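(* Let $n\ge 1$ be an integer and let $p,\lambda\in\mathbb{R}$ satisfy $1<p<\lambda<n$. Then, for every $q>p_1:=\lambda p/(\lambda-p)$ there exists a function $u:\mathbb{R}^n\to\mathbb{R}$ with $u\equiv 0$ in $\mathbb{R}^n\setminus B_1(0)$, $$\|u\|_{L^q(B_1(0))}=\infty\quad\text{and}\quad |||\nabla u|||_{p,\lambda;B_1(0)}<\infty .$$ In particular, we also have $\|\nabla u\|_{M^{p,\lambda}(B_1(0))}<\infty$. Moreover: (i) If $\lambda$ is an integer, such a function $u$ can be taken to be $$u(x)=\left(|x'|^{-\alpha}-2^\alpha\right)_+\,\xi(|x''|),$$ where $x=(x',x'')\in\mathbb{R}^\lambda\times\mathbb{R}^{n-\lambda}$, the parameter $\alpha$ satisfies $$\frac{\lambda}{q}\le\alpha<\frac{\lambda-p}{p},$$ and $\xi:\mathbb{R}^+\to[0,1]$ is a cutoff function with $\xi\equiv1$ in $[0,1/2)$ and $\xi\equiv 0$ in $\mathbb{R}^+\setminus[0,\sqrt3/3)$. (ii) If $k-1<\lambda<k$ for some integer $k\in[2,n]$, the function $u$ can be taken to be $$u(x)=\begin{cases}\left(\mathrm{dist}(x,\mathcal{C}_{n,\lambda})^{-\alpha}-4^\alpha\right)_+ & \text{if } k=n,\\[2pt] \left(\mathrm{dist}(x',\mathcal{C}_{k,\lambda})^{-\alpha}-4^\alpha\right)_+\,\xi(|x''|) & \text{if } k<n,\end{cases}$$ where $x=(x',x'')\in\mathbb{R}^k\times\mathbb{R}^{n-k}$, $\alpha$ satisfies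 $\frac{\lambda}{q}\le\alpha<\frac{\lambda-p}{p}$, $\xi$ is a cutoff function as in (i), and $\mathcal{C}_{k,\lambda}$ is the set of Hausdorff dimension $k-\lambda$ in $\mathbb{R}^k$ given by $$\mathcal{C}_{k,\lambda}=\{0\}\times C_\gamma\subset\mathbb{R}^{k-1}\times[-1/2,1/2],$$ where $C_\gamma\subset[-1/2,1/2]$ is the generalized Cantor set with parameter $\gamma=1-2^{1-\frac{1}{k-\lambda}}$.
   Context: $B_r(y)$ is the open ball in $\mathbb{R}^n$ of radius $r$ centered at $y$; $t_+=\max\{t,0\}$; $\mathbb{R}^+=[0,\infty)$; $\mathrm{dist}(t,U)=\inf_{z\in U}|t-z|$. For a domain $\Omega\subset\mathbb{R}^n$, the Morrey norm is $$\|\nabla u\|_{M^{p,\lambda}(\Omega)}^p:=\sup_{r>0,\,y\in\overline\Omega}\Big(r^{\lambda-n}\int_{\Omega\cap B_r(y)}|\nabla u(x)|^p\,dx\Big),$$ and the "triple norm" is $$|||\nabla u|||_{p,\lambda;\Omega}^p:=\sup_{y\in\overline\Omega}\int_\Omega|\nabla u(x)|^p\,|x-y|^{\lambda-n}\,dx.$$ Here $\nabla u$ is the weak gradient of $u$ (equal a.e. to the classical gradient for the explicit functions above, which are locally Lipschitz outside a closed null set). The explicit functions are understood as defined almost everywhere (their values on the null set where the distance vanishes are irrelevant). Cutoff functions are smooth. Generalized Cantor set $C_\gamma$, $\gamma\in(0,1)$: it is obtained from the interval $[-1/2,1/2]$ by removing, at iteration $j=1,2,\ldots$, the (open) central interval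 of length $\gamma\,l_{j-1}$ from each remaining segment of length $l_{j-1}=((1-\gamma)/2)^{j-1}$; $C_\gamma$ is the set of points that are never removed. (The usual Cantor set corresponds to $\gamma=1/3$.) *)

theory Defs
  imports "HOL-Analysis.Analysis"
begin

section \<open>Smooth functions, weak gradients\<close>

primrec Ck_on :: "nat \<Rightarrow> 'a::real_normed_vector set \<Rightarrow> ('a \<Rightarrow> real) \<Rightarrow> bool" where
  "Ck_on 0 S f \<longleftrightarrow> continuous_on S f"
| "Ck_on (Suc m) S f \<longleftrightarrow>
     (\<forall>x\<in>S. f differentiable (at x)) \<and> (\<forall>v. Ck_on m S (\<lambda>x. frechet_derivative f (at x) v))"

text \<open>Intended for open sets \<open>S\<close> only, since derivatives are taken in the whole space.\<close>

definition smooth_on :: "'a::real_normed_vector set \<Rightarrow> ('a \<Rightarrow> real) \<Rightarrow> bool" where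
  "smooth_on S f \<longleftrightarrow> (\<forall>m. Ck_on m S f)"

definition test_function_on :: "(real ^ 'n) set \<Rightarrow> (real ^ 'n \<Rightarrow> real) \<Rightarrow> bool" where
  "test_function_on \<Omega> \<phi> \<longleftrightarrow> smooth_on UNIV \<phi> \<and>
     compact (closure {x. \<phi> x \<noteq> 0}) \<and> closure {x. \<phi> x \<noteq> 0} \<subseteq> \<Omega>"

definition locally_integrable_on ::
    "'a::euclidean_space set \<Rightarrow> ('a \<Rightarrow> 'b::euclidean_space) \<Rightarrow> bool" where
  "locally_integrable_on \<Omega> f \<longleftrightarrow> (\<forall>K. compact K \<and> K \<subseteq> \<Omega> \<longrightarrow> f absolutely_integrable_on K)"

definition has_weak_gradient_on ::
    "(real ^ 'n \<Rightarrow> real) \<Rightarrow> (real ^ 'n \<Rightarrow> real ^ 'n) \<Rightarrow> (real ^ 'n) set \<Rightarrow> bool" where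
  "has_weak_gradient_on u g \<Omega> \<longleftrightarrow>
     locally_integrable_on \<Omega> u \<and> locally_integrable_on \<Omega> g \<and>
     (\<forall>\<phi> i. test_function_on \<Omega> \<phi> \<longrightarrow>
        (LINT x:\<Omega>|lebesgue. u x * frechet_derivative \<phi> (at x) (axis i 1)) =
        - (LINT x:\<Omega>|lebesgue. g x $ i * \<phi> x))"

section \<open>Norms\<close>

definition ennreal_powr :: "ennreal \<Rightarrow> real \<Rightarrow> ennreal" where
  "ennreal_powr a s = (if a = \<infinity> then \<infinity> else ennreal (enn2real a powr s))"

definition Lq_norm :: "real \<Rightarrow> (real ^ 'n) set \<Rightarrow> (real ^ 'n \<Rightarrow> real) \<Rightarrow> ennreal" where
  "Lq_norm q \<Omega> u =
     ennreal_powr (\<integral>\<^sup>+x\<in>\<Omega>. ennreal (\<bar>u x\<bar> powr q) \<partial>lebesgue) (1 / q)"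

text \<open>In the following two norms \<open>g\<close> stands for the (weak) gradient field.\<close>

definition morrey_norm ::
    "real \<Rightarrow> real \<Rightarrow> (real ^ 'n) set \<Rightarrow> (real ^ 'n \<Rightarrow> real ^ 'n) \<Rightarrow> ennreal" where
  "morrey_norm p lam \<Omega> g =
     ennreal_powr
       (SUP (r, y) \<in> {0<..} \<times> closure \<Omega>.
          ennreal (r powr (lam - real CARD('n))) *
          (\<integral>\<^sup>+x\<in>\<Omega> \<inter> ball y r. ennreal (norm (g x) powr p) \<partial>lebesgue))
       (1 / p)"

text \<open>The junk value \<open>0 powr (lam - n) = 0\<close> at \<open>x = y\<close> only affects a null set.\<close>

definition triple_norm ::
    "real \<Rightarrow> real \<Rightarrow> (real ^ 'n) set \<Rightarrow> (real ^ 'n \<Rightarrow> real ^ 'n) \<Rightarrow> ennreal" where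
  "triple_norm p lam \<Omega> g =
     ennreal_powr
       (SUP y \<in> closure \<Omega>.
          \<integral>\<^sup>+x\<in>\<Omega>. ennreal (norm (g x) powr p * norm (x - y) powr (lam - real CARD('n)))
          \<partial>lebesgue)
       (1 / p)"

text \<open>The weak gradient is required on all of \<open>\<real>\<^sup>n\<close>, not only inside the ball, so that \<open>u\<close>
  cannot be split across the boundary of the ball. It is unique up to null sets, so the
  existential quantifier over \<open>g\<close> does not introduce any choice in the norms.\<close>

definition embedding_counterexample :: "real \<Rightarrow> real \<Rightarrow> real \<Rightarrow> (real ^ 'n \<Rightarrow> real) \<Rightarrow> bool" where
  "embedding_counterexample p lam q u \<longleftrightarrow>
     (\<forall>x. x \<notin> ball 0 1 \<longrightarrow> u x = 0) \<and>
     Lq_norm q (ball 0 1) u = \<infinity> \<and>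
     (\<exists>g. has_weak_gradient_on u g UNIV \<and>
          triple_norm p lam (ball 0 1) g < \<infinity> \<and>
          morrey_norm p lam (ball 0 1) g < \<infinity>)"

section \<open>Splitting of the coordinates and cutoff functions\<close>

text \<open>The order on the index type enumerates the coordinates; positions start at \<open>0\<close>.
  For \<open>x = (x', x'')\<close> in \<open>\<real>\<^sup>k \<times> \<real>\<^sup>n\<^sup>-\<^sup>k\<close>, the components \<open>x'\<close> and \<open>x''\<close> are represented by
  their isometric images \<open>(x', 0)\<close> and \<open>(0, x'')\<close> in \<open>\<real>\<^sup>n\<close>.\<close>

definition coord_pos :: "'n::{finite,linorder} \<Rightarrow> nat" where
  "coord_pos i = card {j. j < i}"

definition first_coords :: "nat \<Rightarrow> real ^ 'n::{finite,linorder} \<Rightarrow> real ^ 'n::{finite,linorder}" where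
  "first_coords k x = (\<chi> i. if coord_pos i < k then x $ i else 0)"

definition last_coords :: "nat \<Rightarrow> real ^ 'n::{finite,linorder} \<Rightarrow> real ^ 'n::{finite,linorder}" where
  "last_coords k x = (\<chi> i. if coord_pos i < k then 0 else x $ i)"

text \<open>Only the values of \<open>\<xi>\<close> on \<open>[0, \<infinity>)\<close> matter. Smoothness at \<open>0\<close> is automatic since \<open>\<xi>\<close> is
  constant on \<open>[0, 1/2)\<close>.\<close>

definition cutoff_function :: "(real \<Rightarrow> real) \<Rightarrow> bool" where
  "cutoff_function \<xi> \<longleftrightarrow> smooth_on {0<..} \<xi> \<and>
     (\<forall>t\<ge>0. 0 \<le> \<xi> t \<and> \<xi> t \<le> 1) \<and>
     (\<forall>t\<in>{0..<1/2}. \<xi> t = 1) \<and>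
     (\<forall>t\<ge>sqrt 3 / 3. \<xi> t = 0)"

section \<open>Generalized Cantor sets\<close>

text \<open>The remaining segments \<open>[a, b]\<close> after \<open>j\<close> iterations, as pairs of end points.\<close>

primrec cantor_segments :: "real \<Rightarrow> nat \<Rightarrow> (real \<times> real) set" where
  "cantor_segments \<gamma> 0 = {(- 1 / 2, 1 / 2)}"
| "cantor_segments \<gamma> (Suc j) =
     (\<Union>(a, b) \<in> cantor_segments \<gamma> j.
        let m = (a + b) / 2; l = ((1 - \<gamma>) / 2) ^ j
        in {(a, m - \<gamma> * l / 2), (m + \<gamma> * l / 2, b)})"

definition cantor_set :: "real \<Rightarrow> real set" where
  "cantor_set \<gamma> = (\<Inter>j. \<Union>(a, b) \<in> cantor_segments \<gamma> j. {a..b})"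

text \<open>The set \<open>{0} \<times> C\<^sub>\<gamma>\<close> in \<open>\<real>\<^sup>k\<^sup>-\<^sup>1 \<times> \<real>\<close>, viewed inside \<open>\<real>\<^sup>k \<times> {0}\<close> in \<open>\<real>\<^sup>n\<close>.\<close>

definition cantor_embedded :: "nat \<Rightarrow> real \<Rightarrow> (real ^ 'n::{finite,linorder}) set" where
  "cantor_embedded k lam =
     {x. \<forall>i. if Suc (coord_pos i) = k
             then x $ i \<in> cantor_set (1 - 2 powr (1 - 1 / (real k - lam)))
             else x $ i = 0}"

section \<open>Hausdorff dimension\<close>

definition hausdorff_premeasure :: "real \<Rightarrow> real \<Rightarrow> 'a::metric_space set \<Rightarrow> ennreal" where
  "hausdorff_premeasure s \<delta> A =
     (INF U \<in> {U :: nat \<Rightarrow> 'a set. A \<subseteq> (\<Union>i. U i) \<and> (\<forall>i. bounded (U i) \<and> diameter (U i) \<le> \<delta>)}.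
        \<Sum>i. ennreal (diameter (U i) powr s))"

definition hausdorff_measure :: "real \<Rightarrow> 'a::metric_space set \<Rightarrow> ennreal" where
  "hausdorff_measure s A = (SUP \<delta>\<in>{0<..}. hausdorff_premeasure s \<delta> A)"

text \<open>Only exponents \<open>s > 0\<close> are used, which avoids \<open>0 powr 0 = 0\<close>. In a Euclidean space the
  infimum is over a nonempty set.\<close>

definition hausdorff_dimension :: "'a::euclidean_space set \<Rightarrow> real" where
  "hausdorff_dimension A = Inf {s. 0 < s \<and> hausdorff_measure s A = 0}"

end

theory Submission
  imports Defs
begin

text \<open>
  The functions in question are truncated negative powers \<open>d\<close> to the power \<open>- \<alpha>\<close> of the distance \<open>d\<close> to a set \<open>F\<close>
  of codimension \<open>lam\<close>, multiplied by a cutoff function in the directions along which \<open>F\<close> is a product: \<open>F\<close> is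
  \<open>{0} \<times> \<real>\<close> to the power \<open>n - lam\<close> if \<open>lam\<close> is an integer, and otherwise a Cantor set in a line times
  \<open>\<real>\<close> to the power \<open>n - k\<close>. Two measure estimates for \<open>F\<close> decide everything. In a ball of radius \<open>r \<ge> t\<close> the
  set \<open>{d < t}\<close> has measure at most of the order \<open>t\<close> to the power \<open>lam\<close> times \<open>r\<close> to the power \<open>n - lam\<close>, and for
  arbitrarily small \<open>t\<close> its part near the origin has measure at least of the order \<open>t\<close> to the power \<open>lam\<close>.

  The upper estimate and two dyadic decompositions, one in \<open>d\<close> and one in \<open>|x - y|\<close>, bound the integral of \<open>d\<close> to
  the power \<open>- s\<close> times \<open>|x - y|\<close> to the power \<open>lam - n\<close> uniformly in \<open>y\<close> whenever \<open>s < lam\<close>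
  (\<open>integral_d_powr_kernel\<close>). The gradient of \<open>u\<close> is bounded by a multiple of \<open>d\<close> to the power \<open>- (\<alpha> + 1)\<close>, and
  \<open>(\<alpha> + 1) p < lam\<close> is the upper restriction on \<open>\<alpha>\<close>; so the triple norm is finite
  (\<open>triple_norm_gradient\<close>), and since \<open>lam < n\<close> it controls the Morrey norm (\<open>morrey_norm_finite\<close>). By the lower estimate
  and \<open>\<alpha> q \<ge> lam\<close>, the integrals of \<open>u\<^sup>q\<close> over the shrinking sets \<open>{0 < d < t}\<close> do not tend to 0, so \<open>u\<close> is
  not in \<open>L\<^sup>q\<close> (\<open>Lq_norm_u\<close>).

  Both measure estimates reduce, by counting boxes, to covering and packing numbers of a set \<open>C\<close> in the line
  (\<open>upper_regular\<close>, \<open>lower_regular\<close>), where \<open>C\<close> is a point or the Cantor set. For the Cantor set they follow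
  from a Hoelder estimate for the map from left end points of segments to their binary addresses (\<open>cantor_left_Hoelder\<close>).
  The same estimate gives the lower bound for the Hausdorff dimension, because it turns a cover of the Cantor set
  into a cover of \<open>[0, 1)\<close> by intervals.

  For the weak gradient, the square of the distance to \<open>C\<close> differs from \<open>s\<^sup>2\<close> by a convex function, hence is
  differentiable outside a countable set (\<open>infdist_squared_differentiable\<close>), and \<open>d\<^sup>2\<close> has partial derivatives almost
  everywhere. The function \<open>u\<close> is the limit of Lipschitz functions of \<open>d\<^sup>2\<close> with the singularity and the kink smoothed
  out. Integration by parts for these is translation invariance of the integral of difference quotients
  (\<open>integration_by_parts_Lipschitz\<close>), and it passes to the limit because \<open>d\<close> to the power \<open>- (\<alpha> + 1)\<close> is a locally
  integrable majorant.
\<close>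

section \<open>The generalized Cantor set\<close>

text \<open>The left end points of the segments of level \<open>j\<close>; the binary digits of the address \<open>m\<close> record, from the
  most significant one on, whether the left or the right half was chosen.\<close>
primrec cantor_left :: "real \<Rightarrow> nat \<Rightarrow> nat \<Rightarrow> real" where
  "cantor_left \<rho> 0 m = - 1 / 2"
| "cantor_left \<rho> (Suc j) m = cantor_left \<rho> j (m div 2) + (1 - \<rho>) * \<rho> ^ j * real (m mod 2)"

lemma cantor_segments_eq:
  assumes "\<rho> = (1 - \<gamma>) / 2"
  shows "cantor_segments \<gamma> j = (\<lambda>m. (cantor_left \<rho> j m, cantor_left \<rho> j m + \<rho> ^ j)) ` {..<2 ^ j}"
proof (induction j)
  case 0
  then show ?case by (simp add: lessThan_Suc)
next
  case (Suc j)
  let ?f = "\<lambda>j m. (cantor_left \<rho> j m, cantor_left \<rho> j m + \<rho> ^ j)"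
  have \<gamma>: "\<gamma> = 1 - 2 * \<rho>" using assms by simp
  have children: "(let m = (a + b) / 2; l = ((1 - \<gamma>) / 2) ^ j in {(a, m - \<gamma> * l / 2), (m + \<gamma> * l / 2, b)})
      = {?f (Suc j) (2 * m), ?f (Suc j) (2 * m + 1)}"
    if "(a, b) = ?f j m" for a b m
  proof -
    have "Suc (2 * m) mod 2 = 1" by presburger
    then show ?thesis using that unfolding assms[symmetric] \<gamma>
      by (auto simp: Let_def field_simps)
  qed
  have range: "{..<2 ^ Suc j} = (\<Union>m\<in>{..<2 ^ j}. {2 * m, 2 * m + 1 :: nat})" (is "?l = ?r")
  proof
    show "?l \<subseteq> ?r"
    proof
      fix x :: nat assume "x \<in> ?l"
      then have "x div 2 < 2 ^ j" "x = 2 * (x div 2) \<or> x = 2 * (x div 2) + 1" by auto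
      then show "x \<in> ?r" by blast
    qed
    show "?r \<subseteq> ?l" by auto
  qed
  have "cantor_segments \<gamma> (Suc j) = (\<Union>m\<in>{..<2 ^ j}. {?f (Suc j) (2 * m), ?f (Suc j) (2 * m + 1)})"
    unfolding cantor_segments.simps(2) Suc image_UN UN_simps using children by (intro SUP_cong) auto
  also have "\<dots> = ?f (Suc j) ` {..<2 ^ Suc j}"
    unfolding range by (simp add: image_UN)
  finally show ?case .
qed

lemma cantor_set_eq:
  assumes "\<rho> = (1 - \<gamma>) / 2"
  shows "cantor_set \<gamma> = (\<Inter>j. \<Union>m\<in>{..<2 ^ j}. {cantor_left \<rho> j m .. cantor_left \<rho> j m + \<rho> ^ j})"
  unfolding cantor_set_def cantor_segments_eq[OF assms] by simp

lemma closed_cantor_set: "closed (cantor_set \<gamma>)"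
  unfolding cantor_set_eq[OF refl] by (intro closed_INT ballI closed_UN) auto

text \<open>Appending binary digits \<open>0\<close> does not move a left end point.\<close>
lemma cantor_left_shift: "cantor_left \<rho> (j + i) (m * 2 ^ i) = cantor_left \<rho> j m"
  by (induction i) (auto simp: mult.assoc[symmetric] mult.commute)

text \<open>Dropping the last \<open>i\<close> digits of an address leads to an ancestor; the two inequalities say that the segment
  of the ancestor contains the segment of the descendant.\<close>
lemma cantor_left_div:
  assumes "0 \<le> \<rho>" "\<rho> \<le> 1"
  shows "cantor_left \<rho> j (m div 2 ^ i) \<le> cantor_left \<rho> (j + i) m \<and>
         cantor_left \<rho> (j + i) m + \<rho> ^ (j + i) \<le> cantor_left \<rho> j (m div 2 ^ i) + \<rho> ^ j"
proof (induction i arbitrary: m)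
  case 0
  then show ?case by simp
next
  case (Suc i)
  have "m div 2 ^ Suc i = m div 2 div 2 ^ i" by (simp add: div_mult2_eq)
  moreover have "0 \<le> (1 - \<rho>) * \<rho> ^ (j + i) * real (m mod 2)" using assms by simp
  moreover have "(1 - \<rho>) * \<rho> ^ (j + i) * real (m mod 2) \<le> (1 - \<rho>) * \<rho> ^ (j + i)"
    using assms by (intro mult_left_le) auto
  ultimately show ?case using Suc[of "m div 2"] by (simp add: algebra_simps)
qed

text \<open>At earlier levels the point lies in the segment of its ancestor, at later levels it is still a left end point,
  with an address padded by zeros.\<close>
lemma cantor_left_in_cantor_set:
  assumes "0 \<le> \<rho>" "\<rho> \<le> 1" "\<rho> = (1 - \<gamma>) / 2" "m < 2 ^ j"
  shows "cantor_left \<rho> j m \<in> cantor_set \<gamma>"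
  unfolding cantor_set_eq[OF assms(3)]
proof
  fix i :: nat
  let ?k = "if j \<le> i then m * 2 ^ (i - j) else m div 2 ^ (j - i)"
  have "?k < 2 ^ i"
  proof (cases "j \<le> i")
    case True
    then have "(2::nat) ^ i = 2 ^ j * 2 ^ (i - j)" by (simp flip: power_add)
    then show ?thesis using True assms(4) by simp
  next
    case False
    then have "(2::nat) ^ j = 2 ^ (j - i) * 2 ^ i" by (simp flip: power_add)
    then show ?thesis using False assms(4) by (simp add: less_mult_imp_div_less mult.commute)
  qed
  moreover have "cantor_left \<rho> j m \<in> {cantor_left \<rho> i ?k .. cantor_left \<rho> i ?k + \<rho> ^ i}"
  proof (cases "j \<le> i")
    case True
    then show ?thesis using cantor_left_shift[of \<rho> j "i - j" m] assms(1) by simp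
  next
    case False
    have "0 \<le> \<rho> ^ j" using assms(1) by simp
    then show ?thesis using False cantor_left_div[OF assms(1,2), of i m "j - i"] by simp
  qed
  ultimately show "cantor_left \<rho> j m \<in> (\<Union>m\<in>{..<2 ^ i}. {cantor_left \<rho> i m .. cantor_left \<rho> i m + \<rho> ^ i})"
    by blast
qed

lemma cantor_set_covered:
  assumes "\<rho> = (1 - \<gamma>) / 2" "s \<in> cantor_set \<gamma>"
  obtains m where "m < 2 ^ j" "cantor_left \<rho> j m \<le> s" "s \<le> cantor_left \<rho> j m + \<rho> ^ j"
  using assms(2) unfolding cantor_set_eq[OF assms(1)] by auto

lemma cantor_set_subset: "cantor_set \<gamma> \<subseteq> {- 1 / 2 .. 1 / 2}"
proof
  fix s assume "s \<in> cantor_set \<gamma>"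
  then show "s \<in> {- 1 / 2 .. 1 / 2}"
    by (rule cantor_set_covered[OF refl, of _ _ 0]) simp
qed

text \<open>Two segments of level \<open>j\<close> whose addresses split at step \<open>i\<close> are separated by the gap of length
  \<open>(1 - 2 \<rho>) \<rho>\<^sup>i\<close> removed at that step; the additional \<open>\<rho>\<^sup>j\<close> is the length of the left segment and makes
  the induction on \<open>j\<close> work.\<close>
lemma cantor_left_gap:
  assumes "0 \<le> \<rho>" "\<rho> \<le> 1" "m < m'" "m' < 2 ^ j"
  shows "\<exists>i<j. m' - m < 2 ^ (j - i) \<and>
    cantor_left \<rho> j m' - cantor_left \<rho> j m \<ge> (1 - 2 * \<rho>) * \<rho> ^ i + \<rho> ^ j"
  using assms(3,4)
proof (induction j arbitrary: m m')
  case 0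
  then show ?case by simp
next
  case (Suc j)
  show ?case
  proof (cases "m div 2 = m' div 2")
    case True
    then have m: "m mod 2 = 0" "m' mod 2 = 1" "m' = m + 1" using Suc.prems(1) by presburger+
    show ?thesis
      using True m(1,2) by (intro exI[of _ j]) (simp add: m(3) algebra_simps)
  next
    case False
    then have "m div 2 < m' div 2" using Suc.prems(1) by (simp add: div_le_mono le_neq_implies_less)
    moreover have "m' div 2 < 2 ^ j" using Suc.prems(2) by auto
    ultimately obtain i where i: "i < j" "m' div 2 - m div 2 < 2 ^ (j - i)"
      "cantor_left \<rho> j (m' div 2) - cantor_left \<rho> j (m div 2) \<ge> (1 - 2 * \<rho>) * \<rho> ^ i + \<rho> ^ j"
      using Suc.IH by blast
    have "m' - m \<le> 2 * (m' div 2 - m div 2) + 1" by presburger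
    also have "\<dots> < 2 * 2 ^ (j - i)" using i(2) by simp
    also have "\<dots> = 2 ^ (Suc j - i)" using i(1) by (simp add: Suc_diff_le)
    finally have *: "m' - m < 2 ^ (Suc j - i)" .
    have "0 \<le> (1 - \<rho>) * \<rho> ^ j * real (m' mod 2)" using assms by simp
    moreover have "(1 - \<rho>) * \<rho> ^ j * real (m mod 2) \<le> (1 - \<rho>) * \<rho> ^ j"
      using assms by (intro mult_left_le) auto
    ultimately show ?thesis using i(1,3) * by (intro exI[of _ i]) (simp add: algebra_simps)
  qed
qed

text \<open>With \<open>2 \<rho>\<^sup>\<theta> = 1\<close> the gap estimate says that the address map is Hoelder continuous.\<close>
lemma cantor_left_Hoelder:
  assumes "0 < \<rho>" "\<rho> < 1 / 2" "2 * \<rho> powr \<theta> = 1" "0 < \<theta>" "m < 2 ^ j" "m' < 2 ^ j"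
  shows "\<bar>real m - real m'\<bar> / 2 ^ j \<le>
    (1 / (1 - 2 * \<rho>)) powr \<theta> * \<bar>cantor_left \<rho> j m - cantor_left \<rho> j m'\<bar> powr \<theta>"
proof -
  have main: "(real m' - real m) / 2 ^ j \<le>
      (1 / (1 - 2 * \<rho>)) powr \<theta> * \<bar>cantor_left \<rho> j m - cantor_left \<rho> j m'\<bar> powr \<theta>"
    if less: "m < m'" "m' < 2 ^ j" for m m'
  proof -
    obtain i where i: "i < j" "m' - m < 2 ^ (j - i)"
      "cantor_left \<rho> j m' - cantor_left \<rho> j m \<ge> (1 - 2 * \<rho>) * \<rho> ^ i + \<rho> ^ j"
      using cantor_left_gap[OF _ _ less, of \<rho>] assms by force
    let ?D = "cantor_left \<rho> j m' - cantor_left \<rho> j m"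
    have D: "(1 - 2 * \<rho>) * \<rho> ^ i \<le> ?D" using i(3) assms(1) zero_le_power[of \<rho> j] by linarith
    have "real m' - real m = real (m' - m)" using less by simp
    also have "\<dots> \<le> 2 ^ (j - i)" using i(2) by (metis less_imp_le of_nat_less_iff of_nat_numeral of_nat_power)
    finally have "(real m' - real m) / 2 ^ j \<le> 2 ^ (j - i) / 2 ^ j" by (simp add: divide_right_mono)
    also have "\<dots> = (1 / 2) ^ i" using i(1) by (simp add: power_diff field_simps)
    also have "\<dots> = (\<rho> powr \<theta>) ^ i" using assms(3) by (metis nonzero_mult_div_cancel_left zero_neq_numeral)
    also have "\<dots> = (\<rho> ^ i) powr \<theta>" using assms(1) by (simp add: powr_powr powr_realpow[symmetric] mult.commute)
    also have "\<dots> \<le> (?D / (1 - 2 * \<rho>)) powr \<theta>"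
      using assms D by (intro powr_mono2) (auto simp: field_simps)
    also have "\<dots> = (1 / (1 - 2 * \<rho>)) powr \<theta> * \<bar>?D\<bar> powr \<theta>"
    proof -
      have "0 \<le> (1 - 2 * \<rho>) * \<rho> ^ i" using assms by simp
      then have "0 \<le> ?D" using D by linarith
      then show ?thesis using assms by (simp add: powr_divide powr_mult)
    qed
    finally show ?thesis by (simp add: abs_minus_commute)
  qed
  show ?thesis
  proof (cases m m' rule: linorder_cases)
    case less
    then show ?thesis using main[OF less assms(6)] by simp
  next
    case equal
    then show ?thesis by simp
  next
    case greater
    then show ?thesis using main[OF greater assms(5)] by (simp add: abs_minus_commute)
  qed
qed

text \<open>The two halves of the statement that \<open>C\<close> has dimension \<open>\<theta>\<close>, in a quantitative form that holds at every
  location and scale for the covering numbers, and along a sequence of scales for the packing numbers.\<close>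
definition upper_regular :: "real \<Rightarrow> real set \<Rightarrow> bool" where
  "upper_regular \<theta> C \<longleftrightarrow> (\<exists>B>0. \<forall>y t r. 0 < t \<and> t \<le> r \<longrightarrow>
     (\<exists>S. finite S \<and> real (card S) \<le> B * (r / t) powr \<theta> \<and>
        C \<inter> {y - r<..<y + r} \<subseteq> (\<Union>c\<in>S. {c - t..c + t})))"

definition lower_regular :: "real \<Rightarrow> real set \<Rightarrow> bool" where
  "lower_regular \<theta> C \<longleftrightarrow> (\<exists>b>0. \<forall>\<epsilon>>0. \<exists>t S. 0 < t \<and> t < \<epsilon> \<and> finite S \<and> S \<subseteq> C \<and>
     b * t powr (- \<theta>) \<le> real (card S) \<and> (\<forall>c\<in>S. \<forall>c'\<in>S. c \<noteq> c' \<longrightarrow> t \<le> \<bar>c - c'\<bar>))"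

lemma upper_regular_singleton: "upper_regular 0 {a}"
  unfolding upper_regular_def
proof (rule exI[of _ 1], intro conjI allI impI)
  fix y t r :: real assume "0 < t \<and> t \<le> r"
  then show "\<exists>S. finite S \<and> real (card S) \<le> 1 * (r / t) powr 0 \<and> {a} \<inter> {y - r<..<y + r} \<subseteq> (\<Union>c\<in>S. {c - t..c + t})"
    by (intro exI[of _ "{a}"]) auto
qed simp

lemma lower_regular_singleton: "lower_regular 0 {a}"
  unfolding lower_regular_def
proof (rule exI[of _ 1], intro conjI allI impI)
  fix \<epsilon> :: real assume "0 < \<epsilon>"
  then show "\<exists>t S. 0 < t \<and> t < \<epsilon> \<and> finite S \<and> S \<subseteq> {a} \<and>
     1 * t powr (- 0) \<le> real (card S) \<and> (\<forall>c\<in>S. \<forall>c'\<in>S. c \<noteq> c' \<longrightarrow> t \<le> \<bar>c - c'\<bar>)"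
    by (intro exI[of _ "\<epsilon> / 2"] exI[of _ "{a}"]) auto
qed simp

text \<open>The equation \<open>2 \<rho>\<^sup>\<theta> = 1\<close> says that the two halves of the set, each scaled by \<open>\<rho>\<close>, have similarity
  dimension \<open>\<theta>\<close>.\<close>
locale cantor_ratio =
  fixes \<rho> \<theta> \<gamma> :: real
  assumes \<rho>_pos: "0 < \<rho>" and \<rho>_less: "\<rho> < 1 / 2" and \<theta>_pos: "0 < \<theta>"
    and dimension: "2 * \<rho> powr \<theta> = 1" and \<rho>_eq: "\<rho> = (1 - \<gamma>) / 2"
begin

lemma \<rho>_le_1: "0 \<le> \<rho>" "\<rho> \<le> 1"
  using \<rho>_pos \<rho>_less by auto

lemma power_powr_\<theta>: "(\<rho> ^ j) powr \<theta> = 1 / 2 ^ j"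
proof -
  have "\<rho> powr \<theta> = 1 / 2" using dimension by simp
  moreover have "(\<rho> ^ j) powr \<theta> = (\<rho> powr \<theta>) ^ j"
    using \<rho>_pos by (simp add: powr_powr powr_realpow[symmetric] mult.commute)
  ultimately show ?thesis by (simp only: power_one_over[symmetric])
qed

abbreviation hoelder_const :: real where
  "hoelder_const \<equiv> (1 / (1 - 2 * \<rho>)) powr \<theta>"

lemma hoelder_const_pos: "0 < hoelder_const"
  using \<rho>_less by simp

lemmas Hoelder = cantor_left_Hoelder[OF \<rho>_pos \<rho>_less dimension \<theta>_pos]

text \<open>By the Hoelder estimate the left end points of level \<open>j\<close> in an interval of length \<open>4r\<close> have addresses
  in an integer interval of length at most a constant times \<open>2\<^sup>j r\<^sup>\<theta>\<close>.\<close>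
lemma upper_regular_cantor: "upper_regular \<theta> (cantor_set \<gamma>)"
proof -
  define B where "B = 2 * hoelder_const * 4 powr \<theta> + 1"
  have B1: "B \<ge> 1" using hoelder_const_pos unfolding B_def by simp
  show ?thesis
    unfolding upper_regular_def
  proof (rule exI[of _ B], intro conjI allI impI)
    show "0 < B" using B1 by simp
    fix y t r :: real assume "0 < t \<and> t \<le> r"
    then have t: "0 < t" "t \<le> r" by auto
    have rt: "1 \<le> (r / t) powr \<theta>" using t \<theta>_pos by (intro ge_one_powr_ge_zero) auto
    have ex: "\<exists>j. \<rho> ^ j \<le> t"
      using real_arch_pow_inv[OF t(1), of \<rho>] \<rho>_less by (auto intro: less_imp_le)
    \<comment> \<open>The first level whose segments have length at most \<open>t\<close>: there are only of the order \<open>t\<close> to the power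
      \<open>- \<theta>\<close> of them, because the segments of the previous level are longer than \<open>t\<close>.\<close>
    define j where "j = (LEAST j. \<rho> ^ j \<le> t)"
    have j: "\<rho> ^ j \<le> t" unfolding j_def by (rule LeastI_ex[OF ex])
    have j': "2 ^ j \<le> 2 * t powr (- \<theta>)" if "j \<noteq> 0"
    proof -
      obtain i where i: "j = Suc i" using \<open>j \<noteq> 0\<close> not0_implies_Suc by blast
      have "t < \<rho> ^ i" using not_less_Least[of i "\<lambda>j. \<rho> ^ j \<le> t"] i unfolding j_def by simp
      then have "t powr \<theta> \<le> (\<rho> ^ i) powr \<theta>" using t \<theta>_pos by (intro powr_mono2) auto
      then have "t powr \<theta> \<le> 1 / 2 ^ i" by (simp only: power_powr_\<theta>)
      then have "2 ^ i \<le> 1 / t powr \<theta>" using t by (simp add: field_simps)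
      then show ?thesis using i t by (simp add: powr_minus_divide)
    qed
    define M where "M = {m. m < 2 ^ j \<and> \<bar>cantor_left \<rho> j m - y\<bar> < 2 * r}"
    have fin: "finite M" unfolding M_def by simp
    have cardM: "real (card M) \<le> 2 ^ j * hoelder_const * (4 * r) powr \<theta> + 1"
    proof (cases "M = {}")
      case True
      then show ?thesis using hoelder_const_pos by simp
    next
      case False
      have "M \<subseteq> {Min M..Max M}" using fin by auto
      then have "card M \<le> Suc (Max M) - Min M" using card_mono[of "{Min M..Max M}" M] by simp
      moreover have "Min M \<le> Max M" using fin False by simp
      ultimately have 1: "real (card M) \<le> \<bar>real (Max M) - real (Min M)\<bar> + 1" by linarith
      have in_M: "Max M \<in> M" "Min M \<in> M" using fin False by auto
      then have "\<bar>cantor_left \<rho> j (Max M) - cantor_left \<rho> j (Min M)\<bar> \<le> 4 * r" unfolding M_def by auto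
      then have "\<bar>cantor_left \<rho> j (Max M) - cantor_left \<rho> j (Min M)\<bar> powr \<theta> \<le> (4 * r) powr \<theta>"
        using \<theta>_pos by (intro powr_mono2) auto
      then have "\<bar>real (Max M) - real (Min M)\<bar> / 2 ^ j \<le> hoelder_const * (4 * r) powr \<theta>"
        using Hoelder[of "Max M" j "Min M"] in_M hoelder_const_pos unfolding M_def
        by (auto intro: order_trans mult_left_mono)
      then show ?thesis using 1 by (simp add: field_simps)
    qed
    have "real (card M) \<le> B * (r / t) powr \<theta>"
    proof (cases "j = 0")
      case True
      then have "M \<subseteq> {0}" unfolding M_def by auto
      then have "card M \<le> card {0::nat}" by (intro card_mono) auto
      then have "real (card M) \<le> 1" by simp
      also have "1 = 1 * (1::real)" by simp
      also have "\<dots> \<le> B * (r / t) powr \<theta>" using B1 rt by (intro mult_mono) auto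
      finally show ?thesis .
    next
      case False
      have "2 ^ j * (hoelder_const * (4 * r) powr \<theta>) \<le> (2 * t powr (- \<theta>)) * (hoelder_const * (4 * r) powr \<theta>)"
        using j'[OF False] hoelder_const_pos by (intro mult_right_mono) auto
      also have "\<dots> = (2 * hoelder_const * 4 powr \<theta>) * (r / t) powr \<theta>"
        using t by (simp add: powr_mult powr_divide powr_minus_divide mult_ac)
      finally have "real (card M) \<le> (2 * hoelder_const * 4 powr \<theta>) * (r / t) powr \<theta> + 1"
        using cardM by (simp add: mult.assoc)
      then show ?thesis using rt unfolding B_def by (simp add: algebra_simps)
    qed
    then have card: "real (card (cantor_left \<rho> j ` M)) \<le> B * (r / t) powr \<theta>"
      using card_image_le[OF fin, of "cantor_left \<rho> j"] by linarith
    have "s \<in> (\<Union>c\<in>cantor_left \<rho> j ` M. {c - t..c + t})" if s: "s \<in> cantor_set \<gamma> \<inter> {y - r<..<y + r}" for s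
    proof -
      obtain m where m: "m < 2 ^ j" "cantor_left \<rho> j m \<le> s" "s \<le> cantor_left \<rho> j m + \<rho> ^ j"
        using cantor_set_covered[OF \<rho>_eq] s by blast
      then have "m \<in> M" "s \<in> {cantor_left \<rho> j m - t..cantor_left \<rho> j m + t}" using s j t unfolding M_def by auto
      then show ?thesis by blast
    qed
    then show "\<exists>S. finite S \<and> real (card S) \<le> B * (r / t) powr \<theta> \<and>
        cantor_set \<gamma> \<inter> {y - r<..<y + r} \<subseteq> (\<Union>c\<in>S. {c - t..c + t})"
      using fin card by (intro exI[of _ "cantor_left \<rho> j ` M"]) auto
  qed
qed

lemma cantor_left_separated:
  assumes "m < 2 ^ j" "m' < 2 ^ j" "m \<noteq> m'"
  shows "(1 - 2 * \<rho>) * \<rho> ^ j \<le> \<bar>cantor_left \<rho> j m - cantor_left \<rho> j m'\<bar>"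
proof -
  have "(1 - 2 * \<rho>) * \<rho> ^ j \<le> cantor_left \<rho> j m' - cantor_left \<rho> j m" if mm: "m < m'" "m' < 2 ^ j" for m m'
  proof -
    obtain i where "cantor_left \<rho> j m' - cantor_left \<rho> j m \<ge> (1 - 2 * \<rho>) * \<rho> ^ i + \<rho> ^ j"
      using cantor_left_gap[OF \<rho>_le_1 mm] by blast
    moreover have "0 \<le> (1 - 2 * \<rho>) * \<rho> ^ i" "(1 - 2 * \<rho>) * \<rho> ^ j \<le> 1 * \<rho> ^ j"
      using \<rho>_pos \<rho>_less by (auto intro!: mult_right_mono)
    ultimately show ?thesis by linarith
  qed
  from this[of m m'] this[of m' m] assms show ?thesis by (cases m m' rule: linorder_cases) auto
qed

text \<open>The \<open>2\<^sup>j\<close> left end points of level \<open>j\<close> are separated by a constant times \<open>\<rho>\<^sup>j\<close>.\<close>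
lemma lower_regular_cantor: "lower_regular \<theta> (cantor_set \<gamma>)"
  unfolding lower_regular_def
proof (rule exI[of _ "(1 - 2 * \<rho>) powr \<theta>"], intro conjI allI impI)
  show "0 < (1 - 2 * \<rho>) powr \<theta>" using \<rho>_less by simp
  fix \<epsilon> :: real assume "0 < \<epsilon>"
  then obtain j where j: "\<rho> ^ j < \<epsilon>" using real_arch_pow_inv[of \<epsilon> \<rho>] \<rho>_less by auto
  define t where "t = (1 - 2 * \<rho>) * \<rho> ^ j"
  have t: "0 < t" unfolding t_def using \<rho>_pos \<rho>_less by simp
  have "(1 - 2 * \<rho>) * \<rho> ^ j \<le> 1 * \<rho> ^ j" using \<rho>_pos by (intro mult_right_mono) auto
  then have "t < \<epsilon>" using j unfolding t_def by simp
  define S where "S = cantor_left \<rho> j ` {..<2 ^ j}"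
  have sep: "\<forall>c\<in>S. \<forall>c'\<in>S. c \<noteq> c' \<longrightarrow> t \<le> \<bar>c - c'\<bar>"
    unfolding S_def t_def using cantor_left_separated by blast
  have "inj_on (cantor_left \<rho> j) {..<2 ^ j}"
  proof (rule inj_onI, rule ccontr)
    fix m m' assume "m \<in> {..<2 ^ j}" "m' \<in> {..<2 ^ j}" "cantor_left \<rho> j m = cantor_left \<rho> j m'" "m \<noteq> m'"
    then show False using cantor_left_separated[of m j m'] t unfolding t_def by simp
  qed
  then have "card S = 2 ^ j" unfolding S_def by (simp add: card_image)
  moreover have "(1 - 2 * \<rho>) powr \<theta> * t powr (- \<theta>) = 2 ^ j"
    using \<rho>_pos \<rho>_less by (simp add: t_def powr_minus_divide powr_mult power_powr_\<theta>)
  ultimately have card: "(1 - 2 * \<rho>) powr \<theta> * t powr (- \<theta>) \<le> real (card S)" by simp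
  have "S \<subseteq> cantor_set \<gamma>" unfolding S_def using cantor_left_in_cantor_set[OF \<rho>_le_1 \<rho>_eq] by auto
  then show "\<exists>t S. 0 < t \<and> t < \<epsilon> \<and> finite S \<and> S \<subseteq> cantor_set \<gamma> \<and>
     (1 - 2 * \<rho>) powr \<theta> * t powr (- \<theta>) \<le> real (card S) \<and> (\<forall>c\<in>S. \<forall>c'\<in>S. c \<noteq> c' \<longrightarrow> t \<le> \<bar>c - c'\<bar>)"
    using t \<open>t < \<epsilon>\<close> card sep by (intro exI[of _ t] exI[of _ S]) (auto simp: S_def)
qed

text \<open>An inverse of the Cantor function: the limit of the left end points addressed by the binary digits.
  The Hoelder estimate for the addresses passes to the limit.\<close>
lemma inverse_cantor_function:
  obtains g where "\<And>x. 0 \<le> x \<Longrightarrow> x < 1 \<Longrightarrow> g x \<in> cantor_set \<gamma>"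
    "\<And>x y. 0 \<le> x \<Longrightarrow> x < 1 \<Longrightarrow> 0 \<le> y \<Longrightarrow> y < 1 \<Longrightarrow> \<bar>x - y\<bar> \<le> hoelder_const * \<bar>g x - g y\<bar> powr \<theta>"
proof -
  define ad where "ad = (\<lambda>(x::real) (j::nat). nat \<lfloor>2 ^ j * x\<rfloor>)"
  define g where "g = (\<lambda>x. lim (\<lambda>j. cantor_left \<rho> j (ad x j)))"
  have ad_less: "ad x j < 2 ^ j" if "0 \<le> x" "x < 1" for x j
  proof -
    have "2 ^ j * x < 2 ^ j" using that by simp
    then show ?thesis unfolding ad_def using that by (simp add: nat_less_iff floor_less_iff)
  qed
  have ad_close: "\<bar>real (ad x j) - 2 ^ j * x\<bar> \<le> 1" if "0 \<le> x" for x j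
  proof -
    have "real (ad x j) = of_int \<lfloor>2 ^ j * x\<rfloor>" unfolding ad_def using that by simp
    then show ?thesis by linarith
  qed
  have ad_div: "ad x (Suc j) div 2 = ad x j" if "0 \<le> x" for x j
  proof -
    have "\<lfloor>2 ^ j * x\<rfloor> = \<lfloor>2 ^ Suc j * x\<rfloor> div 2"
      using floor_divide_real_eq_div[of 2 "2 ^ Suc j * x"] by simp
    moreover have "0 \<le> \<lfloor>2 ^ Suc j * x\<rfloor>" using that by simp
    ultimately show ?thesis unfolding ad_def by (simp only: nat_div_distrib nat_numeral)
  qed
  have in_C: "cantor_left \<rho> j (ad x j) \<in> cantor_set \<gamma>" if "0 \<le> x" "x < 1" for x j
    using cantor_left_in_cantor_set[OF \<rho>_le_1 \<rho>_eq ad_less[OF that]] .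
  have lim: "(\<lambda>j. cantor_left \<rho> j (ad x j)) \<longlonglongrightarrow> g x" if "0 \<le> x" "x < 1" for x
  proof -
    have "incseq (\<lambda>j. cantor_left \<rho> j (ad x j))"
    proof (rule incseq_SucI)
      fix j show "cantor_left \<rho> j (ad x j) \<le> cantor_left \<rho> (Suc j) (ad x (Suc j))"
        using cantor_left_div[OF \<rho>_le_1, of j "ad x (Suc j)" 1] ad_div[OF that(1)] by simp
    qed
    moreover have "\<forall>j. cantor_left \<rho> j (ad x j) \<le> 1 / 2"
      using in_C[OF that] cantor_set_subset[of \<gamma>] by fastforce
    ultimately have "convergent (\<lambda>j. cantor_left \<rho> j (ad x j))"
      by (meson convergentI incseq_convergent)
    then show ?thesis unfolding g_def by (simp add: convergent_LIMSEQ_iff)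
  qed
  show ?thesis
  proof (rule that[of g])
    show "g x \<in> cantor_set \<gamma>" if "0 \<le> x" "x < 1" for x
      using closed_sequentially[OF closed_cantor_set in_C[OF that] lim[OF that]] .
    show "\<bar>x - y\<bar> \<le> hoelder_const * \<bar>g x - g y\<bar> powr \<theta>" if "0 \<le> x" "x < 1" "0 \<le> y" "y < 1" for x y
    proof (rule LIMSEQ_le)
      show "(\<lambda>j. hoelder_const * \<bar>cantor_left \<rho> j (ad x j) - cantor_left \<rho> j (ad y j)\<bar> powr \<theta>)
          \<longlonglongrightarrow> hoelder_const * \<bar>g x - g y\<bar> powr \<theta>"
        using lim that \<theta>_pos by (intro tendsto_intros tendsto_powr') auto
      have "(\<lambda>j. 2 * (1 / 2) ^ j) \<longlonglongrightarrow> 2 * (0::real)"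
        by (intro tendsto_mult tendsto_const LIMSEQ_power_zero) auto
      then have "(\<lambda>j. \<bar>x - y\<bar> - 2 * (1 / 2) ^ j) \<longlonglongrightarrow> \<bar>x - y\<bar> - 2 * (0::real)"
        by (intro tendsto_diff tendsto_const)
      then show "(\<lambda>j. \<bar>x - y\<bar> - 2 * (1 / 2) ^ j) \<longlonglongrightarrow> \<bar>x - y\<bar>" by simp
      have "\<bar>x - y\<bar> - 2 * (1 / 2) ^ j \<le> hoelder_const * \<bar>cantor_left \<rho> j (ad x j) - cantor_left \<rho> j (ad y j)\<bar> powr \<theta>" for j
      proof -
        have pow: "(1 / 2) ^ j = 1 / (2 ^ j :: real)" by (rule power_one_over)
        have "2 ^ j * \<bar>x - y\<bar> = \<bar>2 ^ j * x - 2 ^ j * y\<bar>"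
          by (simp add: abs_mult flip: right_diff_distrib)
        also have "\<dots> \<le> \<bar>real (ad x j) - real (ad y j)\<bar> + 2"
          using ad_close[of x j] ad_close[of y j] that by linarith
        finally have "\<bar>x - y\<bar> \<le> (\<bar>real (ad x j) - real (ad y j)\<bar> + 2) / 2 ^ j"
          by (simp add: pos_le_divide_eq mult.commute)
        then have "\<bar>x - y\<bar> - 2 * (1 / 2) ^ j \<le> \<bar>real (ad x j) - real (ad y j)\<bar> / 2 ^ j"
          unfolding pow by (simp add: add_divide_distrib)
        also note Hoelder[OF ad_less[OF that(1,2)] ad_less[OF that(3,4)]]
        finally show ?thesis .
      qed
      then show "\<exists>N. \<forall>n\<ge>N. \<bar>x - y\<bar> - 2 * (1 / 2) ^ n
          \<le> hoelder_const * \<bar>cantor_left \<rho> n (ad x n) - cantor_left \<rho> n (ad y n)\<bar> powr \<theta>" by blast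
    qed
  qed
qed

text \<open>The segments of level \<open>j\<close> contribute \<open>2\<^sup>j\<close> terms of size \<open>\<rho>\<close> to the power \<open>j s\<close>, and \<open>2 \<rho>\<^sup>s < 1\<close> for
  \<open>s > \<theta>\<close>. The sets are transported by an isometric embedding \<open>f\<close> of the line.\<close>
lemma hausdorff_measure_cantor_eq_0:
  fixes f :: "real \<Rightarrow> 'a::euclidean_space"
  assumes f: "\<And>s s'. dist (f s) (f s') = \<bar>s - s'\<bar>" and s: "\<theta> < s"
  shows "hausdorff_measure s (f ` cantor_set \<gamma>) = 0"
proof -
  have "hausdorff_premeasure s \<delta> (f ` cantor_set \<gamma>) = 0" if \<delta>: "0 < \<delta>" for \<delta>
  proof -
    define U where "U = (\<lambda>j i. if i < 2 ^ j then f ` {cantor_left \<rho> j i .. cantor_left \<rho> j i + \<rho> ^ j} else {})"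
    have diam: "bounded (U j i) \<and> diameter (U j i) \<le> \<rho> ^ j" for j i
    proof -
      have d: "dist x y \<le> \<rho> ^ j" if "x \<in> U j i" "y \<in> U j i" for x y
        using that f by (auto simp: U_def split: if_splits)
      have "bounded (U j i)"
      proof (cases "U j i = {}")
        case False
        then obtain x where "x \<in> U j i" by blast
        then show ?thesis using d unfolding bounded_def by blast
      qed simp
      moreover have "diameter (U j i) \<le> \<rho> ^ j"
        using d \<rho>_pos by (intro diameter_le) (auto simp: dist_norm)
      ultimately show ?thesis by blast
    qed
    have cover: "f ` cantor_set \<gamma> \<subseteq> (\<Union>i. U j i)" for j
    proof
      fix x assume "x \<in> f ` cantor_set \<gamma>"
      then obtain t where t: "t \<in> cantor_set \<gamma>" "x = f t" by blast
      obtain m where "m < 2 ^ j" "cantor_left \<rho> j m \<le> t" "t \<le> cantor_left \<rho> j m + \<rho> ^ j"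
        using cantor_set_covered[OF \<rho>_eq t(1)] by blast
      then show "x \<in> (\<Union>i. U j i)" unfolding U_def using t(2) by (auto intro!: exI[of _ m])
    qed
    have bound: "hausdorff_premeasure s \<delta> (f ` cantor_set \<gamma>) \<le> ennreal ((2 * \<rho> powr s) ^ j)" if "\<rho> ^ j \<le> \<delta>" for j
    proof -
      have "hausdorff_premeasure s \<delta> (f ` cantor_set \<gamma>) \<le> (\<Sum>i. ennreal (diameter (U j i) powr s))"
        unfolding hausdorff_premeasure_def using diam cover that by (intro INF_lower) (auto intro: order_trans)
      also have "\<dots> = (\<Sum>i<2 ^ j. ennreal (diameter (U j i) powr s))"
        by (rule suminf_finite) (auto simp: U_def)
      also have "\<dots> \<le> (\<Sum>i<(2::nat) ^ j. ennreal ((\<rho> ^ j) powr s))"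
        using diam s \<theta>_pos by (intro sum_mono ennreal_leI powr_mono2) (auto intro: diameter_ge_0)
      also have "\<dots> = ennreal (2 ^ j * (\<rho> ^ j) powr s)"
        by (simp add: ennreal_mult ennreal_of_nat_eq_real_of_nat)
      also have "2 ^ j * (\<rho> ^ j) powr s = (2 * \<rho> powr s) ^ j"
        using \<rho>_pos by (simp add: power_mult_distrib powr_powr powr_realpow[symmetric] mult.commute)
      finally show ?thesis .
    qed
    have "2 * \<rho> powr s < 1"
      using powr_less_mono'[of \<rho> \<theta> s] dimension s \<rho>_pos \<rho>_less by simp
    then have "(\<lambda>j. ennreal ((2 * \<rho> powr s) ^ j)) \<longlonglongrightarrow> ennreal 0"
      by (intro tendsto_ennrealI LIMSEQ_power_zero) simp
    moreover obtain n where n: "\<rho> ^ n < \<delta>" using real_arch_pow_inv[OF \<delta>, of \<rho>] \<rho>_less by auto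
    have "\<rho> ^ j \<le> \<delta>" if "j \<ge> n" for j
      using power_decreasing[OF that \<rho>_le_1] n by linarith
    ultimately have "hausdorff_premeasure s \<delta> (f ` cantor_set \<gamma>) \<le> ennreal 0"
      using bound by (intro LIMSEQ_le_const) auto
    then show ?thesis by simp
  qed
  then show ?thesis unfolding hausdorff_measure_def by simp
qed

text \<open>A cover of the Cantor set is pulled back by the inverse Cantor function to a cover of \<open>[0, 1)\<close>; a set of
  diameter \<open>\<delta>\<close> becomes a subset of an interval of length comparable to \<open>\<delta>\<^sup>\<theta>\<close>, and the lengths of the
  intervals add up to at least 1.\<close>
lemma hausdorff_measure_cantor_neq_0:
  fixes f :: "real \<Rightarrow> 'a::euclidean_space"
  assumes f: "\<And>s s'. dist (f s) (f s') = \<bar>s - s'\<bar>" and s: "0 < s" "s \<le> \<theta>"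
  shows "hausdorff_measure s (f ` cantor_set \<gamma>) \<noteq> 0"
proof
  let ?K = hoelder_const
  obtain g where g: "\<And>x. 0 \<le> x \<Longrightarrow> x < 1 \<Longrightarrow> g x \<in> cantor_set \<gamma>"
    "\<And>x y. 0 \<le> x \<Longrightarrow> x < 1 \<Longrightarrow> 0 \<le> y \<Longrightarrow> y < 1 \<Longrightarrow> \<bar>x - y\<bar> \<le> ?K * \<bar>g x - g y\<bar> powr \<theta>"
    using inverse_cantor_function by blast
  assume "hausdorff_measure s (f ` cantor_set \<gamma>) = 0"
  then have "hausdorff_premeasure s 1 (f ` cantor_set \<gamma>) = 0"
    unfolding hausdorff_measure_def using zero_less_one by (metis SUP_upper greaterThan_iff le_zero_eq)
  moreover have "0 < ennreal (1 / (2 * ?K))" using hoelder_const_pos by (simp del: ennreal_eq_0_iff)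
  ultimately have "hausdorff_premeasure s 1 (f ` cantor_set \<gamma>) < ennreal (1 / (2 * ?K))" by simp
  then obtain U :: "nat \<Rightarrow> 'a set" where U: "f ` cantor_set \<gamma> \<subseteq> (\<Union>i. U i)"
      "\<And>i. bounded (U i)" "\<And>i. diameter (U i) \<le> 1"
      and small: "(\<Sum>i. ennreal (diameter (U i) powr s)) < ennreal (1 / (2 * ?K))"
    unfolding hausdorff_premeasure_def INF_less_iff by auto
  define \<delta> where "\<delta> = (\<lambda>i. ?K * diameter (U i) powr \<theta>)"
  have \<delta>_nonneg: "0 \<le> \<delta> i" for i unfolding \<delta>_def using hoelder_const_pos by simp
  define P where "P = (\<lambda>i. {x. 0 \<le> x \<and> x < 1 \<and> f (g x) \<in> U i})"
  have "\<exists>V. P i \<subseteq> V \<and> V \<in> sets lborel \<and> emeasure lborel V \<le> ennreal (2 * \<delta> i)" for i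
  proof (cases "P i = {}")
    case True
    then show ?thesis by (intro exI[of _ "{}"]) auto
  next
    case False
    then obtain x where x: "x \<in> P i" by blast
    have "P i \<subseteq> {x - \<delta> i .. x + \<delta> i}"
    proof
      fix y assume y: "y \<in> P i"
      have "\<bar>g x - g y\<bar> \<le> diameter (U i)"
        using diameter_bounded_bound[OF U(2), of "f (g x)" i "f (g y)"] x y f unfolding P_def by simp
      then have "\<bar>g x - g y\<bar> powr \<theta> \<le> diameter (U i) powr \<theta>" using \<theta>_pos by (intro powr_mono2) auto
      then have "?K * \<bar>g x - g y\<bar> powr \<theta> \<le> \<delta> i"
        unfolding \<delta>_def using hoelder_const_pos by (intro mult_left_mono) auto
      then have "\<bar>x - y\<bar> \<le> \<delta> i" using g(2)[of x y] x y unfolding P_def by auto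
      then show "y \<in> {x - \<delta> i .. x + \<delta> i}" by auto
    qed
    then show ?thesis using \<delta>_nonneg[of i] by (intro exI[of _ "{x - \<delta> i .. x + \<delta> i}"]) auto
  qed
  then obtain V where V: "\<And>i. P i \<subseteq> V i" "\<And>i. V i \<in> sets lborel"
    "\<And>i. emeasure lborel (V i) \<le> ennreal (2 * \<delta> i)" by metis
  have "{0..<1} \<subseteq> (\<Union>i. V i)"
  proof
    fix x :: real assume x: "x \<in> {0..<1}"
    then have "f (g x) \<in> (\<Union>i. U i)" using U(1) g(1) by auto
    then obtain i where "f (g x) \<in> U i" by blast
    then have "x \<in> P i" unfolding P_def using x by simp
    then show "x \<in> (\<Union>i. V i)" using V(1) by blast
  qed
  then have "emeasure lborel {0..<1::real} \<le> emeasure lborel (\<Union>i. V i)" using V(2) by (intro emeasure_mono) auto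
  also have "\<dots> \<le> (\<Sum>i. emeasure lborel (V i))" using V(2) by (intro emeasure_subadditive_countably) auto
  also have "\<dots> \<le> (\<Sum>i. ennreal (2 * ?K) * ennreal (diameter (U i) powr s))"
  proof (intro suminf_le allI)
    fix i
    have "diameter (U i) powr \<theta> \<le> diameter (U i) powr s"
    proof (cases "diameter (U i) = 0")
      case False
      then show ?thesis using U(3)[of i] diameter_ge_0[OF U(2), of i] s by (intro powr_mono') auto
    qed simp
    then have "2 * \<delta> i \<le> 2 * ?K * diameter (U i) powr s"
      unfolding \<delta>_def using hoelder_const_pos by simp
    then show "emeasure lborel (V i) \<le> ennreal (2 * ?K) * ennreal (diameter (U i) powr s)"
      using V(3)[of i] hoelder_const_pos by (auto simp: ennreal_mult'[symmetric] intro: order_trans ennreal_leI)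
  qed auto
  also have "\<dots> = ennreal (2 * ?K) * (\<Sum>i. ennreal (diameter (U i) powr s))" by (rule ennreal_suminf_cmult)
  also have "\<dots> < ennreal (2 * ?K) * ennreal (1 / (2 * ?K))"
    using small hoelder_const_pos by (intro ennreal_mult_strict_left_mono) auto
  also have "\<dots> = 1" using hoelder_const_pos by (simp flip: ennreal_mult)
  finally show False by simp
qed

lemma hausdorff_dimension_cantor:
  fixes f :: "real \<Rightarrow> 'a::euclidean_space"
  assumes f: "\<And>s s'. dist (f s) (f s') = \<bar>s - s'\<bar>"
  shows "hausdorff_dimension (f ` cantor_set \<gamma>) = \<theta>"
proof -
  have "{s. 0 < s \<and> hausdorff_measure s (f ` cantor_set \<gamma>) = 0} = {\<theta><..}"
  proof (rule set_eqI)
    fix s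
    show "s \<in> {s. 0 < s \<and> hausdorff_measure s (f ` cantor_set \<gamma>) = 0} \<longleftrightarrow> s \<in> {\<theta><..}"
      using hausdorff_measure_cantor_eq_0[of f s, OF f] hausdorff_measure_cantor_neq_0[of f s, OF f] \<theta>_pos by force
  qed
  then show ?thesis unfolding hausdorff_dimension_def by simp
qed

end

section \<open>The distance to a closed subset of the line\<close>

text \<open>The function \<open>s\<^sup>2 - dist(s, C)\<^sup>2\<close> is convex with subgradients \<open>2 c(s)\<close>, \<open>c(s)\<close> a nearest point of \<open>C\<close>.
  Hence \<open>c\<close> is monotone, and where it is continuous the subgradients force differentiability.\<close>
lemma infdist_squared_differentiable:
  fixes C :: "real set"
  assumes "closed C" "C \<noteq> {}"
  obtains Z where "countable Z"
    "\<And>s. s \<notin> Z \<Longrightarrow> \<exists>l. ((\<lambda>s. (infdist s C)\<^sup>2) has_real_derivative l) (at s)"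
proof -
  have "\<exists>c\<in>C. infdist s C = \<bar>s - c\<bar>" for s
    using infdist_attains_inf[OF assms, of s] by (auto simp: dist_real_def)
  then obtain c where c: "\<And>s. c s \<in> C" "\<And>s. infdist s C = \<bar>s - c s\<bar>" by metis
  define F where "F = (\<lambda>s. s\<^sup>2 - (infdist s C)\<^sup>2)"
  have sub: "2 * c s * (s' - s) \<le> F s' - F s" for s s'
  proof -
    have "infdist s' C \<le> \<bar>s' - c s\<bar>" using infdist_le[OF c(1), of s' s] by (simp add: dist_real_def)
    then have "(infdist s' C)\<^sup>2 \<le> \<bar>s' - c s\<bar>\<^sup>2" by (intro power_mono infdist_nonneg) auto
    moreover have "(infdist s C)\<^sup>2 = (s - c s)\<^sup>2" unfolding c(2) by simp
    ultimately show ?thesis unfolding F_def by (simp add: power2_eq_square algebra_simps)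
  qed
  have "mono c"
  proof (rule monoI)
    fix s s' :: real assume "s \<le> s'"
    have "2 * (c s - c s') * (s' - s) \<le> 0" using sub[of s s'] sub[of s' s] by (simp add: algebra_simps)
    then show "c s \<le> c s'" using \<open>s \<le> s'\<close> by (cases "s = s'") (auto simp: mult_le_0_iff)
  qed
  have "(F has_real_derivative 2 * c s) (at s)" if "isCont c s" for s
  proof -
    have "((\<lambda>s'. 2 * \<bar>c s' - c s\<bar>) \<longlongrightarrow> 2 * \<bar>c s - c s\<bar>) (at s)"
      using that unfolding isCont_def by (intro tendsto_intros)
    then have lim: "((\<lambda>s'. 2 * \<bar>c s' - c s\<bar>) \<longlongrightarrow> 0) (at s)" by simp
    have est: "\<bar>(F s' - F s) / (s' - s) - 2 * c s\<bar> \<le> 2 * \<bar>c s' - c s\<bar>" if "s' \<noteq> s" for s'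
    proof -
      let ?q = "F s' - F s - 2 * c s * (s' - s)"
      have "0 \<le> ?q" "?q \<le> 2 * (c s' - c s) * (s' - s)"
        using sub[of s s'] sub[of s' s] by (simp_all add: algebra_simps)
      then have "\<bar>?q\<bar> \<le> \<bar>2 * (c s' - c s) * (s' - s)\<bar>" by linarith
      then have "\<bar>?q\<bar> \<le> 2 * \<bar>c s' - c s\<bar> * \<bar>s' - s\<bar>" by (simp only: abs_mult abs_numeral)
      moreover have "(F s' - F s) / (s' - s) - 2 * c s = ?q / (s' - s)" using that by (simp add: field_simps)
      ultimately show ?thesis using that by (simp add: abs_divide pos_divide_le_eq)
    qed
    have "((\<lambda>s'. (F s' - F s) / (s' - s) - 2 * c s) \<longlongrightarrow> 0) (at s)"
      using est by (intro tendsto_rabs_zero_cancel[OF tendsto_sandwich[OF _ _ tendsto_const lim]])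
        (auto simp: eventually_at_filter)
    then show ?thesis unfolding has_field_derivative_iff by (rule LIM_zero_cancel)
  qed
  then have "\<exists>l. ((\<lambda>s. (infdist s C)\<^sup>2) has_real_derivative l) (at s)" if "isCont c s" for s
  proof -
    have "((\<lambda>s. s\<^sup>2 - F s) has_real_derivative 2 * s - 2 * c s) (at s)"
      using \<open>isCont c s \<Longrightarrow> (F has_real_derivative 2 * c s) (at s)\<close>[OF that] by (auto intro!: derivative_eq_intros)
    then show ?thesis unfolding F_def by auto
  qed
  then show ?thesis using mono_ctble_discont[OF \<open>mono c\<close>] that[of "{s. \<not> isCont c s}"] by blast
qed

section \<open>Weak partial derivatives of Lipschitz functions\<close>

text \<open>A pointwise limit of difference quotients along a fixed sequence: for continuous \<open>f\<close> this is a Borel function of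
  the point, whether or not the derivative exists everywhere, and it equals the partial derivative where that exists.\<close>
definition partial_deriv :: "(real ^ 'n \<Rightarrow> real) \<Rightarrow> 'n \<Rightarrow> real ^ 'n \<Rightarrow> real" where
  "partial_deriv f i x = lim (\<lambda>m. (f (x + (1 / real (Suc m)) *\<^sub>R axis i 1) - f x) * real (Suc m))"

abbreviation has_partial_deriv :: "(real ^ 'n \<Rightarrow> real) \<Rightarrow> 'n \<Rightarrow> real ^ 'n \<Rightarrow> real \<Rightarrow> bool" where
  "has_partial_deriv f i x l \<equiv> ((\<lambda>t. f (x + t *\<^sub>R axis i 1)) has_real_derivative l) (at 0)"

lemma difference_quotient_LIMSEQ:
  assumes "(g has_real_derivative l) (at 0)"
  shows "(\<lambda>m. (g (1 / real (Suc m)) - g 0) * real (Suc m)) \<longlonglongrightarrow> l"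
    and "(\<lambda>m. (g (- (1 / real (Suc m))) - g 0) * real (Suc m)) \<longlonglongrightarrow> - l"
proof -
  have lim: "((\<lambda>y. (g y - g 0) / (y - 0)) \<longlongrightarrow> l) (at 0)"
    using assms unfolding has_field_derivative_iff .
  have h: "(\<lambda>m. 1 / real (Suc m)) \<longlonglongrightarrow> 0"
    using LIMSEQ_inverse_real_of_nat by (simp add: inverse_eq_divide)
  have "filterlim (\<lambda>m. 1 / real (Suc m)) (at 0) sequentially"
    using h by (simp add: filterlim_at)
  from filterlim_compose[OF lim this]
  show "(\<lambda>m. (g (1 / real (Suc m)) - g 0) * real (Suc m)) \<longlonglongrightarrow> l" by simp
  have "filterlim (\<lambda>m. - (1 / real (Suc m))) (at 0) sequentially"
    using tendsto_minus[OF h] by (simp add: filterlim_at)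
  from tendsto_minus[OF filterlim_compose[OF lim this]]
  show "(\<lambda>m. (g (- (1 / real (Suc m))) - g 0) * real (Suc m)) \<longlonglongrightarrow> - l" by (simp add: algebra_simps)
qed

lemma partial_deriv_LIMSEQ:
  assumes "has_partial_deriv f i x l"
  shows "(\<lambda>m. (f (x + (1 / real (Suc m)) *\<^sub>R axis i 1) - f x) * real (Suc m)) \<longlonglongrightarrow> l"
  using difference_quotient_LIMSEQ(1)[OF assms] by simp

lemma partial_deriv_eq: "has_partial_deriv f i x l \<Longrightarrow> partial_deriv f i x = l"
  unfolding partial_deriv_def by (intro limI partial_deriv_LIMSEQ)

lemma borel_measurable_partial_deriv:
  assumes "continuous_on UNIV f"
  shows "partial_deriv f i \<in> borel_measurable borel"
proof -
  have [measurable]: "f \<in> borel_measurable borel" using assms by (rule borel_measurable_continuous_onI)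
  have "(\<lambda>x. f (x + (1 / real (Suc m)) *\<^sub>R axis i 1)) \<in> borel_measurable borel" for m
    using assms by (intro borel_measurable_continuous_onI continuous_on_compose2[OF assms] continuous_intros) auto
  then show ?thesis unfolding partial_deriv_def[abs_def] by measurable
qed

lemma integrable_continuous_bounded_support:
  fixes f :: "'a::euclidean_space \<Rightarrow> real"
  assumes "continuous_on UNIV f" "\<And>x. norm x > R \<Longrightarrow> f x = 0"
  shows "integrable lborel f"
proof -
  have "integrable lborel (\<lambda>x. indicator (cball 0 R) x *\<^sub>R f x)"
    using assms(1) by (intro borel_integrable_compact continuous_on_subset[OF assms(1)]) auto
  also have "(\<lambda>x. indicator (cball 0 R) x *\<^sub>R f x) = f"
    using assms(2) by (auto simp: fun_eq_iff indicator_def not_le)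
  finally show ?thesis .
qed

lemma integral_lborel_translate:
  fixes F :: "'a::euclidean_space \<Rightarrow> real"
  assumes "F \<in> borel_measurable borel"
  shows "(LINT x|lborel. F (c + x)) = (LINT x|lborel. F x)"
proof -
  have "(LINT x|lborel. F x) = (LINT x|distr lborel borel ((+) c). F x)" by (simp only: lborel_distr_plus)
  also have "\<dots> = (LINT x|lborel. F (c + x))" using assms by (intro integral_distr) auto
  finally show ?thesis by simp
qed

locale test_fun =
  fixes \<phi> :: "real ^ 'n \<Rightarrow> real"
  assumes test: "test_function_on UNIV \<phi>"
begin

abbreviation d\<phi> :: "'n \<Rightarrow> real ^ 'n \<Rightarrow> real" where
  "d\<phi> i x \<equiv> frechet_derivative \<phi> (at x) (axis i 1)"

definition supp :: "(real ^ 'n) set" where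
  "supp = closure {x. \<phi> x \<noteq> 0}"

lemma compact_supp: "compact supp"
  using test unfolding test_function_on_def supp_def by blast

lemma differentiable: "\<phi> differentiable (at x)"
  and continuous_d\<phi>: "continuous_on UNIV (d\<phi> i)"
proof -
  have "Ck_on (Suc 0) UNIV \<phi>" using test unfolding test_function_on_def smooth_on_def by blast
  then show "\<phi> differentiable (at x)" "continuous_on UNIV (d\<phi> i)" by auto
qed

lemma continuous: "continuous_on UNIV \<phi>"
  using differentiable by (intro differentiable_imp_continuous_on) (simp add: differentiable_on_def)

lemma zero_outside: "x \<notin> supp \<Longrightarrow> \<phi> x = 0"
  using closure_subset[of "{x. \<phi> x \<noteq> 0}"] unfolding supp_def by blast

lemma d\<phi>_zero_outside:
  assumes "x \<notin> supp"
  shows "d\<phi> i x = 0"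
proof -
  have "(\<phi> has_derivative (\<lambda>_. 0)) (at x)"
  proof (rule has_derivative_transform_within_open[of "\<lambda>_. 0"])
    show "open (- supp)" by (simp add: supp_def open_Compl)
    show "x \<in> - supp" using assms by simp
    show "0 = \<phi> y" if "y \<in> - supp" for y using zero_outside[of y] that by simp
  qed (rule has_derivative_const)
  then have "frechet_derivative \<phi> (at x) = (\<lambda>_. 0)" by (rule frechet_derivative_at[symmetric])
  then show ?thesis by simp
qed

lemma line_derivative:
  "((\<lambda>t. \<phi> (x + t *\<^sub>R axis i 1)) has_real_derivative d\<phi> i (x + t *\<^sub>R axis i 1)) (at t)"
proof -
  let ?l = "\<lambda>t. x + t *\<^sub>R axis i 1 :: real ^ 'n"
  have "(\<phi> has_derivative frechet_derivative \<phi> (at (?l t))) (at (?l t))"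
    using differentiable frechet_derivative_works by blast
  moreover have "(?l has_derivative (\<lambda>h. h *\<^sub>R axis i 1)) (at t)"
    by (auto intro!: derivative_eq_intros)
  ultimately have "((\<lambda>t. \<phi> (?l t)) has_derivative (\<lambda>h. frechet_derivative \<phi> (at (?l t)) (h *\<^sub>R axis i 1))) (at t)"
    by (rule has_derivative_compose[rotated])
  moreover have "linear (frechet_derivative \<phi> (at (?l t)))"
    using differentiable linear_frechet_derivative by blast
  ultimately show ?thesis
    unfolding has_field_derivative_def by (simp add: linear_scale mult_commute_abs)
qed

lemma d\<phi>_bounded:
  obtains B where "0 < B" "\<And>x. \<bar>d\<phi> i x\<bar> \<le> B" "\<And>x. \<bar>\<phi> x\<bar> \<le> B"
proof -
  have bdd: "\<exists>B. \<forall>x. \<bar>f x\<bar> \<le> B" if f: "continuous_on UNIV f" "\<And>x. x \<notin> supp \<Longrightarrow> f x = 0" for f :: "real ^ 'n \<Rightarrow> real"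
  proof -
    have "compact (f ` supp)"
      using f(1) compact_supp by (intro compact_continuous_image) (auto intro: continuous_on_subset)
    then obtain B where "\<forall>y\<in>f ` supp. \<bar>y\<bar> \<le> B" using compact_imp_bounded[of "f ` supp"] unfolding bounded_iff by auto
    then have "\<bar>f x\<bar> \<le> max B 0" for x using f(2)[of x] by (cases "x \<in> supp") (auto simp: le_max_iff_disj)
    then show ?thesis by blast
  qed
  obtain B1 where B1: "\<forall>x. \<bar>d\<phi> i x\<bar> \<le> B1" using bdd[OF continuous_d\<phi> d\<phi>_zero_outside] by blast
  obtain B2 where B2: "\<forall>x. \<bar>\<phi> x\<bar> \<le> B2" using bdd[OF continuous zero_outside] by blast
  show ?thesis
  proof (rule that[of "max 1 (max B1 B2)"])
    show "\<bar>d\<phi> i x\<bar> \<le> max 1 (max B1 B2)" "\<bar>\<phi> x\<bar> \<le> max 1 (max B1 B2)" for x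
      using B1 B2 by (simp_all add: le_max_iff_disj)
  qed simp
qed

lemma bounded_support:
  obtains R where "\<And>x. norm x > R \<Longrightarrow> \<phi> x = 0"
proof -
  obtain R where "\<forall>x\<in>supp. norm x \<le> R" using compact_imp_bounded[OF compact_supp] unfolding bounded_iff by blast
  then have "norm x > R \<Longrightarrow> x \<notin> supp" for x by force
  then show ?thesis using that[of R] zero_outside by blast
qed

text \<open>Both sides are limits of integrals of difference quotients, which agree by translation invariance;
  the Lipschitz bounds make the convergence dominated.\<close>
lemma integration_by_parts_Lipschitz:
  fixes f :: "real ^ 'n \<Rightarrow> real"
  assumes lipschitz: "L-lipschitz_on UNIV f"
    and supp: "\<And>x. norm x > R \<Longrightarrow> f x = 0"
    and diff: "AE x in lborel. \<exists>l. has_partial_deriv f i x l"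
  shows "(LINT x|lborel. f x * d\<phi> i x) = - (LINT x|lborel. partial_deriv f i x * \<phi> x)"
proof -
  let ?e = "axis i 1 :: real ^ 'n"
  define h where "h = (\<lambda>m. 1 / real (Suc m))"
  have Lip: "\<bar>f x - f y\<bar> \<le> L * norm (x - y)" for x y
    using lipschitz_onD[OF lipschitz, of x y] by (simp add: dist_norm)
  have cont_f: "continuous_on UNIV f" using lipschitz by (rule lipschitz_on_continuous_on)
  note [continuous_intros] = continuous_on_compose2[OF cont_f] continuous_on_compose2[OF continuous]
  have [measurable]: "f \<in> borel_measurable borel" "\<phi> \<in> borel_measurable borel" "d\<phi> i \<in> borel_measurable borel"
    "partial_deriv f i \<in> borel_measurable borel"
    using cont_f continuous continuous_d\<phi>
    by (auto intro: borel_measurable_continuous_onI borel_measurable_partial_deriv)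
  obtain B where B: "0 < B" "\<And>x. \<bar>d\<phi> i x\<bar> \<le> B" "\<And>x. \<bar>\<phi> x\<bar> \<le> B" using d\<phi>_bounded[of i] by blast
  obtain R' where R': "\<And>x. norm x > R' \<Longrightarrow> \<phi> x = 0" using bounded_support by blast
  have int_f: "integrable lborel f" by (rule integrable_continuous_bounded_support[OF cont_f supp])
  have int_\<phi>: "integrable lborel \<phi>" by (rule integrable_continuous_bounded_support[OF continuous R'])
  have meas_shift: "(\<lambda>x. f (x + h m *\<^sub>R ?e)) \<in> borel_measurable borel" "(\<lambda>x. \<phi> (x + - h m *\<^sub>R ?e)) \<in> borel_measurable borel" for m
    by (intro borel_measurable_continuous_onI continuous_intros; simp)+
  have quot_eq: "(LINT x|lborel. (f (x + h m *\<^sub>R ?e) - f x) * real (Suc m) * \<phi> x)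
      = (LINT x|lborel. f x * ((\<phi> (x + - h m *\<^sub>R ?e) - \<phi> x) * real (Suc m)))" for m
  proof -
    have i1: "integrable lborel (\<lambda>x. f (x + h m *\<^sub>R ?e) * \<phi> x)"
      by (rule integrable_continuous_bounded_support[of _ R']) (auto intro!: continuous_intros simp: R')
    have i2: "integrable lborel (\<lambda>x. f x * \<phi> (x + - h m *\<^sub>R ?e))"
      by (rule integrable_continuous_bounded_support[of _ R]) (auto intro!: continuous_intros simp: supp)
    have i3: "integrable lborel (\<lambda>x. f x * \<phi> x)"
      by (rule integrable_continuous_bounded_support[of _ R]) (auto intro!: continuous_intros simp: supp)
    have "(LINT x|lborel. f (x + h m *\<^sub>R ?e) * \<phi> x) = (LINT x|lborel. f x * \<phi> (x + - h m *\<^sub>R ?e))"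
      using integral_lborel_translate[of "\<lambda>x. f x * \<phi> (x + - h m *\<^sub>R ?e)" "h m *\<^sub>R ?e"] meas_shift
      by (simp add: add.commute)
    then have "(LINT x|lborel. real (Suc m) * (f (x + h m *\<^sub>R ?e) * \<phi> x - f x * \<phi> x))
      = (LINT x|lborel. real (Suc m) * (f x * \<phi> (x + - h m *\<^sub>R ?e) - f x * \<phi> x))"
      using i1 i2 i3 by (simp del: of_nat_Suc)
    then show ?thesis by (simp add: algebra_simps del: of_nat_Suc)
  qed
  have lim1: "(\<lambda>m. LINT x|lborel. (f (x + h m *\<^sub>R ?e) - f x) * real (Suc m) * \<phi> x)
      \<longlonglongrightarrow> (LINT x|lborel. partial_deriv f i x * \<phi> x)"
  proof (rule integral_dominated_convergence[where w = "\<lambda>x. L * \<bar>\<phi> x\<bar>"])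
    show "integrable lborel (\<lambda>x. L * \<bar>\<phi> x\<bar>)" using int_\<phi> by auto
    show "AE x in lborel. (\<lambda>m. (f (x + h m *\<^sub>R ?e) - f x) * real (Suc m) * \<phi> x) \<longlonglongrightarrow> partial_deriv f i x * \<phi> x"
      using diff
    proof eventually_elim
      case (elim x)
      then obtain l where l: "has_partial_deriv f i x l" by blast
      show ?case unfolding h_def using partial_deriv_LIMSEQ[OF l] partial_deriv_eq[OF l] by (intro tendsto_intros) auto
    qed
    show "AE x in lborel. norm ((f (x + h m *\<^sub>R ?e) - f x) * real (Suc m) * \<phi> x) \<le> L * \<bar>\<phi> x\<bar>" for m
    proof (rule AE_I2)
      fix x
      have "\<bar>f (x + h m *\<^sub>R ?e) - f x\<bar> \<le> L * (1 / real (Suc m))"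
        using Lip[of "x + h m *\<^sub>R ?e" x] by (simp add: h_def)
      then have "\<bar>f (x + h m *\<^sub>R ?e) - f x\<bar> * real (Suc m) \<le> L" by (simp add: field_simps)
      then show "norm ((f (x + h m *\<^sub>R ?e) - f x) * real (Suc m) * \<phi> x) \<le> L * \<bar>\<phi> x\<bar>"
        by (auto simp: abs_mult intro!: mult_right_mono)
    qed
  qed (use meas_shift in measurable)
  have lim2: "(\<lambda>m. LINT x|lborel. f x * ((\<phi> (x + - h m *\<^sub>R ?e) - \<phi> x) * real (Suc m)))
      \<longlonglongrightarrow> (LINT x|lborel. f x * - d\<phi> i x)"
  proof (rule integral_dominated_convergence[where w = "\<lambda>x. \<bar>f x\<bar> * B"])
    show "integrable lborel (\<lambda>x. \<bar>f x\<bar> * B)" using int_f by auto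
    show "AE x in lborel. (\<lambda>m. f x * ((\<phi> (x + - h m *\<^sub>R ?e) - \<phi> x) * real (Suc m))) \<longlonglongrightarrow> f x * - d\<phi> i x"
    proof (rule AE_I2)
      fix x
      show "(\<lambda>m. f x * ((\<phi> (x + - h m *\<^sub>R ?e) - \<phi> x) * real (Suc m))) \<longlonglongrightarrow> f x * - d\<phi> i x"
        unfolding h_def using difference_quotient_LIMSEQ(2)[OF line_derivative[of x i 0, simplified]]
        by (intro tendsto_intros) simp
    qed
    show "AE x in lborel. norm (f x * ((\<phi> (x + - h m *\<^sub>R ?e) - \<phi> x) * real (Suc m))) \<le> \<bar>f x\<bar> * B" for m
    proof (rule AE_I2)
      fix x
      have h: "0 < h m" unfolding h_def by simp
      obtain z where z: "\<phi> (x + 0 *\<^sub>R ?e) - \<phi> (x + - h m *\<^sub>R ?e) = (0 - - h m) * d\<phi> i (x + z *\<^sub>R ?e)"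
        using MVT2[of "- h m" 0 "\<lambda>t. \<phi> (x + t *\<^sub>R ?e)" "\<lambda>t. d\<phi> i (x + t *\<^sub>R ?e)"] line_derivative h by auto
      then have "\<phi> (x + - h m *\<^sub>R ?e) - \<phi> x = - (h m * d\<phi> i (x + z *\<^sub>R ?e))" by (simp add: algebra_simps)
      then have "(\<phi> (x + - h m *\<^sub>R ?e) - \<phi> x) * real (Suc m) = - d\<phi> i (x + z *\<^sub>R ?e)"
        unfolding h_def by (simp del: of_nat_Suc)
      then show "norm (f x * ((\<phi> (x + - h m *\<^sub>R ?e) - \<phi> x) * real (Suc m))) \<le> \<bar>f x\<bar> * B"
        using B(2) by (auto simp: abs_mult intro!: mult_left_mono)
    qed
  qed (use meas_shift in measurable)
  have "(LINT x|lborel. partial_deriv f i x * \<phi> x) = (LINT x|lborel. f x * - d\<phi> i x)"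
    using LIMSEQ_unique[OF lim1 lim2[folded quot_eq]] .
  then show ?thesis by simp
qed

text \<open>The weak derivative survives limits with a common locally integrable majorant, because test functions
  and their derivatives are bounded with compact support.\<close>
lemma integration_by_parts_limit:
  fixes F G :: "nat \<Rightarrow> real ^ 'n \<Rightarrow> real"
  assumes parts: "\<And>N. (LINT x|lborel. F N x * d\<phi> i x) = - (LINT x|lborel. G N x * \<phi> x)"
    and meas: "\<And>N. F N \<in> borel_measurable borel" "\<And>N. G N \<in> borel_measurable borel"
      "f \<in> borel_measurable borel" "g \<in> borel_measurable borel"
    and bound: "\<And>N. AE x in lborel. \<bar>F N x\<bar> \<le> w x" "\<And>N. AE x in lborel. \<bar>G N x\<bar> \<le> w x"
    and w: "\<And>K. compact K \<Longrightarrow> set_integrable lborel K w"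
    and lim: "AE x in lborel. (\<lambda>N. F N x) \<longlonglongrightarrow> f x" "AE x in lborel. (\<lambda>N. G N x) \<longlonglongrightarrow> g x"
  shows "(LINT x|lborel. f x * d\<phi> i x) = - (LINT x|lborel. g x * \<phi> x)"
proof -
  note [measurable] = meas borel_measurable_continuous_onI[OF continuous]
    borel_measurable_continuous_onI[OF continuous_d\<phi>]
  obtain B where B: "0 < B" "\<And>x. \<bar>d\<phi> i x\<bar> \<le> B" "\<And>x. \<bar>\<phi> x\<bar> \<le> B" using d\<phi>_bounded[of i] by blast
  have dom: "(\<lambda>N. LINT x|lborel. F N x * \<psi> x) \<longlonglongrightarrow> (LINT x|lborel. f x * \<psi> x)"
    if [measurable]: "\<And>N. F N \<in> borel_measurable borel" "f \<in> borel_measurable borel" "\<psi> \<in> borel_measurable borel"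
      and bd: "\<And>N. AE x in lborel. \<bar>F N x\<bar> \<le> w x" and lim: "AE x in lborel. (\<lambda>N. F N x) \<longlonglongrightarrow> f x"
      and \<psi>: "\<And>x. \<bar>\<psi> x\<bar> \<le> B" "\<And>x. x \<notin> supp \<Longrightarrow> \<psi> x = 0" for F f \<psi>
  proof (rule integral_dominated_convergence[where w = "\<lambda>x. (indicator supp x *\<^sub>R w x) * B"])
    show "integrable lborel (\<lambda>x. indicat_real supp x *\<^sub>R w x * B)"
      using w[OF compact_supp] unfolding set_integrable_def by auto
    show "AE x in lborel. (\<lambda>N. F N x * \<psi> x) \<longlonglongrightarrow> f x * \<psi> x"
      using lim by eventually_elim (intro tendsto_intros)
    show "AE x in lborel. norm (F N x * \<psi> x) \<le> indicat_real supp x *\<^sub>R w x * B" for N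
      using bd[of N]
    proof eventually_elim
      case (elim x)
      then show ?case using \<psi>[of x] B(1) by (cases "x \<in> supp") (auto simp: abs_mult intro!: mult_mono)
    qed
  qed measurable
  have "(\<lambda>N. LINT x|lborel. F N x * d\<phi> i x) \<longlonglongrightarrow> (LINT x|lborel. f x * d\<phi> i x)"
    using B(2) d\<phi>_zero_outside by (intro dom meas bound lim) auto
  moreover have "(\<lambda>N. - (LINT x|lborel. G N x * \<phi> x)) \<longlonglongrightarrow> - (LINT x|lborel. g x * \<phi> x)"
    using B(3) zero_outside by (intro tendsto_minus dom meas bound lim) auto
  ultimately show ?thesis unfolding parts by (rule LIMSEQ_unique)
qed

end

section \<open>Distance functions of a given codimension\<close>

lemmas [measurable] = borel_open[OF open_ball]

lemma emeasure_cbox_cart: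
  fixes a b :: "real ^ 'n"
  assumes "\<And>i. a $ i \<le> b $ i"
  shows "emeasure lborel (cbox a b) = ennreal (\<Prod>i\<in>UNIV. b $ i - a $ i)"
    and "emeasure lborel (box a b) = ennreal (\<Prod>i\<in>UNIV. b $ i - a $ i)"
proof -
  have "a \<in> cbox a b" using assms by (simp add: mem_box_cart)
  then have "measure lborel (cbox a b) = (\<Prod>i\<in>UNIV. b $ i - a $ i)" using content_cbox_cart[of a b] by blast
  then show cbox: "emeasure lborel (cbox a b) = ennreal (\<Prod>i\<in>UNIV. b $ i - a $ i)"
    using emeasure_eq_ennreal_measure[of lborel "cbox a b"] emeasure_lborel_cbox_finite[of a b] by simp
  have "a \<bullet> u \<le> b \<bullet> u" if "u \<in> Basis" for u
    using assms that by (auto simp: Basis_vec_def inner_axis)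
  then have "emeasure lborel (box a b) = emeasure lborel (cbox a b)" by simp
  then show "emeasure lborel (box a b) = ennreal (\<Prod>i\<in>UNIV. b $ i - a $ i)" using cbox by simp
qed

text \<open>If \<open>i\<close> is chosen such that \<open>t\<close> lies between \<open>R / 2 ^ Suc i\<close> and \<open>R / 2 ^ i\<close>, the term with index \<open>i\<close>
  alone is large enough. Keeping the whole sum yields a bound by sublevel sets that can be integrated term by term.\<close>
lemma powr_le_dyadic_sum:
  assumes "0 < t" "t < R" "0 \<le> \<tau>"
  shows "ennreal (t powr (- \<tau>)) \<le> (\<Sum>i. ennreal ((R / 2 ^ Suc i) powr (- \<tau>)) * indicator {..<R / 2 ^ i} t)"
proof -
  have "\<exists>i. R / 2 ^ i \<le> t"
  proof -
    obtain i where "(1 / 2) ^ i < t / R" using real_arch_pow_inv[of "t / R" "1 / 2"] assms by auto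
    then show ?thesis using assms by (intro exI[of _ i]) (simp add: field_simps power_one_over)
  qed
  define k where "k = (LEAST i. R / 2 ^ i \<le> t)"
  have k: "R / 2 ^ k \<le> t" unfolding k_def by (rule LeastI_ex) fact
  have "k \<noteq> 0" using k assms by (intro notI) simp
  then obtain i where i: "k = Suc i" using not0_implies_Suc by blast
  have "t < R / 2 ^ i" using not_less_Least[of i "\<lambda>i. R / 2 ^ i \<le> t"] i unfolding k_def by simp
  moreover have "t powr (- \<tau>) \<le> (R / 2 ^ Suc i) powr (- \<tau>)"
    using k i assms by (intro powr_mono2') auto
  ultimately have "ennreal (t powr (- \<tau>)) \<le> ennreal ((R / 2 ^ Suc i) powr (- \<tau>)) * indicator {..<R / 2 ^ i} t"
    by (auto intro: ennreal_leI)
  also have "\<dots> \<le> (\<Sum>i. ennreal ((R / 2 ^ Suc i) powr (- \<tau>)) * indicator {..<R / 2 ^ i} t)"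
  proof -
    define F where "F = (\<lambda>i. ennreal ((R / 2 ^ Suc i) powr (- \<tau>)) * indicator {..<R / 2 ^ i} t)"
    have "F i \<le> suminf F" using sum_le_suminf[of F "{i}"] by simp
    then show ?thesis unfolding F_def .
  qed
  finally show ?thesis .
qed

text \<open>The total weight of the dyadic shells, a geometric series.\<close>
lemma suminf_dyadic_finite:
  fixes \<sigma> :: real
  assumes "0 < \<sigma>"
  obtains \<Sigma> where "0 \<le> \<Sigma>" "(\<Sum>i. ennreal ((1 / 2 ^ i) powr \<sigma>)) = ennreal \<Sigma>"
proof -
  have "(1 / 2 ^ i) powr \<sigma> = ((1 / 2) powr \<sigma>) ^ i" for i
  proof -
    have "(1 / 2 ^ i) powr \<sigma> = ((1 / 2) powr real i) powr \<sigma>" by (simp add: powr_realpow power_one_over)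
    also have "\<dots> = ((1 / 2) powr \<sigma>) powr real i" by (simp only: powr_powr mult.commute)
    also have "\<dots> = ((1 / 2) powr \<sigma>) ^ i" by (rule powr_realpow) simp
    finally show ?thesis .
  qed
  moreover have "(1 / 2 :: real) powr \<sigma> < 1" using powr_less_mono'[of "1 / 2" 0 \<sigma>] assms by simp
  ultimately have sm: "summable (\<lambda>i. (1 / 2 ^ i) powr \<sigma>)" by (simp only:) (rule summable_geometric, simp)
  show ?thesis
  proof (rule that)
    show "0 \<le> (\<Sum>i. (1 / 2 ^ i) powr \<sigma>)" by (rule suminf_nonneg[OF sm]) (rule powr_ge_zero)
    show "(\<Sum>i. ennreal ((1 / 2 ^ i) powr \<sigma>)) = ennreal (\<Sum>i. (1 / 2 ^ i) powr \<sigma>)"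
      by (rule suminf_ennreal2[OF _ sm]) (rule powr_ge_zero)
  qed
qed

text \<open>The model is the distance to a product of a set of dimension \<open>k - lam\<close> in \<open>\<real>\<close> to the power \<open>k\<close> with the
  remaining coordinate directions; its sublevel sets are no larger than those of a plane of codimension \<open>lam\<close>.\<close>
locale codim_distance =
  fixes d :: "real ^ 'n \<Rightarrow> real" and lam :: real
  assumes d_nonneg: "0 \<le> d x"
    and d_lipschitz: "1-lipschitz_on UNIV d"
    and codim: "0 < lam" "lam < real CARD('n)"
    and upper: "\<exists>A>0. \<forall>y t r. 0 < t \<and> t \<le> r \<longrightarrow>
      emeasure lborel ({x. d x < t} \<inter> ball y r) \<le> ennreal (A * t powr lam * r powr (real CARD('n) - lam))"
begin

lemma d_Lipschitz: "\<bar>d x - d y\<bar> \<le> norm (x - y)"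
  using lipschitz_onD[OF d_lipschitz, of x y] by (simp add: dist_norm)

lemma d_continuous: "continuous_on UNIV d"
  using d_lipschitz by (rule lipschitz_on_continuous_on)

lemma d_measurable [measurable]: "d \<in> borel_measurable borel"
  using d_continuous by (rule borel_measurable_continuous_onI)

text \<open>Summing over the shells where \<open>d\<close> is comparable to \<open>r / 2\<^sup>i\<close> gives a geometric series with ratio \<open>2\<close> to
  the power \<open>s - lam\<close>; this is where \<open>s < lam\<close> is needed.\<close>
lemma integral_d_powr_ball:
  assumes "0 \<le> s" "s < lam"
  obtains A where "0 \<le> A" "\<And>y r. 0 < r \<Longrightarrow>
    (\<integral>\<^sup>+x\<in>ball y r. ennreal (d x powr (- s)) \<partial>lborel) \<le> ennreal (A * r powr (real CARD('n) - s))"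
proof -
  let ?n = "real CARD('n)"
  obtain A where A: "0 < A" "\<And>y t r. 0 < t \<Longrightarrow> t \<le> r \<Longrightarrow>
      emeasure lborel ({x. d x < t} \<inter> ball y r) \<le> ennreal (A * t powr lam * r powr (?n - lam))"
    using upper by blast
  have "0 < lam - s" using assms by simp
  then obtain \<Sigma> where "0 \<le> \<Sigma>" and \<Sigma>: "(\<Sum>i. ennreal ((1 / 2 ^ i) powr (lam - s))) = ennreal \<Sigma>"
    by (rule suminf_dyadic_finite)
  show ?thesis
  proof (rule that[of "2 powr s * A * \<Sigma> + 2 ^ CARD('n)"])
    show "0 \<le> 2 powr s * A * \<Sigma> + 2 ^ CARD('n)" using \<open>0 \<le> \<Sigma>\<close> A(1) by simp
    fix y :: "real ^ 'n" and r :: real assume r: "0 < r"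
    have pw: "ennreal (d x powr (- s)) \<le>
        (\<Sum>i. ennreal ((r / 2 ^ Suc i) powr (- s)) * indicator {..<r / 2 ^ i} (d x)) + ennreal (r powr (- s))" for x
    proof -
      consider "d x = 0" | "0 < d x" "d x < r" | "r \<le> d x" using d_nonneg[of x] by linarith
      then show ?thesis
      proof cases
        case 2
        then show ?thesis using powr_le_dyadic_sum[of "d x" r s] assms by (auto intro: add_increasing2)
      next
        case 3
        then have "d x powr (- s) \<le> r powr (- s)" using r assms by (intro powr_mono2') auto
        then show ?thesis by (intro add_increasing ennreal_leI) auto
      qed simp
    qed
    have "(\<integral>\<^sup>+x\<in>ball y r. ennreal (d x powr (- s)) \<partial>lborel)
      \<le> (\<integral>\<^sup>+x. (\<Sum>i. ennreal ((r / 2 ^ Suc i) powr (- s)) * indicator ({x. d x < r / 2 ^ i} \<inter> ball y r) x)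
           + ennreal (r powr (- s)) * indicator (ball y r) x \<partial>lborel)"
    proof (rule nn_integral_mono)
      fix x
      show "ennreal (d x powr (- s)) * indicator (ball y r) x \<le>
          (\<Sum>i. ennreal ((r / 2 ^ Suc i) powr (- s)) * indicator ({x. d x < r / 2 ^ i} \<inter> ball y r) x)
           + ennreal (r powr (- s)) * indicator (ball y r) x"
        using pw[of x] by (cases "x \<in> ball y r") (simp_all add: indicator_def)
    qed
    also have "\<dots> = (\<Sum>i. ennreal ((r / 2 ^ Suc i) powr (- s)) * emeasure lborel ({x. d x < r / 2 ^ i} \<inter> ball y r))
        + ennreal (r powr (- s)) * emeasure lborel (ball y r)"
    proof -
      have S: "{x. d x < r / 2 ^ i} \<inter> ball y r \<in> sets borel" for i by measurable
      have B: "ball y r \<in> sets borel" by simp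
      note [measurable] = S B
      let ?f = "\<lambda>i x. ennreal ((r / 2 ^ Suc i) powr (- s)) * indicator ({x. d x < r / 2 ^ i} \<inter> ball y r) x"
      have f: "?f i \<in> borel_measurable lborel" for i
        using S[of i] by (intro borel_measurable_times_ennreal borel_measurable_indicator) auto
      have "(\<integral>\<^sup>+x. (\<Sum>i. ?f i x) + ennreal (r powr (- s)) * indicator (ball y r) x \<partial>lborel)
        = (\<integral>\<^sup>+x. (\<Sum>i. ?f i x) \<partial>lborel) + (\<integral>\<^sup>+x. ennreal (r powr (- s)) * indicator (ball y r) x \<partial>lborel)"
      proof (rule nn_integral_add)
        show "(\<lambda>x. \<Sum>i. ?f i x) \<in> borel_measurable lborel" using f by (rule borel_measurable_suminf_order)
        show "(\<lambda>x. ennreal (r powr (- s)) * indicator (ball y r) x) \<in> borel_measurable lborel"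
          using B by (intro borel_measurable_times_ennreal borel_measurable_indicator) auto
      qed
      also have "(\<integral>\<^sup>+x. (\<Sum>i. ?f i x) \<partial>lborel) = (\<Sum>i. \<integral>\<^sup>+x. ?f i x \<partial>lborel)"
        using f by (rule nn_integral_suminf)
      also have "(\<lambda>i. \<integral>\<^sup>+x. ?f i x \<partial>lborel)
        = (\<lambda>i. ennreal ((r / 2 ^ Suc i) powr (- s)) * emeasure lborel ({x. d x < r / 2 ^ i} \<inter> ball y r))"
        using S by (intro ext nn_integral_cmult_indicator) (simp only: sets_lborel)
      also have "(\<integral>\<^sup>+x. ennreal (r powr (- s)) * indicator (ball y r) x \<partial>lborel)
        = ennreal (r powr (- s)) * emeasure lborel (ball y r)"
        by (rule nn_integral_cmult_indicator) (simp only: sets_lborel B)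
      finally show ?thesis .
    qed
    also have "\<dots> \<le> ennreal (2 powr s * A * r powr (?n - s)) * ennreal \<Sigma> + ennreal (2 ^ CARD('n) * r powr (?n - s))"
    proof (rule add_mono)
      have "ennreal ((r / 2 ^ Suc i) powr (- s)) * emeasure lborel ({x. d x < r / 2 ^ i} \<inter> ball y r)
        \<le> ennreal (2 powr s * A * r powr (?n - s)) * ennreal ((1 / 2 ^ i) powr (lam - s))" for i
      proof -
        have "r / 2 ^ i \<le> r" using r by (simp add: field_simps)
        then have "ennreal ((r / 2 ^ Suc i) powr (- s)) * emeasure lborel ({x. d x < r / 2 ^ i} \<inter> ball y r)
          \<le> ennreal ((r / 2 ^ Suc i) powr (- s)) * ennreal (A * (r / 2 ^ i) powr lam * r powr (?n - lam))"
          using A(2)[of "r / 2 ^ i" r y] r by (intro mult_left_mono) auto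
        also have "\<dots> = ennreal ((r / 2 ^ Suc i) powr (- s) * (A * (r / 2 ^ i) powr lam * r powr (?n - lam)))"
          using A(1) by (simp add: ennreal_mult)
        also have "(r / 2 ^ Suc i) powr (- s) * (A * (r / 2 ^ i) powr lam * r powr (?n - lam))
          = 2 powr s * A * r powr (?n - s) * (1 / 2 ^ i) powr (lam - s)"
        proof -
          define h where "h = (1 / 2 ^ i :: real)"
          have h: "0 < h" unfolding h_def by simp
          have e: "r / 2 ^ Suc i = r * h / 2" "r / 2 ^ i = r * h" unfolding h_def by simp_all
          have r': "r powr (?n - s) = r powr (- s) * (r powr lam * r powr (?n - lam))"
            by (simp flip: powr_add)
          have h': "h powr (lam - s) = h powr (- s) * h powr lam" by (simp flip: powr_add)
          show ?thesis unfolding h_def[symmetric] e r' h' using r h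
            by (simp add: powr_mult powr_divide powr_minus_divide)
        qed
        finally show ?thesis using A(1) by (simp add: ennreal_mult)
      qed
      then have "(\<Sum>i. ennreal ((r / 2 ^ Suc i) powr (- s)) * emeasure lborel ({x. d x < r / 2 ^ i} \<inter> ball y r))
        \<le> (\<Sum>i. ennreal (2 powr s * A * r powr (?n - s)) * ennreal ((1 / 2 ^ i) powr (lam - s)))"
        by (intro suminf_le allI) auto
      also have "\<dots> = ennreal (2 powr s * A * r powr (?n - s)) * ennreal \<Sigma>"
        unfolding \<Sigma>[symmetric] by (rule ennreal_suminf_cmult)
      finally show "(\<Sum>i. ennreal ((r / 2 ^ Suc i) powr (- s)) * emeasure lborel ({x. d x < r / 2 ^ i} \<inter> ball y r))
        \<le> ennreal (2 powr s * A * r powr (?n - s)) * ennreal \<Sigma>" .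
      have "ball y r \<subseteq> cbox (\<chi> i. y $ i - r) (\<chi> i. y $ i + r)"
      proof
        fix x assume "x \<in> ball y r"
        then have "\<bar>x $ i - y $ i\<bar> \<le> r" for i
          using component_le_norm_cart[of "x - y" i] by (simp add: dist_norm norm_minus_commute)
        then show "x \<in> cbox (\<chi> i. y $ i - r) (\<chi> i. y $ i + r)"
          by (simp add: mem_box_cart abs_le_iff) (metis add.commute diff_le_eq minus_diff_eq neg_le_iff_le)
      qed
      then have "emeasure lborel (ball y r) \<le> emeasure lborel (cbox (\<chi> i. y $ i - r) (\<chi> i. y $ i + r))"
        by (intro emeasure_mono) auto
      also have "\<dots> = ennreal ((2 * r) ^ CARD('n))"
      proof -
        have "(\<chi> i. y $ i - r) $ j \<le> (\<chi> i. y $ i + r) $ j" for j using r by simp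
        from emeasure_cbox_cart(1)[of "\<chi> i. y $ i - r" "\<chi> i. y $ i + r", OF this]
        show ?thesis by simp
      qed
      finally have "ennreal (r powr (- s)) * emeasure lborel (ball y r) \<le> ennreal (r powr (- s)) * ennreal ((2 * r) ^ CARD('n))"
        by (intro mult_left_mono) auto
      also have "\<dots> = ennreal (2 ^ CARD('n) * r powr (?n - s))"
      proof -
        have "r powr (?n - s) = r powr ?n * r powr (- s)" by (simp flip: powr_add)
        then show ?thesis using r by (simp add: power_mult_distrib powr_realpow mult_ac flip: ennreal_mult)
      qed
      finally show "ennreal (r powr (- s)) * emeasure lborel (ball y r) \<le> ennreal (2 ^ CARD('n) * r powr (?n - s))" .
    qed
    also have "\<dots> = ennreal ((2 powr s * A * \<Sigma> + 2 ^ CARD('n)) * r powr (?n - s))"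
      using A(1) \<open>0 \<le> \<Sigma>\<close> by (simp add: ennreal_plus[symmetric] ennreal_mult[symmetric] algebra_simps del: ennreal_plus)
    finally show "(\<integral>\<^sup>+x\<in>ball y r. ennreal (d x powr (- s)) \<partial>lborel)
      \<le> ennreal ((2 powr s * A * \<Sigma> + 2 ^ CARD('n)) * r powr (?n - s))" .
  qed
qed

text \<open>A second dyadic decomposition, now in \<open>|x - y|\<close>: on the ball of radius \<open>r = 2 / 2\<^sup>i\<close> the kernel contributes
  \<open>r\<close> to the power \<open>lam - n\<close> and the previous lemma \<open>r\<close> to the power \<open>n - s\<close>, which leaves the summable
  \<open>r\<close> to the power \<open>lam - s\<close>, independently of \<open>y\<close>.\<close>
lemma integral_d_powr_kernel:
  assumes "0 \<le> s" "s < lam"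
  obtains B where "0 \<le> B" "\<And>y. (\<integral>\<^sup>+x\<in>ball y 2. ennreal (d x powr (- s) * norm (x - y) powr (lam - real CARD('n))) \<partial>lborel) \<le> ennreal B"
proof -
  let ?n = "real CARD('n)"
  obtain A where A: "0 \<le> A" "\<And>y r. 0 < r \<Longrightarrow>
    (\<integral>\<^sup>+x\<in>ball y r. ennreal (d x powr (- s)) \<partial>lborel) \<le> ennreal (A * r powr (?n - s))"
    using integral_d_powr_ball[OF assms] by blast
  have "0 < lam - s" using assms by simp
  then obtain \<Sigma> where "0 \<le> \<Sigma>" and \<Sigma>: "(\<Sum>i. ennreal ((1 / 2 ^ i) powr (lam - s))) = ennreal \<Sigma>"
    by (rule suminf_dyadic_finite)
  let ?K = "2 powr (?n - s) * A"
  show ?thesis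
  proof (rule that[of "?K * \<Sigma>"])
    show "0 \<le> ?K * \<Sigma>" using \<open>0 \<le> \<Sigma>\<close> A(1) by simp
    fix y :: "real ^ 'n"
    have pw: "ennreal (d x powr (- s) * norm (x - y) powr (lam - ?n)) * indicator (ball y 2) x
      \<le> (\<Sum>i. ennreal ((2 / 2 ^ Suc i) powr (lam - ?n)) * (ennreal (d x powr (- s)) * indicator (ball y (2 / 2 ^ i)) x))" for x
    proof (cases "x \<in> ball y 2 \<and> x \<noteq> y")
      case True
      then have le: "ennreal (norm (x - y) powr (lam - ?n))
        \<le> (\<Sum>i. ennreal ((2 / 2 ^ Suc i) powr (lam - ?n)) * indicator {..<2 / 2 ^ i} (norm (x - y)))"
        using powr_le_dyadic_sum[of "norm (x - y)" 2 "?n - lam"] codim by (simp add: dist_norm norm_minus_commute)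
      have "ennreal (d x powr (- s) * norm (x - y) powr (lam - ?n)) * indicator (ball y 2) x
        = ennreal (d x powr (- s)) * ennreal (norm (x - y) powr (lam - ?n))"
        using True by (simp add: ennreal_mult)
      also have "\<dots> \<le> ennreal (d x powr (- s)) * (\<Sum>i. ennreal ((2 / 2 ^ Suc i) powr (lam - ?n)) * indicator {..<2 / 2 ^ i} (norm (x - y)))"
        using le by (rule mult_left_mono) simp
      also have "\<dots> = (\<Sum>i. ennreal (d x powr (- s)) * (ennreal ((2 / 2 ^ Suc i) powr (lam - ?n)) * indicator {..<2 / 2 ^ i} (norm (x - y))))"
        by (rule ennreal_suminf_cmult[symmetric])
      also have "\<dots> = (\<Sum>i. ennreal ((2 / 2 ^ Suc i) powr (lam - ?n)) * (ennreal (d x powr (- s)) * indicator (ball y (2 / 2 ^ i)) x))"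
      proof (rule suminf_cong)
        fix i
        have "indicator {..<2 / 2 ^ i} (norm (x - y)) = (indicator (ball y (2 / 2 ^ i)) x :: ennreal)"
          by (simp add: indicator_def dist_norm norm_minus_commute[of y x])
        then show "ennreal (d x powr (- s)) * (ennreal ((2 / 2 ^ Suc i) powr (lam - ?n)) * indicator {..<2 / 2 ^ i} (norm (x - y)))
          = ennreal ((2 / 2 ^ Suc i) powr (lam - ?n)) * (ennreal (d x powr (- s)) * indicator (ball y (2 / 2 ^ i)) x)"
          by (simp only: mult_ac)
      qed
      finally show ?thesis .
    next
      case False
      then have "ennreal (d x powr (- s) * norm (x - y) powr (lam - ?n)) * indicator (ball y 2) x = 0" by auto
      then show ?thesis by (simp only: zero_le)
    qed
    have "(\<integral>\<^sup>+x\<in>ball y 2. ennreal (d x powr (- s) * norm (x - y) powr (lam - ?n)) \<partial>lborel)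
      \<le> (\<integral>\<^sup>+x. (\<Sum>i. ennreal ((2 / 2 ^ Suc i) powr (lam - ?n)) * (ennreal (d x powr (- s)) * indicator (ball y (2 / 2 ^ i)) x)) \<partial>lborel)"
      by (intro nn_integral_mono pw)
    also have "\<dots> = (\<Sum>i. ennreal ((2 / 2 ^ Suc i) powr (lam - ?n)) * (\<integral>\<^sup>+x\<in>ball y (2 / 2 ^ i). ennreal (d x powr (- s)) \<partial>lborel))"
    proof -
      have f: "(\<lambda>x. ennreal (d x powr (- s)) * indicator (ball y (2 / 2 ^ i)) x) \<in> borel_measurable lborel" for i
        by measurable
      then have "(\<lambda>x. ennreal ((2 / 2 ^ Suc i) powr (lam - ?n)) * (ennreal (d x powr (- s)) * indicator (ball y (2 / 2 ^ i)) x))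
        \<in> borel_measurable lborel" for i by (intro borel_measurable_times_ennreal borel_measurable_const f)
      then show ?thesis unfolding nn_integral_cmult[OF f, symmetric] by (rule nn_integral_suminf)
    qed
    also have "\<dots> \<le> (\<Sum>i. ennreal ?K * ennreal ((1 / 2 ^ i) powr (lam - s)))"
    proof (intro suminf_le allI)
      fix i
      have "ennreal ((2 / 2 ^ Suc i) powr (lam - ?n)) * (\<integral>\<^sup>+x\<in>ball y (2 / 2 ^ i). ennreal (d x powr (- s)) \<partial>lborel)
        \<le> ennreal ((2 / 2 ^ Suc i) powr (lam - ?n)) * ennreal (A * (2 / 2 ^ i) powr (?n - s))"
        using A(2)[of "2 / 2 ^ i" y] by (intro mult_left_mono) auto
      also have "\<dots> = ennreal ((2 / 2 ^ Suc i) powr (lam - ?n) * (A * (2 / 2 ^ i) powr (?n - s)))"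
        using A(1) by (simp add: ennreal_mult)
      also have "(2 / 2 ^ Suc i) powr (lam - ?n) * (A * (2 / 2 ^ i) powr (?n - s)) = ?K * (1 / 2 ^ i) powr (lam - s)"
      proof -
        define h where "h = (1 / 2 ^ i :: real)"
        have h: "0 < h" unfolding h_def by simp
        have e: "2 / 2 ^ Suc i = h" "2 / 2 ^ i = 2 * h" unfolding h_def by simp_all
        have h': "h powr (lam - s) = h powr (lam - ?n) * h powr (?n - s)" by (simp flip: powr_add)
        show ?thesis unfolding h_def[symmetric] e h' using h by (simp add: powr_mult)
      qed
      finally show "ennreal ((2 / 2 ^ Suc i) powr (lam - ?n)) * (\<integral>\<^sup>+x\<in>ball y (2 / 2 ^ i). ennreal (d x powr (- s)) \<partial>lborel)
        \<le> ennreal ?K * ennreal ((1 / 2 ^ i) powr (lam - s))" using A(1) by (simp add: ennreal_mult)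
    qed auto
    also have "\<dots> = ennreal ?K * ennreal \<Sigma>" unfolding \<Sigma>[symmetric] by (rule ennreal_suminf_cmult)
    also have "\<dots> = ennreal (?K * \<Sigma>)" using \<open>0 \<le> \<Sigma>\<close> A(1) by (simp add: ennreal_mult)
    finally show "(\<integral>\<^sup>+x\<in>ball y 2. ennreal (d x powr (- s) * norm (x - y) powr (lam - ?n)) \<partial>lborel) \<le> ennreal (?K * \<Sigma>)" .
  qed
qed

lemma AE_d_pos: "AE x in lborel. 0 < d x"
proof -
  let ?n = "real CARD('n)"
  obtain A where A: "0 < A" "\<And>y t r. 0 < t \<Longrightarrow> t \<le> r \<Longrightarrow>
      emeasure lborel ({x. d x < t} \<inter> ball y r) \<le> ennreal (A * t powr lam * r powr (?n - lam))"
    using upper by blast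
  have null: "{x. d x = 0} \<inter> ball 0 (real (Suc m)) \<in> null_sets lborel" for m
  proof -
    let ?Z = "{x. d x = 0} \<inter> ball 0 (real (Suc m))"
    have le: "emeasure lborel ?Z \<le> ennreal (A * (1 / real (Suc k)) powr lam * real (Suc m) powr (?n - lam))" for k
    proof -
      have "emeasure lborel ?Z \<le> emeasure lborel ({x. d x < 1 / real (Suc k)} \<inter> ball 0 (real (Suc m)))"
        by (intro emeasure_mono) auto
      also have "1 / real (Suc k) \<le> real (Suc m)" by (simp add: field_simps)
      then have "emeasure lborel ({x. d x < 1 / real (Suc k)} \<inter> ball 0 (real (Suc m)))
        \<le> ennreal (A * (1 / real (Suc k)) powr lam * real (Suc m) powr (?n - lam))" by (intro A(2)) auto
      finally show ?thesis .
    qed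
    have "(\<lambda>k. 1 / real (Suc k)) \<longlonglongrightarrow> 0" using LIMSEQ_inverse_real_of_nat by (simp add: inverse_eq_divide)
    then have "(\<lambda>k. (1 / real (Suc k)) powr lam) \<longlonglongrightarrow> 0 powr lam"
      using codim by (intro tendsto_powr' tendsto_const) auto
    then have "(\<lambda>k. ennreal (A * (1 / real (Suc k)) powr lam * real (Suc m) powr (?n - lam)))
      \<longlonglongrightarrow> ennreal (A * 0 powr lam * real (Suc m) powr (?n - lam))"
      by (intro tendsto_ennrealI tendsto_mult tendsto_const)
    then have "emeasure lborel ?Z \<le> ennreal (A * 0 powr lam * real (Suc m) powr (?n - lam))"
      using le by (intro LIMSEQ_le_const) auto
    then show ?thesis by (auto simp: null_sets_def)
  qed
  have "{x. d x = 0} = (\<Union>m. {x. d x = 0} \<inter> ball 0 (real (Suc m)))"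
  proof
    show "{x. d x = 0} \<subseteq> (\<Union>m. {x. d x = 0} \<inter> ball 0 (real (Suc m)))"
    proof
      fix x assume x: "x \<in> {x. d x = 0}"
      obtain m where "norm x < real m" using reals_Archimedean2 by blast
      then have "x \<in> ball 0 (real (Suc m))" by simp
      then show "x \<in> (\<Union>m. {x. d x = 0} \<inter> ball 0 (real (Suc m)))" using x by blast
    qed
  qed auto
  then have "{x. d x = 0} \<in> null_sets lborel" using null by (metis null_sets_UN)
  then have "AE x in lborel. x \<notin> {x. d x = 0}" by (rule AE_not_in)
  then show ?thesis by eventually_elim (use d_nonneg in \<open>auto simp: less_le\<close>)
qed

end

section \<open>Coordinates\<close>

lemma coord_pos_strict_mono: "i < j \<Longrightarrow> coord_pos i < coord_pos j"
  unfolding coord_pos_def by (intro psubset_card_mono) auto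

lemma inj_coord_pos: "inj (coord_pos :: 'n::{finite,linorder} \<Rightarrow> nat)"
  by (rule injI) (metis coord_pos_strict_mono less_irrefl neq_iff)

lemma range_coord_pos: "range (coord_pos :: 'n::{finite,linorder} \<Rightarrow> nat) = {..<CARD('n)}"
proof (rule card_subset_eq)
  show "range (coord_pos :: 'n \<Rightarrow> nat) \<subseteq> {..<CARD('n)}"
    unfolding coord_pos_def by (auto intro!: psubset_card_mono)
  show "card (range (coord_pos :: 'n \<Rightarrow> nat)) = card {..<CARD('n)}"
    using card_image[OF inj_coord_pos[where ?'n = 'n]] by simp
qed simp

lemma card_first_coords:
  assumes "k \<le> CARD('n::{finite,linorder})"
  shows "card {i :: 'n. coord_pos i < k} = k"
proof -
  have image: "coord_pos ` {i :: 'n. coord_pos i < k} = {..<k}"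
  proof
    show "coord_pos ` {i :: 'n. coord_pos i < k} \<subseteq> {..<k}" by blast
    show "{..<k} \<subseteq> coord_pos ` {i :: 'n. coord_pos i < k}"
    proof
      fix m assume m: "m \<in> {..<k}"
      then have "m \<in> range (coord_pos :: 'n \<Rightarrow> nat)" unfolding range_coord_pos using assms by simp
      then obtain i :: 'n where "m = coord_pos i" by blast
      then show "m \<in> coord_pos ` {i :: 'n. coord_pos i < k}" using m by blast
    qed
  qed
  have "card {i :: 'n. coord_pos i < k} = card (coord_pos ` {i :: 'n. coord_pos i < k})"
    by (intro card_image[symmetric] inj_on_subset[OF inj_coord_pos] subset_UNIV)
  also have "\<dots> = k" unfolding image by (rule card_lessThan)
  finally show ?thesis .
qed

lemma norm_square_cart: "(norm (x :: real ^ 'n))\<^sup>2 = (\<Sum>i\<in>UNIV. (x $ i)\<^sup>2)"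
  unfolding power2_norm_eq_inner inner_vec_def by (simp add: power2_eq_square)

lemma norm_first_coords_le: "norm (first_coords k x) \<le> norm x"
  unfolding first_coords_def by (intro norm_le_componentwise_cart) auto

section \<open>Thin sets in a line and their distance functions\<close>

text \<open>The point and the Cantor set are treated together: \<open>C\<close> is a set of dimension \<open>\<theta>\<close> on the axis of the
  last of the first \<open>k\<close> coordinates.\<close>
locale thin_set =
  fixes k :: nat and i0 :: "'n::{finite,linorder}" and C :: "real set" and \<theta> :: real
  assumes k_le: "k \<le> CARD('n)" and i0: "Suc (coord_pos i0) = k"
    and closed_C: "closed C" and nonempty_C: "C \<noteq> {}"
    and upper_C: "upper_regular \<theta> C" and lower_C: "lower_regular \<theta> C"
    and \<theta>: "0 \<le> \<theta>" "\<theta> < real k" "real k - \<theta> < real CARD('n)"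
begin

abbreviation J :: "'n set" where "J \<equiv> {i. Suc (coord_pos i) < k}"
abbreviation I :: "'n set" where "I \<equiv> {i. coord_pos i < k}"
abbreviation E :: "(real ^ 'n::{finite,linorder}) set" where
  "E \<equiv> {x. \<forall>i. if Suc (coord_pos i) = k then x $ i \<in> C else x $ i = 0}"

definition d :: "real ^ 'n::{finite,linorder} \<Rightarrow> real" where
  "d x = sqrt ((\<Sum>i\<in>J. (x $ i)\<^sup>2) + (infdist (x $ i0) C)\<^sup>2)"

lemma i0_iff: "Suc (coord_pos i) = k \<longleftrightarrow> i = i0"
  using i0 inj_coord_pos by (auto dest: injD)

lemma I_eq: "I = insert i0 J" and i0_notin_J: "i0 \<notin> J"
proof -
  show "I = insert i0 J"
  proof (rule set_eqI)
    fix i show "i \<in> I \<longleftrightarrow> i \<in> insert i0 J"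
      unfolding mem_Collect_eq insert_iff i0_iff[symmetric] by linarith
  qed
  show "i0 \<notin> J" using i0 by simp
qed

lemma card_I: "card I = k" and card_I_compl: "card (- I) = CARD('n) - k"
  using card_first_coords[OF k_le] by (simp_all add: Compl_eq_Diff_UNIV card_Diff_subset)

lemma E_eq: "E = (\<lambda>c. axis i0 c) ` C"
proof
  show "E \<subseteq> (\<lambda>c. axis i0 c) ` C"
  proof
    fix x assume x: "x \<in> E"
    then have "x = axis i0 (x $ i0)" by (simp add: vec_eq_iff axis_def i0_iff)
    moreover have "x $ i0 \<in> C" using x i0 by auto
    ultimately show "x \<in> (\<lambda>c. axis i0 c) ` C" by blast
  qed
  show "(\<lambda>c. axis i0 c) ` C \<subseteq> E"
  proof
    fix x assume "x \<in> (\<lambda>c. axis i0 c) ` C"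
    then obtain c where c: "c \<in> C" "x = axis i0 c" by blast
    show "x \<in> E" unfolding c(2) using c(1) by (simp add: axis_def i0_iff)
  qed
qed

lemma nearest_point: obtains c where "c \<in> C" "infdist s C = \<bar>s - c\<bar>"
proof -
  obtain c where "c \<in> C" "infdist s C = dist s c" using infdist_attains_inf[OF closed_C nonempty_C] by blast
  then show ?thesis using that[of c] by (simp add: dist_real_def)
qed

lemma norm_first_coords_diff: "(norm (first_coords k x - axis i0 c))\<^sup>2 = (\<Sum>i\<in>J. (x $ i)\<^sup>2) + (x $ i0 - c)\<^sup>2"
proof -
  have "(norm (first_coords k x - axis i0 c))\<^sup>2 = (\<Sum>i\<in>UNIV. ((first_coords k x - axis i0 c) $ i)\<^sup>2)"
    by (rule norm_square_cart)
  also have "\<dots> = (\<Sum>i\<in>insert i0 J. ((first_coords k x - axis i0 c) $ i)\<^sup>2)"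
    unfolding I_eq[symmetric] by (intro sum.mono_neutral_right) (use i0 in \<open>auto simp: first_coords_def axis_def\<close>)
  also have "\<dots> = (x $ i0 - c)\<^sup>2 + (\<Sum>i\<in>J. ((first_coords k x - axis i0 c) $ i)\<^sup>2)"
    using i0_notin_J i0 by (subst sum.insert) (auto simp: first_coords_def axis_def)
  also have "(\<Sum>i\<in>J. ((first_coords k x - axis i0 c) $ i)\<^sup>2) = (\<Sum>i\<in>J. (x $ i)\<^sup>2)"
    using i0_notin_J by (intro sum.cong) (auto simp: first_coords_def axis_def)
  finally show ?thesis by simp
qed

text \<open>Pythagoras: the set lies on the axis of the coordinate \<open>i0\<close>.\<close>
lemma d_eq_infdist: "infdist (first_coords k x) E = d x"
proof (rule antisym)
  obtain c where c: "c \<in> C" "infdist (x $ i0) C = \<bar>x $ i0 - c\<bar>" by (rule nearest_point)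
  have "infdist (first_coords k x) E \<le> norm (first_coords k x - axis i0 c)"
    unfolding E_eq using c(1) infdist_le[of "axis i0 c" "(\<lambda>c. axis i0 c) ` C"] by (simp add: dist_norm)
  also have "\<dots> = sqrt ((norm (first_coords k x - axis i0 c))\<^sup>2)" by simp
  also have "\<dots> = d x" unfolding norm_first_coords_diff d_def c(2) by simp
  finally show "infdist (first_coords k x) E \<le> d x" .
  have "d x \<le> dist (first_coords k x) y" if y: "y \<in> E" for y
  proof -
    obtain c where c: "c \<in> C" "y = axis i0 c" using y unfolding E_eq by blast
    have "infdist (x $ i0) C \<le> \<bar>x $ i0 - c\<bar>" using infdist_le[OF c(1), of "x $ i0"] by (simp add: dist_real_def)
    then have "(infdist (x $ i0) C)\<^sup>2 \<le> \<bar>x $ i0 - c\<bar>\<^sup>2" by (intro power_mono infdist_nonneg) auto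
    then have "d x \<le> sqrt ((norm (first_coords k x - axis i0 c))\<^sup>2)" unfolding norm_first_coords_diff d_def by simp
    then show ?thesis unfolding c(2) by (simp add: dist_norm)
  qed
  moreover have ne: "E \<noteq> {}" unfolding E_eq using nonempty_C by simp
  ultimately show "d x \<le> infdist (first_coords k x) E"
    unfolding infdist_notempty[OF ne] by (intro cINF_greatest[OF ne])
qed

lemma d_sqr: "(d x)\<^sup>2 = (\<Sum>i\<in>J. (x $ i)\<^sup>2) + (infdist (x $ i0) C)\<^sup>2"
  unfolding d_def by (intro real_sqrt_pow2 add_nonneg_nonneg sum_nonneg) auto

lemma infdist_le_d: "infdist (x $ i0) C \<le> d x"
  unfolding d_def by (intro real_le_rsqrt) (simp add: sum_nonneg)

lemma component_le_d: "i \<in> J \<Longrightarrow> \<bar>x $ i\<bar> \<le> d x"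
  unfolding d_def using member_le_sum[of i J "\<lambda>i. (x $ i)\<^sup>2"]
  by (intro real_le_rsqrt) (simp add: add_increasing2)

text \<open>Cover the relevant part of \<open>C\<close> by intervals of radius \<open>t\<close>. The points of the ball with \<open>d < t\<close> then lie
  in as many boxes, each with \<open>k\<close> edges of length \<open>4t\<close> and \<open>n - k\<close> edges of length \<open>2r\<close>.\<close>
lemma d_upper: "\<exists>A>0. \<forall>y t r. 0 < t \<and> t \<le> r \<longrightarrow>
  emeasure lborel ({x. d x < t} \<inter> ball y r) \<le> ennreal (A * t powr (real k - \<theta>) * r powr (real CARD('n) - (real k - \<theta>)))"
proof -
  obtain B where B: "0 < B" "\<And>y t r. 0 < t \<Longrightarrow> t \<le> r \<Longrightarrow> \<exists>S. finite S \<and> real (card S) \<le> B * (r / t) powr \<theta> \<and>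
        C \<inter> {y - r<..<y + r} \<subseteq> (\<Union>c\<in>S. {c - t..c + t})"
    using upper_C unfolding upper_regular_def by blast
  let ?A = "B * 2 powr \<theta> * 4 ^ k * 2 ^ (CARD('n) - k)"
  show ?thesis
  proof (intro exI[of _ ?A] conjI allI impI)
    show "0 < ?A" using B(1) by simp
    fix y :: "real ^ 'n::{finite,linorder}" and t r :: real assume "0 < t \<and> t \<le> r"
    then have t: "0 < t" "t \<le> r" "0 < r" by auto
    obtain S where S: "finite S" "real (card S) \<le> B * (2 * r / t) powr \<theta>"
      "C \<inter> {y $ i0 - 2 * r<..<y $ i0 + 2 * r} \<subseteq> (\<Union>c\<in>S. {c - t..c + t})"
      using B(2)[of t "2 * r" "y $ i0"] t by auto
    define a :: "real \<Rightarrow> real ^ 'n::{finite,linorder}" where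
      "a = (\<lambda>c. \<chi> i. if i = i0 then c - 2 * t else if i \<in> J then - (2 * t) else y $ i - r)"
    define b :: "real \<Rightarrow> real ^ 'n::{finite,linorder}" where
      "b = (\<lambda>c. \<chi> i. if i = i0 then c + 2 * t else if i \<in> J then 2 * t else y $ i + r)"
    have "{x. d x < t} \<inter> ball y r \<subseteq> (\<Union>c\<in>S. cbox (a c) (b c))"
    proof
      fix x assume x: "x \<in> {x. d x < t} \<inter> ball y r"
      have xy: "\<bar>x $ i - y $ i\<bar> < r" for i
        using component_le_norm_cart[of "x - y" i] x by (simp add: dist_norm norm_minus_commute)
      obtain c0 where c0: "c0 \<in> C" "infdist (x $ i0) C = \<bar>x $ i0 - c0\<bar>" by (rule nearest_point)
      have c0t: "\<bar>x $ i0 - c0\<bar> < t" using infdist_le_d[of x] x c0(2) by simp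
      then have "c0 \<in> {y $ i0 - 2 * r<..<y $ i0 + 2 * r}" using xy[of i0] t by auto
      then obtain c where c: "c \<in> S" "\<bar>c0 - c\<bar> \<le> t" using S(3) c0(1) by (auto simp: abs_le_iff)
      have xc: "c - 2 * t \<le> x $ i0" "x $ i0 \<le> c + 2 * t" using c0t c(2) by linarith+
      have dx: "d x < t" using x by simp
      have "x \<in> cbox (a c) (b c)"
        unfolding mem_box_cart
      proof (intro allI)
        fix i
        show "a c $ i \<le> x $ i \<and> x $ i \<le> b c $ i"
        proof -
          consider "i = i0" | "i \<noteq> i0" "i \<in> J" | "i \<noteq> i0" "i \<notin> J" by blast
          then show ?thesis
          proof cases
            case 1
            then show ?thesis using xc by (simp add: a_def b_def)
          next
            case 2
            have "\<bar>x $ i\<bar> \<le> 2 * t" using component_le_d[OF 2(2), of x] dx t by linarith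
            then have "- (2 * t) \<le> x $ i" "x $ i \<le> 2 * t" by linarith+
            then show ?thesis using 2 by (simp add: a_def b_def)
          next
            case 3
            have "y $ i - r \<le> x $ i" "x $ i \<le> y $ i + r" using xy[of i] by linarith+
            then show ?thesis using 3 by (simp add: a_def b_def)
          qed
        qed
      qed
      then show "x \<in> (\<Union>c\<in>S. cbox (a c) (b c))" using c(1) by blast
    qed
    then have "emeasure lborel ({x. d x < t} \<inter> ball y r) \<le> emeasure lborel (\<Union>c\<in>S. cbox (a c) (b c))"
      using S(1) by (intro emeasure_mono) auto
    also have "\<dots> \<le> (\<Sum>c\<in>S. emeasure lborel (cbox (a c) (b c)))"
      using S(1) by (intro emeasure_subadditive_finite) auto
    also have "\<dots> = (\<Sum>c\<in>S. ennreal ((4 * t) ^ k * (2 * r) ^ (CARD('n) - k)))"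
    proof (intro sum.cong refl)
      fix c
      have "a c $ i \<le> b c $ i" for i unfolding a_def b_def using t by simp
      then have "emeasure lborel (cbox (a c) (b c)) = ennreal (\<Prod>i\<in>UNIV. b c $ i - a c $ i)"
        by (rule emeasure_cbox_cart)
      also have "(\<Prod>i\<in>UNIV. b c $ i - a c $ i) = (\<Prod>i\<in>UNIV. if i \<in> I then 4 * t else 2 * r)"
        unfolding I_eq a_def b_def by (intro prod.cong) auto
      also have "\<dots> = (4 * t) ^ k * (2 * r) ^ (CARD('n) - k)"
        using prod.If_cases[of UNIV "\<lambda>i. i \<in> I" "\<lambda>_. 4 * t" "\<lambda>_. 2 * r"] card_I card_I_compl
        by (simp add: Collect_neg_eq)
      finally show "emeasure lborel (cbox (a c) (b c)) = ennreal ((4 * t) ^ k * (2 * r) ^ (CARD('n) - k))" .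
    qed
    also have "\<dots> = ennreal (real (card S) * ((4 * t) ^ k * (2 * r) ^ (CARD('n) - k)))"
      by (simp add: ennreal_mult' ennreal_of_nat_eq_real_of_nat)
    also have "\<dots> \<le> ennreal (B * (2 * r / t) powr \<theta> * ((4 * t) ^ k * (2 * r) ^ (CARD('n) - k)))"
      using S(2) t by (intro ennreal_leI mult_right_mono) auto
    also have "B * (2 * r / t) powr \<theta> * ((4 * t) ^ k * (2 * r) ^ (CARD('n) - k))
      = ?A * t powr (real k - \<theta>) * r powr (real CARD('n) - (real k - \<theta>))"
    proof -
      have "t powr (real k - \<theta>) = t ^ k / t powr \<theta>" using t by (simp add: powr_diff powr_realpow)
      moreover have "r powr (real CARD('n) - (real k - \<theta>)) = r powr (real (CARD('n) - k) + \<theta>)"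
        using k_le by (simp add: of_nat_diff algebra_simps)
      moreover have "\<dots> = r ^ (CARD('n) - k) * r powr \<theta>" using t by (simp add: powr_add powr_realpow)
      ultimately show ?thesis using t by (simp add: powr_mult powr_divide power_mult_distrib)
    qed
    finally show "emeasure lborel ({x. d x < t} \<inter> ball y r)
      \<le> ennreal (?A * t powr (real k - \<theta>) * r powr (real CARD('n) - (real k - \<theta>)))" .
  qed
qed

lemma d_lipschitz: "1-lipschitz_on UNIV d"
proof (rule lipschitz_onI)
  fix x y :: "real ^ 'n::{finite,linorder}"
  have "dist (d x) (d y) \<le> dist (first_coords k x) (first_coords k y)"
    unfolding d_eq_infdist[symmetric] dist_real_def by (rule infdist_triangle_abs)
  also have "\<dots> = norm (first_coords k (x - y))"
    unfolding dist_norm by (rule arg_cong[where f = norm]) (simp add: vec_eq_iff first_coords_def)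
  also have "\<dots> \<le> norm (x - y)" by (rule norm_first_coords_le)
  finally show "dist (d x) (d y) \<le> 1 * dist x y" by (simp add: dist_norm)
qed simp

sublocale codim_distance d "real k - \<theta>"
proof
  show "0 \<le> d x" for x by (simp add: d_def sum_nonneg)
  show "1-lipschitz_on UNIV d" by (rule d_lipschitz)
  show "0 < real k - \<theta>" "real k - \<theta> < real CARD('n)" using \<theta> by simp_all
qed (rule d_upper)

text \<open>Each point of a \<open>t\<close>-separated subset of \<open>C\<close> is the centre of a box contained in the set, with \<open>k\<close> edges
  proportional to \<open>t\<close> and \<open>n - k\<close> edges of fixed length, and these boxes are disjoint.\<close>
lemma d_lower:
  "\<exists>c>0. \<forall>\<epsilon>>0. \<exists>t. 0 < t \<and> t < \<epsilon> \<and>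
    ennreal (c * t powr (real k - \<theta>)) \<le> emeasure lborel {x. d x < t \<and> norm (last_coords k x) < 1 / 2}"
proof -
  let ?n = "real CARD('n)"
  have n: "1 \<le> ?n" by (simp add: Suc_le_eq)
  obtain b where b: "0 < b" "\<And>\<epsilon>. 0 < \<epsilon> \<Longrightarrow> \<exists>t S. 0 < t \<and> t < \<epsilon> \<and> finite S \<and> S \<subseteq> C \<and>
     b * t powr (- \<theta>) \<le> real (card S) \<and> (\<forall>c\<in>S. \<forall>c'\<in>S. c \<noteq> c' \<longrightarrow> t \<le> \<bar>c - c'\<bar>)"
    using lower_C unfolding lower_regular_def by blast
  let ?c = "b * (1 / ?n) ^ k * (1 / (2 * ?n)) ^ (CARD('n) - k)"
  show ?thesis
  proof (rule exI[of _ ?c], intro conjI allI impI)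
    show "0 < ?c" using b(1) n by simp
    fix \<epsilon> :: real assume "0 < \<epsilon>"
    then obtain t S where t: "0 < t" "t < \<epsilon>" and S: "finite S" "S \<subseteq> C" "b * t powr (- \<theta>) \<le> real (card S)"
      "\<And>c c'. c \<in> S \<Longrightarrow> c' \<in> S \<Longrightarrow> c \<noteq> c' \<Longrightarrow> t \<le> \<bar>c - c'\<bar>" using b(2) by metis
    define h where "h = t / (2 * ?n)"
    define q where "q = 1 / (4 * ?n)"
    have h: "0 < h" "h \<le> t / 2" unfolding h_def using t n by (auto simp: field_simps)
    have q: "0 < q" unfolding q_def using n by simp
    define w :: "'n \<Rightarrow> real" where "w = (\<lambda>i. if i \<in> I then h else q)"
    define V where "V = (\<lambda>c. box (axis i0 c - (\<chi> i. w i)) (axis i0 c + (\<chi> i. w i)))"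
    have V: "\<bar>x $ i - axis i0 c $ i\<bar> < w i" if "x \<in> V c" for x c i
    proof -
      have "axis i0 c $ i - w i < x $ i \<and> x $ i < axis i0 c $ i + w i"
        using that unfolding V_def mem_box_cart by (metis vec_lambda_beta vector_add_component vector_minus_component)
      then show ?thesis by linarith
    qed
    have "disjoint_family_on V S"
      unfolding disjoint_family_on_def
    proof (intro ballI impI)
      fix c c' assume cc: "c \<in> S" "c' \<in> S" "c \<noteq> c'"
      show "V c \<inter> V c' = {}"
      proof (rule ccontr)
        assume "V c \<inter> V c' \<noteq> {}"
        then obtain x where x: "x \<in> V c" "x \<in> V c'" by blast
        have "i0 \<in> I" unfolding I_eq by simp
        then have "\<bar>x $ i0 - c\<bar> < h" "\<bar>x $ i0 - c'\<bar> < h"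
          using V[OF x(1), of i0] V[OF x(2), of i0] by (simp_all add: w_def axis_def)
        then show False using S(4)[OF cc] h by linarith
      qed
    qed
    then have "(\<Sum>c\<in>S. emeasure lborel (V c)) = emeasure lborel (\<Union>c\<in>S. V c)"
      using S(1) by (intro sum_emeasure) (auto simp: V_def)
    also have "\<dots> \<le> emeasure lborel {x. d x < t \<and> norm (last_coords k x) < 1 / 2}"
    proof (rule emeasure_mono)
      show "(\<Union>c\<in>S. V c) \<subseteq> {x. d x < t \<and> norm (last_coords k x) < 1 / 2}"
      proof
        fix x assume "x \<in> (\<Union>c\<in>S. V c)"
        then obtain c where c: "c \<in> S" "x \<in> V c" by blast
        have "d x \<le> norm (first_coords k x - axis i0 c)"
          unfolding d_eq_infdist[symmetric] E_eq using c(1) S(2) infdist_le[of "axis i0 c" "(\<lambda>c. axis i0 c) ` C"]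
          by (auto simp: dist_norm)
        also have "\<dots> \<le> (\<Sum>i\<in>UNIV. \<bar>(first_coords k x - axis i0 c) $ i\<bar>)" by (rule norm_le_l1_cart)
        also have "\<dots> \<le> (\<Sum>i\<in>(UNIV :: 'n set). h)"
        proof (rule sum_mono)
          fix i
          show "\<bar>(first_coords k x - axis i0 c) $ i\<bar> \<le> h"
            using V[OF c(2), of i] h(1) i0 by (auto simp: first_coords_def w_def axis_def split: if_splits)
        qed
        also have "\<dots> < t" unfolding h_def using t n by simp
        finally have 1: "d x < t" .
        have "norm (last_coords k x) \<le> (\<Sum>i\<in>UNIV. \<bar>last_coords k x $ i\<bar>)" by (rule norm_le_l1_cart)
        also have "\<dots> \<le> (\<Sum>i\<in>(UNIV :: 'n set). q)"
        proof (rule sum_mono)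
          fix i
          show "\<bar>last_coords k x $ i\<bar> \<le> q"
            using V[OF c(2), of i] q i0 by (auto simp: last_coords_def w_def axis_def split: if_splits)
        qed
        also have "\<dots> < 1 / 2" unfolding q_def using n by simp
        finally show "x \<in> {x. d x < t \<and> norm (last_coords k x) < 1 / 2}" using 1 by simp
      qed
      have "continuous_on UNIV (\<lambda>x :: real ^ 'n::{finite,linorder}. norm (last_coords k x))"
        unfolding last_coords_def
      proof (intro continuous_on_norm continuous_on_vec_lambda)
        show "continuous_on UNIV (\<lambda>x :: real ^ 'n::{finite,linorder}. if coord_pos i < k then 0 else x $ i)" for i
          by (cases "coord_pos i < k") (auto intro!: continuous_intros)
      qed
      then have [measurable]: "(\<lambda>x :: real ^ 'n::{finite,linorder}. norm (last_coords k x)) \<in> borel_measurable borel"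
        by (rule borel_measurable_continuous_onI)
      show "{x. d x < t \<and> norm (last_coords k x) < 1 / 2} \<in> sets lborel" by measurable
    qed
    finally have le: "(\<Sum>c\<in>S. emeasure lborel (V c)) \<le> emeasure lborel {x. d x < t \<and> norm (last_coords k x) < 1 / 2}" .
    have emV: "emeasure lborel (V c) = ennreal ((2 * h) ^ k * (2 * q) ^ (CARD('n) - k))" for c
    proof -
      have "emeasure lborel (V c) = ennreal (\<Prod>i\<in>UNIV. (axis i0 c + (\<chi> i. w i)) $ i - (axis i0 c - (\<chi> i. w i)) $ i)"
        unfolding V_def by (intro emeasure_cbox_cart) (use h q in \<open>auto simp: w_def\<close>)
      also have "(\<Prod>i\<in>UNIV. (axis i0 c + (\<chi> i. w i)) $ i - (axis i0 c - (\<chi> i. w i)) $ i)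
        = (\<Prod>i\<in>UNIV. if i \<in> I then 2 * h else 2 * q)"
        by (intro prod.cong) (auto simp: w_def)
      also have "\<dots> = (2 * h) ^ k * (2 * q) ^ (CARD('n) - k)"
        using prod.If_cases[of UNIV "\<lambda>i. i \<in> I" "\<lambda>_. 2 * h" "\<lambda>_. 2 * q"] card_I card_I_compl
        by (simp add: Collect_neg_eq)
      finally show ?thesis .
    qed
    have "?c * t powr (real k - \<theta>) = b * t powr (- \<theta>) * ((2 * h) ^ k * (2 * q) ^ (CARD('n) - k))"
    proof -
      have "t powr (real k - \<theta>) = t powr (- \<theta>) * t ^ k" using t by (simp add: powr_diff powr_minus_divide powr_realpow)
      moreover have "2 * h = t * (1 / ?n)" "2 * q = 1 / (2 * ?n)" unfolding h_def q_def by simp_all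
      ultimately show ?thesis by (simp add: power_mult_distrib power_divide)
    qed
    also have "\<dots> \<le> real (card S) * ((2 * h) ^ k * (2 * q) ^ (CARD('n) - k))"
      using S(3) h q by (intro mult_right_mono) auto
    finally have "ennreal (?c * t powr (real k - \<theta>)) \<le> ennreal (real (card S) * ((2 * h) ^ k * (2 * q) ^ (CARD('n) - k)))"
      by (rule ennreal_leI)
    also have "\<dots> = (\<Sum>c\<in>S. emeasure lborel (V c))"
      by (simp add: emV ennreal_mult' ennreal_of_nat_eq_real_of_nat)
    finally show "\<exists>t. 0 < t \<and> t < \<epsilon> \<and>
      ennreal (?c * t powr (real k - \<theta>)) \<le> emeasure lborel {x. d x < t \<and> norm (last_coords k x) < 1 / 2}"
      using t le by (auto intro: order_trans)
  qed
qed

text \<open>The square of \<open>d\<close> is a quadratic polynomial plus the squared distance of one coordinate to \<open>C\<close>, so it fails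
  to be differentiable only on countably many hyperplanes.\<close>
lemma d_sqr_partial_deriv: "AE x in lborel. \<forall>i. \<exists>l. has_partial_deriv (\<lambda>x. (d x)\<^sup>2) i x l"
proof -
  obtain Z where Z: "countable Z" "\<And>s. s \<notin> Z \<Longrightarrow> \<exists>l. ((\<lambda>s. (infdist s C)\<^sup>2) has_real_derivative l) (at s)"
    using infdist_squared_differentiable[OF closed_C nonempty_C] by blast
  have "{x :: real ^ 'n::{finite,linorder}. x $ i0 = z} \<in> null_sets lebesgue" for z
  proof -
    have "(axis i0 1 :: real ^ 'n::{finite,linorder}) \<in> Basis" by (auto simp: Basis_vec_def)
    from negligible_standard_hyperplane[OF this, of z] show ?thesis
      by (simp add: negligible_iff_null_sets inner_axis)
  qed
  then have "(\<Union>z\<in>Z. {x :: real ^ 'n::{finite,linorder}. x $ i0 = z}) \<in> null_sets lebesgue"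
    using Z(1) by (intro null_sets_UN') auto
  then have "AE x :: real ^ 'n::{finite,linorder} in lebesgue. x \<notin> (\<Union>z\<in>Z. {x. x $ i0 = z})" by (rule AE_not_in)
  then have "AE x :: real ^ 'n::{finite,linorder} in lborel. x \<notin> (\<Union>z\<in>Z. {x. x $ i0 = z})" by (simp add: AE_completion_iff)
  then show ?thesis
  proof eventually_elim
    case (elim x)
    then obtain l0 where l0: "((\<lambda>s. (infdist s C)\<^sup>2) has_real_derivative l0) (at (x $ i0))" using Z(2)[of "x $ i0"] by auto
    show ?case
    proof
      fix i
      let ?a = "\<lambda>j :: 'n. if j = i then 1 else 0 :: real"
      have "((\<lambda>t. (infdist (x $ i0 + t * ?a i0) C)\<^sup>2) has_real_derivative l0 * ?a i0) (at 0)"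
        by (rule DERIV_chain2[where f = "\<lambda>s. (infdist s C)\<^sup>2"]) (use l0 in \<open>auto intro!: derivative_eq_intros\<close>)
      moreover have "((\<lambda>t. \<Sum>j\<in>J. (x $ j + t * ?a j)\<^sup>2) has_real_derivative (\<Sum>j\<in>J. 2 * (x $ j) * ?a j)) (at 0)"
        by (auto intro!: derivative_eq_intros sum.cong)
      ultimately have "((\<lambda>t. (\<Sum>j\<in>J. (x $ j + t * ?a j)\<^sup>2) + (infdist (x $ i0 + t * ?a i0) C)\<^sup>2)
          has_real_derivative (\<Sum>j\<in>J. 2 * (x $ j) * ?a j) + l0 * ?a i0) (at 0)"
        by (intro DERIV_add)
      moreover have "(\<lambda>t. (d (x + t *\<^sub>R axis i 1))\<^sup>2) = (\<lambda>t. (\<Sum>j\<in>J. (x $ j + t * ?a j)\<^sup>2) + (infdist (x $ i0 + t * ?a i0) C)\<^sup>2)"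
        unfolding d_sqr by (simp add: axis_def)
      ultimately show "\<exists>l. has_partial_deriv (\<lambda>x. (d x)\<^sup>2) i x l" by auto
    qed
  qed
qed

end

section \<open>Smooth truncations of the profile\<close>

lemma DERIV_max_0_square: "((\<lambda>t::real. (max t 0)\<^sup>2) has_real_derivative 2 * max t 0) (at t)"
proof (cases t "0::real" rule: linorder_cases)
  case less
  have "((\<lambda>t. 0) has_real_derivative 2 * max t 0) (at t)" using less by simp
  then show ?thesis
    by (rule has_field_derivative_transform_within_open[of _ _ _ "{..<0}"]) (use less in auto)
next
  case equal
  have "((\<lambda>y. (max y 0)\<^sup>2 / y) \<longlongrightarrow> 0) (at (0::real))"
  proof (rule tendsto_rabs_zero_cancel, rule tendsto_sandwich[OF _ _ tendsto_const])
    show "((\<lambda>y. \<bar>y\<bar>) \<longlongrightarrow> 0) (at (0::real))" by (rule tendsto_rabs_zero) (rule tendsto_ident_at)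
    have "\<bar>(max y 0)\<^sup>2 / y\<bar> \<le> \<bar>y\<bar>" for y :: real by (auto simp: max_def power2_eq_square)
    then show "\<forall>\<^sub>F y in at 0. \<bar>(max y 0)\<^sup>2 / y\<bar> \<le> \<bar>y :: real\<bar>" by simp
  qed simp
  then show ?thesis using equal by (simp add: has_field_derivative_iff)
next
  case greater
  have "((\<lambda>t. t\<^sup>2) has_real_derivative 2 * max t 0) (at t)" using greater by (auto intro!: derivative_eq_intros)
  then show ?thesis
    by (rule has_field_derivative_transform_within_open[of _ _ _ "{0<..}"]) (use greater in auto)
qed

text \<open>A continuously differentiable substitute for the positive part, exact for \<open>w \<le> 0\<close>. Its derivatives
  converge to the indicator of \<open>w > 0\<close> at every point as \<open>e\<close> tends to 0, so the level set where the positive part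
  has its kink needs no separate discussion.\<close>
definition smooth_pos :: "real \<Rightarrow> real \<Rightarrow> real" where
  "smooth_pos e w = sqrt ((max w 0)\<^sup>2 + e\<^sup>2) - e"

lemma DERIV_smooth_pos:
  assumes "0 < e"
  shows "(smooth_pos e has_real_derivative max w 0 / sqrt ((max w 0)\<^sup>2 + e\<^sup>2)) (at w)"
proof -
  have pos: "0 < (max w 0)\<^sup>2 + e\<^sup>2" using assms by (intro add_nonneg_pos) auto
  have "((\<lambda>w. (max w 0)\<^sup>2 + e\<^sup>2) has_real_derivative 2 * max w 0 + 0) (at w)"
    by (intro DERIV_add DERIV_max_0_square DERIV_const)
  from DERIV_diff[OF DERIV_chain2[OF DERIV_real_sqrt[OF pos] this] DERIV_const[of e]]
  show ?thesis unfolding smooth_pos_def[abs_def] by (simp add: field_simps)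
qed

lemma smooth_pos_deriv_bound: "\<bar>max w 0 / sqrt ((max w 0)\<^sup>2 + e\<^sup>2)\<bar> \<le> 1"
proof -
  define S where "S = sqrt ((max w 0)\<^sup>2 + e\<^sup>2)"
  have S: "max w 0 \<le> S" "0 \<le> S" unfolding S_def by (auto intro: real_le_rsqrt)
  have "max w 0 / S \<le> 1"
  proof (cases "S = 0")
    case False
    have "max w 0 / S \<le> S / S" using S by (intro divide_right_mono)
    then show ?thesis using False by simp
  qed simp
  moreover have "0 \<le> max w 0 / S" using S(2) by simp
  ultimately show ?thesis unfolding S_def[symmetric] by simp
qed

lemma smooth_pos_nonneg: "0 < e \<Longrightarrow> 0 \<le> smooth_pos e w"
  unfolding smooth_pos_def by (simp add: real_le_rsqrt)

lemma smooth_pos_le: "0 < e \<Longrightarrow> smooth_pos e w \<le> max w 0"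
proof -
  assume "0 < e"
  then have "sqrt ((max w 0)\<^sup>2 + e\<^sup>2) \<le> max w 0 + e"
    by (intro real_le_lsqrt) (auto simp: power2_sum)
  then show ?thesis unfolding smooth_pos_def by simp
qed

lemma smooth_pos_nonpos: "0 < e \<Longrightarrow> w \<le> 0 \<Longrightarrow> smooth_pos e w = 0"
  unfolding smooth_pos_def by (simp add: max_def)

text \<open>The argument \<open>z\<close> stands for the square of the distance, which is differentiable almost everywhere; adding
  \<open>e\<^sup>2\<close> removes the singularity at \<open>z = 0\<close> and only decreases the function.\<close>
definition trunc_power :: "real \<Rightarrow> real \<Rightarrow> real \<Rightarrow> real \<Rightarrow> real" where
  "trunc_power \<alpha> b e z = (z + e\<^sup>2) powr (- \<alpha> / 2) - b"

definition profile :: "real \<Rightarrow> real \<Rightarrow> real \<Rightarrow> real \<Rightarrow> real" where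
  "profile \<alpha> b e z = smooth_pos e (trunc_power \<alpha> b e z)"

definition profile' :: "real \<Rightarrow> real \<Rightarrow> real \<Rightarrow> real \<Rightarrow> real" where
  "profile' \<alpha> b e z = max (trunc_power \<alpha> b e z) 0 / sqrt ((max (trunc_power \<alpha> b e z) 0)\<^sup>2 + e\<^sup>2)
     * (- \<alpha> / 2 * (z + e\<^sup>2) powr (- \<alpha> / 2 - 1))"

lemma DERIV_profile:
  assumes "0 < e" "0 \<le> z"
  shows "(profile \<alpha> b e has_real_derivative profile' \<alpha> b e z) (at z)"
proof -
  have pos: "0 < z + e\<^sup>2" using assms by (intro add_nonneg_pos) auto
  have "((\<lambda>z. z + e\<^sup>2) has_real_derivative 1) (at z)" by (auto intro!: derivative_eq_intros)
  from DERIV_diff[OF DERIV_fun_powr[OF this pos, of "- \<alpha> / 2"] DERIV_const[of b]]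
  have "(trunc_power \<alpha> b e has_real_derivative - \<alpha> / 2 * (z + e\<^sup>2) powr (- \<alpha> / 2 - 1)) (at z)"
    unfolding trunc_power_def[abs_def] by simp
  from DERIV_chain2[OF DERIV_smooth_pos[OF assms(1)] this]
  show ?thesis unfolding profile_def[abs_def] profile'_def .
qed

lemma profile'_bound:
  assumes "0 < e" "0 \<le> z" "0 < \<alpha>"
  shows "\<bar>profile' \<alpha> b e z\<bar> \<le> \<alpha> / 2 * (z + e\<^sup>2) powr (- \<alpha> / 2 - 1)"
proof -
  let ?D = "max (trunc_power \<alpha> b e z) 0 / sqrt ((max (trunc_power \<alpha> b e z) 0)\<^sup>2 + e\<^sup>2)"
  have "\<bar>profile' \<alpha> b e z\<bar> = \<bar>?D\<bar> * (\<alpha> / 2 * (z + e\<^sup>2) powr (- \<alpha> / 2 - 1))"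
    unfolding profile'_def using assms(3) by (simp only: abs_mult) simp
  also have "\<dots> \<le> 1 * (\<alpha> / 2 * (z + e\<^sup>2) powr (- \<alpha> / 2 - 1))"
    using assms by (intro mult_right_mono smooth_pos_deriv_bound) auto
  finally show ?thesis by simp
qed

lemma profile_nonneg: "0 < e \<Longrightarrow> 0 \<le> profile \<alpha> b e z"
  unfolding profile_def by (rule smooth_pos_nonneg)

lemma profile_le:
  assumes "0 < e" "0 \<le> b"
  shows "profile \<alpha> b e z \<le> (z + e\<^sup>2) powr (- \<alpha> / 2)"
proof -
  have "profile \<alpha> b e z \<le> max (trunc_power \<alpha> b e z) 0" unfolding profile_def using assms(1) by (rule smooth_pos_le)
  also have "\<dots> \<le> (z + e\<^sup>2) powr (- \<alpha> / 2)" unfolding trunc_power_def using assms by simp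
  finally show ?thesis .
qed

lemma powr_neg_half:
  fixes s \<alpha> :: real
  assumes "0 \<le> s"
  shows "(s\<^sup>2) powr (- (\<alpha> / 2)) = s powr (- \<alpha>)"
proof (cases "s = 0")
  case False
  then have "s\<^sup>2 = s powr 2" using assms by simp
  then show ?thesis by (simp only: powr_powr) simp
qed simp

lemma profile_support:
  assumes "0 < e" "0 < \<alpha>" "0 < \<beta>" "1 / \<beta> \<le> s"
  shows "profile \<alpha> (\<beta> powr \<alpha>) e (s\<^sup>2) = 0" "profile' \<alpha> (\<beta> powr \<alpha>) e (s\<^sup>2) = 0"
proof -
  have \<beta>: "0 < 1 / \<beta>" using assms by simp
  have "(s\<^sup>2 + e\<^sup>2) powr (- \<alpha> / 2) \<le> ((1 / \<beta>)\<^sup>2) powr (- \<alpha> / 2)"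
  proof (rule powr_mono2')
    show "(1 / \<beta>)\<^sup>2 \<le> s\<^sup>2 + e\<^sup>2" using assms \<beta> power_mono[of "1 / \<beta>" s 2] by (simp add: add_increasing2)
  qed (use assms in auto)
  also have "\<dots> = (1 / \<beta>) powr (- \<alpha>)" using powr_neg_half[of "1 / \<beta>" \<alpha>] \<beta> by simp
  also have "\<dots> = \<beta> powr \<alpha>" using assms by (simp add: powr_minus_divide powr_divide)
  finally have "trunc_power \<alpha> (\<beta> powr \<alpha>) e (s\<^sup>2) \<le> 0" unfolding trunc_power_def by simp
  then show "profile \<alpha> (\<beta> powr \<alpha>) e (s\<^sup>2) = 0" "profile' \<alpha> (\<beta> powr \<alpha>) e (s\<^sup>2) = 0"
    using assms unfolding profile_def profile'_def by (auto simp: smooth_pos_nonpos max_def)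
qed

lemma profile_limits:
  fixes s :: real and e :: "nat \<Rightarrow> real"
  assumes s: "0 < s" and e: "\<And>N. 0 < e N" "e \<longlonglongrightarrow> 0" and \<alpha>: "0 < \<alpha>"
  shows "(\<lambda>N. profile \<alpha> b (e N) (s\<^sup>2)) \<longlonglongrightarrow> max (s powr (- \<alpha>) - b) 0"
    and "(\<lambda>N. profile' \<alpha> b (e N) (s\<^sup>2)) \<longlonglongrightarrow>
      (if b < s powr (- \<alpha>) then - \<alpha> / 2 * (s\<^sup>2) powr (- \<alpha> / 2 - 1) else 0)"
proof -
  let ?w = "\<lambda>N. trunc_power \<alpha> b (e N) (s\<^sup>2)"
  have pw: "(\<lambda>N. (s\<^sup>2 + (e N)\<^sup>2) powr a) \<longlonglongrightarrow> (s\<^sup>2 + 0\<^sup>2) powr a" for a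
    using s e(2) by (intro tendsto_intros) auto
  have w: "?w \<longlonglongrightarrow> s powr (- \<alpha>) - b"
    unfolding trunc_power_def using tendsto_diff[OF pw[of "- \<alpha> / 2"] tendsto_const[of b]] s powr_neg_half[of s \<alpha>] by simp
  have m: "(\<lambda>N. max (?w N) 0) \<longlonglongrightarrow> max (s powr (- \<alpha>) - b) 0"
    by (intro tendsto_max w tendsto_const)
  have sq: "(\<lambda>N. sqrt ((max (?w N) 0)\<^sup>2 + (e N)\<^sup>2)) \<longlonglongrightarrow> sqrt ((max (s powr (- \<alpha>) - b) 0)\<^sup>2 + 0\<^sup>2)"
    by (intro tendsto_intros m e(2))
  show "(\<lambda>N. profile \<alpha> b (e N) (s\<^sup>2)) \<longlonglongrightarrow> max (s powr (- \<alpha>) - b) 0"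
    unfolding profile_def smooth_pos_def using tendsto_diff[OF sq e(2)] by simp
  show "(\<lambda>N. profile' \<alpha> b (e N) (s\<^sup>2)) \<longlonglongrightarrow>
      (if b < s powr (- \<alpha>) then - \<alpha> / 2 * (s\<^sup>2) powr (- \<alpha> / 2 - 1) else 0)"
  proof (cases "b < s powr (- \<alpha>)")
    case True
    have "(\<lambda>N. max (?w N) 0 / sqrt ((max (?w N) 0)\<^sup>2 + (e N)\<^sup>2) * (- \<alpha> / 2 * (s\<^sup>2 + (e N)\<^sup>2) powr (- \<alpha> / 2 - 1)))
      \<longlonglongrightarrow> max (s powr (- \<alpha>) - b) 0 / sqrt ((max (s powr (- \<alpha>) - b) 0)\<^sup>2 + 0\<^sup>2) * (- \<alpha> / 2 * (s\<^sup>2 + 0\<^sup>2) powr (- \<alpha> / 2 - 1))"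
      using True by (intro tendsto_mult tendsto_divide m sq pw tendsto_const) auto
    then show ?thesis using True unfolding profile'_def by simp
  next
    case False
    have "?w N \<le> 0" for N
    proof -
      have "(s\<^sup>2 + (e N)\<^sup>2) powr (- \<alpha> / 2) \<le> (s\<^sup>2) powr (- \<alpha> / 2)" using s \<alpha> by (intro powr_mono2') auto
      also have "\<dots> = s powr (- \<alpha>)" using powr_neg_half[of s \<alpha>] s by simp
      finally show ?thesis using False unfolding trunc_power_def by linarith
    qed
    then have "profile' \<alpha> b (e N) (s\<^sup>2) = 0" for N unfolding profile'_def by (simp add: max_def)
    then show ?thesis using False by simp
  qed
qed

lemma profile_Lipschitz:
  assumes "0 < e" "0 < \<alpha>"
  shows "\<bar>profile \<alpha> b e (s\<^sup>2) - profile \<alpha> b e (t\<^sup>2)\<bar> \<le> \<alpha> * (e\<^sup>2) powr (- \<alpha> / 2) / e * \<bar>s - t\<bar>"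
proof -
  have "norm (profile \<alpha> b e (s\<^sup>2) - profile \<alpha> b e (t\<^sup>2)) \<le> \<alpha> * (e\<^sup>2) powr (- \<alpha> / 2) / e * norm (s - t)"
  proof (rule field_differentiable_bound[of UNIV "\<lambda>s. profile \<alpha> b e (s\<^sup>2)"])
    fix z :: real
    have "((\<lambda>s. s\<^sup>2) has_real_derivative 2 * z) (at z)" by (auto intro!: derivative_eq_intros)
    from DERIV_chain2[OF DERIV_profile[OF assms(1)] this]
    show "((\<lambda>s. profile \<alpha> b e (s\<^sup>2)) has_field_derivative profile' \<alpha> b e (z\<^sup>2) * (2 * z)) (at z within UNIV)" by simp
    have pos: "0 < z\<^sup>2 + e\<^sup>2" using assms by (intro add_nonneg_pos) auto
    have 1: "(z\<^sup>2 + e\<^sup>2) powr (- \<alpha> / 2) \<le> (e\<^sup>2) powr (- \<alpha> / 2)" using assms by (intro powr_mono2') auto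
    have "0 \<le> \<bar>z\<bar> * e" using assms by simp
    moreover have "2 * (\<bar>z\<bar> * e) \<le> z\<^sup>2 + e\<^sup>2" using sum_squares_bound[of "\<bar>z\<bar>" e] by simp
    ultimately have "\<bar>z\<bar> * e \<le> z\<^sup>2 + e\<^sup>2" by linarith
    then have 2: "\<bar>z\<bar> / (z\<^sup>2 + e\<^sup>2) \<le> 1 / e" using pos assms by (simp add: field_simps)
    have "norm (profile' \<alpha> b e (z\<^sup>2) * (2 * z)) \<le> \<alpha> / 2 * (z\<^sup>2 + e\<^sup>2) powr (- \<alpha> / 2 - 1) * (2 * \<bar>z\<bar>)"
      using mult_right_mono[OF profile'_bound[OF assms(1) _ assms(2), of "z\<^sup>2" b], of "2 * \<bar>z\<bar>"]
      by (simp add: abs_mult mult_ac)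
    also have "(z\<^sup>2 + e\<^sup>2) powr (- \<alpha> / 2 - 1) = (z\<^sup>2 + e\<^sup>2) powr (- \<alpha> / 2) / (z\<^sup>2 + e\<^sup>2)"
      using pos by (simp add: powr_diff)
    also have "\<alpha> / 2 * ((z\<^sup>2 + e\<^sup>2) powr (- \<alpha> / 2) / (z\<^sup>2 + e\<^sup>2)) * (2 * \<bar>z\<bar>)
      = \<alpha> * (z\<^sup>2 + e\<^sup>2) powr (- \<alpha> / 2) * (\<bar>z\<bar> / (z\<^sup>2 + e\<^sup>2))"
    proof -
      have "\<alpha> / 2 * (X / Y) * (2 * \<bar>z\<bar>) = \<alpha> * X * (\<bar>z\<bar> / Y)" for X Y by simp
      then show ?thesis .
    qed
    also have "\<dots> \<le> \<alpha> * (e\<^sup>2) powr (- \<alpha> / 2) * (1 / e)"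
      using 1 2 assms pos by (intro mult_mono mult_left_mono) auto
    finally show "norm (profile' \<alpha> b e (z\<^sup>2) * (2 * z)) \<le> \<alpha> * (e\<^sup>2) powr (- \<alpha> / 2) / e" by simp
  qed auto
  then show ?thesis by simp
qed

section \<open>The counterexample for an abstract distance function\<close>

lemma ennreal_powr_finite: "ennreal_powr a s < \<infinity> \<longleftrightarrow> a < \<infinity>"
  unfolding ennreal_powr_def by (auto simp: less_top)

lemma vec_borel_measurable:
  fixes g :: "'n::finite \<Rightarrow> 'a \<Rightarrow> real"
  assumes "\<And>i. g i \<in> borel_measurable M"
  shows "(\<lambda>x. (\<chi> i. g i x) :: real ^ 'n) \<in> borel_measurable M"
  unfolding borel_measurable_euclidean_space[of "\<lambda>x. (\<chi> i. g i x)"] using assms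
  by (auto simp: Basis_vec_def inner_axis)

text \<open>On \<open>ball y r\<close> the kernel \<open>|x - y|\<close> to the power \<open>lam - n\<close> is at least \<open>r\<close> to the same power.\<close>
lemma morrey_norm_finite:
  fixes g :: "real ^ 'n \<Rightarrow> real ^ 'n"
  assumes [measurable]: "g \<in> borel_measurable borel" and \<Omega>: "\<Omega> \<in> sets borel" and lam: "lam < real CARD('n)"
    and fin: "triple_norm p lam \<Omega> g < \<infinity>"
  shows "morrey_norm p lam \<Omega> g < \<infinity>"
proof -
  let ?n = "real CARD('n)"
  let ?T = "SUP y \<in> closure \<Omega>. \<integral>\<^sup>+x\<in>\<Omega>. ennreal (norm (g x) powr p * norm (x - y) powr (lam - ?n)) \<partial>lebesgue"
  note [measurable] = \<Omega>
  have "ennreal (r powr (lam - ?n)) * (\<integral>\<^sup>+x\<in>\<Omega> \<inter> ball y r. ennreal (norm (g x) powr p) \<partial>lebesgue) \<le> ?T"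
    if r: "0 < r" and y: "y \<in> closure \<Omega>" for r y
  proof -
    have "ennreal (r powr (lam - ?n)) * (\<integral>\<^sup>+x\<in>\<Omega> \<inter> ball y r. ennreal (norm (g x) powr p) \<partial>lebesgue)
      = (\<integral>\<^sup>+x. ennreal (r powr (lam - ?n)) * (ennreal (norm (g x) powr p) * indicator (\<Omega> \<inter> ball y r) x) \<partial>lborel)"
      unfolding nn_integral_completion by (subst nn_integral_cmult) auto
    also have "\<dots> \<le> (\<integral>\<^sup>+x\<in>\<Omega>. ennreal (norm (g x) powr p * norm (x - y) powr (lam - ?n)) \<partial>lborel)"
    proof (rule nn_integral_mono_AE)
      have "AE x in lborel. x \<noteq> y" by (rule AE_lborel_singleton)
      then show "AE x in lborel. ennreal (r powr (lam - ?n)) * (ennreal (norm (g x) powr p) * indicator (\<Omega> \<inter> ball y r) x)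
        \<le> ennreal (norm (g x) powr p * norm (x - y) powr (lam - ?n)) * indicator \<Omega> x"
      proof eventually_elim
        case (elim x)
        show ?case
        proof (cases "x \<in> \<Omega> \<inter> ball y r")
          case True
          then have "r powr (lam - ?n) \<le> norm (x - y) powr (lam - ?n)"
            using elim lam by (intro powr_mono2') (auto simp: dist_norm norm_minus_commute)
          then have "r powr (lam - ?n) * norm (g x) powr p \<le> norm (g x) powr p * norm (x - y) powr (lam - ?n)"
            by (subst mult.commute) (intro mult_left_mono, auto)
          then show ?thesis using True by (auto simp: ennreal_mult[symmetric] intro: ennreal_leI)
        qed simp
      qed
    qed
    also have "\<dots> \<le> ?T" unfolding nn_integral_completion by (rule SUP_upper[OF y])
    finally show ?thesis .
  qed
  then have "(SUP (r, y) \<in> {0<..} \<times> closure \<Omega>.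
          ennreal (r powr (lam - ?n)) * (\<integral>\<^sup>+x\<in>\<Omega> \<inter> ball y r. ennreal (norm (g x) powr p) \<partial>lebesgue)) \<le> ?T"
    by (intro SUP_least) auto
  also have "?T < \<infinity>" using fin unfolding triple_norm_def ennreal_powr_finite .
  finally show ?thesis unfolding morrey_norm_def ennreal_powr_finite .
qed

text \<open>The bound \<open>(\<alpha> + 1) p < lam\<close> makes the gradient admissible for the triple norm, and \<open>lam \<le> \<alpha> q\<close> makes the
  function too large for \<open>L\<^sup>q\<close>.\<close>
locale profile_of_distance = codim_distance d lam
  for d :: "real ^ 'n \<Rightarrow> real" and lam :: real +
  fixes p \<alpha> q \<beta> L c0 :: real and \<eta> :: "real ^ 'n \<Rightarrow> real"
  assumes p: "1 < p" and \<alpha>: "0 < \<alpha>" "(\<alpha> + 1) * p < lam" and q: "0 < q" "lam \<le> \<alpha> * q" and \<beta>: "0 < \<beta>"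
    and \<eta>: "0 \<le> \<eta> x" "\<eta> x \<le> 1" and \<eta>_lipschitz: "L-lipschitz_on UNIV \<eta>"
    and d_sqr_deriv: "AE x in lborel. \<forall>i. \<exists>l. has_partial_deriv (\<lambda>x. (d x)\<^sup>2) i x l"
    and \<eta>_deriv: "AE x in lborel. \<forall>i. \<exists>l. has_partial_deriv \<eta> i x l"
    and support: "d x < 1 / \<beta> \<Longrightarrow> \<eta> x \<noteq> 0 \<Longrightarrow> norm x < 1"
    and c0: "0 < c0"
    and lower: "\<exists>c>0. \<forall>\<epsilon>>0. \<exists>t. 0 < t \<and> t < \<epsilon> \<and> ennreal (c * t powr lam) \<le> emeasure lborel {x. d x < t \<and> c0 \<le> \<eta> x}"
begin

abbreviation b :: real where "b \<equiv> \<beta> powr \<alpha>"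

definition u :: "real ^ 'n \<Rightarrow> real" where
  "u x = max (d x powr (- \<alpha>) - \<beta> powr \<alpha>) 0 * \<eta> x"

lemma L_nonneg: "0 \<le> L"
  using \<eta>_lipschitz by (rule lipschitz_on_nonneg)

lemma \<eta>_Lipschitz: "\<bar>\<eta> x - \<eta> y\<bar> \<le> L * norm (x - y)"
  using lipschitz_onD[OF \<eta>_lipschitz, of x y] by (simp add: dist_norm)

lemma \<eta>_continuous: "continuous_on UNIV \<eta>"
  using \<eta>_lipschitz by (rule lipschitz_on_continuous_on)

lemma \<eta>_measurable [measurable]: "\<eta> \<in> borel_measurable borel"
  using \<eta>_continuous by (rule borel_measurable_continuous_onI)

lemma u_measurable [measurable]: "u \<in> borel_measurable borel"
  unfolding u_def[abs_def] by measurable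

lemma u_zero_outside: "norm x \<ge> 1 \<Longrightarrow> u x = 0"
proof -
  assume x: "norm x \<ge> 1"
  show "u x = 0"
  proof (cases "\<eta> x = 0")
    case False
    then have "1 / \<beta> \<le> d x" using support[of x] x by force
    then have "d x powr (- \<alpha>) \<le> (1 / \<beta>) powr (- \<alpha>)" using \<alpha> \<beta> by (intro powr_mono2') auto
    also have "\<dots> = \<beta> powr \<alpha>" using \<beta> by (simp add: powr_minus_divide powr_divide)
    finally show ?thesis unfolding u_def by simp
  qed (simp add: u_def)
qed

subsection \<open>The function is not in \<open>L\<^sup>q\<close>\<close>

text \<open>On the part of \<open>{0 < d < t}\<close> where \<open>\<eta> \<ge> c0\<close>, whose measure is at least of the order \<open>t\<close> to the power \<open>lam\<close> for suitable small \<open>t\<close>,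
  the function \<open>u\<^sup>q\<close> is at least of the order \<open>t\<close> to the power \<open>- lam\<close>. If \<open>u\<^sup>q\<close> were integrable, its
  integrals over these shrinking sets would tend to 0.\<close>
lemma Lq_norm_u: "Lq_norm q (ball 0 1) u = \<infinity>"
proof (rule ccontr)
  define f where "f = (\<lambda>x. ennreal (\<bar>u x\<bar> powr q) * indicator (ball 0 1) x)"
  have [measurable]: "f \<in> borel_measurable borel" unfolding f_def by measurable
  assume "Lq_norm q (ball 0 1) u \<noteq> \<infinity>"
  then have fin: "(\<integral>\<^sup>+x. f x \<partial>lborel) < \<infinity>"
    unfolding Lq_norm_def f_def using ennreal_powr_finite[of _ "1 / q"] by (simp add: nn_integral_completion less_top)
  obtain c where c: "0 < c" "\<And>\<epsilon>. 0 < \<epsilon> \<Longrightarrow> \<exists>t. 0 < t \<and> t < \<epsilon> \<and>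
      ennreal (c * t powr lam) \<le> emeasure lborel {x. d x < t \<and> c0 \<le> \<eta> x}"
    using lower by blast
  \<comment> \<open>For \<open>d < t0\<close> the constant \<open>b\<close> takes away at most half of the power, the support condition applies, and
    \<open>d < 1\<close> allows the exponents to be compared.\<close>
  define t0 where "t0 = min 1 (min (1 / \<beta>) ((2 * b) powr (- 1 / \<alpha>)))"
  have b: "0 < b" using \<beta> by simp
  have t0: "0 < t0" unfolding t0_def using \<beta> b by simp
  have big: "c * (c0 / 2) powr q \<le> e" if e: "ennreal e = (\<integral>\<^sup>+x. f x * indicator {x. 0 < d x \<and> d x < s} x \<partial>lborel)" "0 < s" "0 \<le> e" for s e
  proof -
    obtain t where t: "0 < t" "t < min s t0" "ennreal (c * t powr lam) \<le> emeasure lborel {x. d x < t \<and> c0 \<le> \<eta> x}"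
      using c(2)[of "min s t0"] e(2) t0 by auto
    have tt: "t < s" "t < 1" "t < 1 / \<beta>" "t < (2 * b) powr (- 1 / \<alpha>)" using t unfolding t0_def by auto
    let ?A = "{x. d x < t \<and> c0 \<le> \<eta> x}"
    have pw: "((c0 / 2) powr q * t powr (- lam)) \<le> \<bar>u x\<bar> powr q" "x \<in> ball 0 1" if x: "0 < d x" "x \<in> ?A" for x
    proof -
      have "\<eta> x \<noteq> 0" using x c0 by auto
      then show "x \<in> ball 0 1" using support[of x] x tt by auto
      have "2 * b = ((2 * b) powr (- 1 / \<alpha>)) powr (- \<alpha>)" using b \<alpha> by (simp add: powr_powr)
      also have "\<dots> \<le> d x powr (- \<alpha>)" using x tt \<alpha> by (intro powr_mono2') auto
      finally have half: "d x powr (- \<alpha>) / 2 \<le> max (d x powr (- \<alpha>) - b) 0" by linarith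
      have "d x powr (- \<alpha>) / 2 * c0 \<le> max (d x powr (- \<alpha>) - b) 0 * \<eta> x"
        using x c0 by (intro mult_mono half) auto
      then have "c0 / 2 * d x powr (- \<alpha>) \<le> \<bar>u x\<bar>" unfolding u_def by (simp add: mult.commute)
      then have "(c0 / 2 * d x powr (- \<alpha>)) powr q \<le> \<bar>u x\<bar> powr q" using c0 q by (intro powr_mono2) auto
      moreover have "(c0 / 2 * d x powr (- \<alpha>)) powr q = (c0 / 2) powr q * d x powr (- (\<alpha> * q))"
      proof -
        have "0 \<le> c0 / 2" using c0 by simp
        then show ?thesis by (simp only: powr_mult powr_ge_zero powr_powr mult_minus_left)
      qed
      moreover have "t powr (- lam) \<le> d x powr (- lam)" using x codim by (intro powr_mono2') auto
      moreover have "d x powr (- lam) \<le> d x powr (- (\<alpha> * q))" using x tt q by (intro powr_mono') auto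
      ultimately show "((c0 / 2) powr q * t powr (- lam)) \<le> \<bar>u x\<bar> powr q"
        using mult_left_mono[of "t powr (- lam)" "d x powr (- (\<alpha> * q))" "(c0 / 2) powr q"] by simp
    qed
    have eq: "c * (c0 / 2) powr q = (c0 / 2) powr q * t powr (- lam) * (c * t powr lam)"
      using t by (simp add: powr_minus_divide)
    have "ennreal (c * (c0 / 2) powr q) = ennreal ((c0 / 2) powr q * t powr (- lam)) * ennreal (c * t powr lam)"
      unfolding eq using c(1) by (intro ennreal_mult) auto
    also have "\<dots> \<le> ennreal ((c0 / 2) powr q * t powr (- lam)) * emeasure lborel ?A"
      using t(3) by (intro mult_left_mono) auto
    also have "\<dots> = (\<integral>\<^sup>+x. ennreal ((c0 / 2) powr q * t powr (- lam)) * indicator ?A x \<partial>lborel)"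
      by (subst nn_integral_cmult_indicator) auto
    also have "\<dots> \<le> (\<integral>\<^sup>+x. f x * indicator {x. 0 < d x \<and> d x < s} x \<partial>lborel)"
    proof (rule nn_integral_mono_AE)
      show "AE x in lborel. ennreal ((c0 / 2) powr q * t powr (- lam)) * indicator ?A x \<le> f x * indicator {x. 0 < d x \<and> d x < s} x"
        using AE_d_pos
      proof eventually_elim
        case (elim x)
        show ?case
        proof (cases "x \<in> ?A")
          case True
          then show ?thesis using pw[OF elim True] tt elim unfolding f_def by (auto intro: ennreal_leI)
        qed simp
      qed
    qed
    finally show ?thesis unfolding e(1)[symmetric] using e(3) by simp
  qed
  define S where "S = (\<lambda>m. {x. 0 < d x \<and> d x < 1 / real (Suc m)})"
  have [measurable]: "S m \<in> sets borel" for m unfolding S_def by measurable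
  have "(\<lambda>m. emeasure (density lborel f) (S m)) \<longlonglongrightarrow> emeasure (density lborel f) (\<Inter>m. S m)"
  proof (rule Lim_emeasure_decseq)
    show "decseq S"
    proof (rule decseq_SucI)
      fix m
      have "1 / real (Suc (Suc m)) \<le> 1 / real (Suc m)" by (intro divide_left_mono) auto
      then show "S (Suc m) \<subseteq> S m" unfolding S_def by auto
    qed
    show "emeasure (density lborel f) (S m) \<noteq> \<infinity>" for m
    proof -
      have "emeasure (density lborel f) (S m) = (\<integral>\<^sup>+x. f x * indicator (S m) x \<partial>lborel)"
        by (rule emeasure_density) auto
      also have "\<dots> \<le> (\<integral>\<^sup>+x. f x \<partial>lborel)" by (intro nn_integral_mono) (auto simp: indicator_def)
      finally show ?thesis using fin by auto
    qed
  qed auto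
  moreover have "(\<Inter>m. S m) = {}"
  proof (rule ccontr)
    assume "(\<Inter>m. S m) \<noteq> {}"
    then obtain x where x: "\<And>m. x \<in> S m" by blast
    then have "0 < d x" unfolding S_def by auto
    then obtain m where "inverse (real (Suc m)) < d x" using reals_Archimedean by blast
    then show False using x[of m] unfolding S_def by (auto simp: inverse_eq_divide)
  qed
  ultimately have lim: "(\<lambda>m. emeasure (density lborel f) (S m)) \<longlonglongrightarrow> 0" by simp
  have "ennreal (c * (c0 / 2) powr q) \<le> emeasure (density lborel f) (S m)" for m
  proof -
    have eq: "emeasure (density lborel f) (S m) = (\<integral>\<^sup>+x. f x * indicator (S m) x \<partial>lborel)"
      by (rule emeasure_density) auto
    show ?thesis
    proof (cases "emeasure (density lborel f) (S m)" rule: ennreal_cases)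
      case (real e)
      then have "c * (c0 / 2) powr q \<le> e" using big[of e "1 / real (Suc m)"] eq unfolding S_def by simp
      then show ?thesis using real by (simp add: ennreal_leI)
    qed simp
  qed
  then have "ennreal (c * (c0 / 2) powr q) \<le> 0" by (intro LIMSEQ_le_const[OF lim]) auto
  then show False using c(1) c0 by (simp add: ennreal_eq_0_iff mult_le_0_iff)
qed

subsection \<open>The weak gradient\<close>

text \<open>The limit of the partial derivatives of the truncations, that is, almost everywhere the classical derivative
  of \<open>u\<close> where \<open>0 < d < 1 / \<beta>\<close> and zero where \<open>d \<ge> 1 / \<beta>\<close>.\<close>
definition grad :: "'n \<Rightarrow> real ^ 'n \<Rightarrow> real" where
  "grad i x = (if b < d x powr (- \<alpha>)
     then - \<alpha> / 2 * ((d x)\<^sup>2) powr (- \<alpha> / 2 - 1) * partial_deriv (\<lambda>x. (d x)\<^sup>2) i x * \<eta> x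
       + (d x powr (- \<alpha>) - b) * partial_deriv \<eta> i x
     else 0)"

definition \<epsilon> :: "nat \<Rightarrow> real" where "\<epsilon> N = 1 / real (Suc N)"

definition approx :: "nat \<Rightarrow> real ^ 'n \<Rightarrow> real" where
  "approx N x = profile \<alpha> b (\<epsilon> N) ((d x)\<^sup>2) * \<eta> x"

text \<open>One locally integrable function that bounds \<open>u\<close>, its truncations and all their partial derivatives; the
  powers of \<open>d\<close> without derivative are absorbed because everything vanishes for \<open>d \<ge> 1 / \<beta>\<close>.\<close>
definition majorant :: "real ^ 'n \<Rightarrow> real" where
  "majorant x = (\<alpha> + (1 + L) / \<beta>) * d x powr (- (\<alpha> + 1))"

lemma \<epsilon>: "0 < \<epsilon> N" "\<epsilon> \<longlonglongrightarrow> 0"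
proof -
  show "0 < \<epsilon> N" unfolding \<epsilon>_def by simp
  show "\<epsilon> \<longlonglongrightarrow> 0" unfolding \<epsilon>_def using LIMSEQ_inverse_real_of_nat by (simp add: inverse_eq_divide)
qed

lemma majorant_const_pos: "0 < \<alpha> + (1 + L) / \<beta>"
  using \<alpha> \<beta> L_nonneg by (intro add_pos_nonneg) auto

lemma majorant_measurable [measurable]: "majorant \<in> borel_measurable borel"
  unfolding majorant_def[abs_def] by measurable

lemma d_sqr_continuous: "continuous_on UNIV (\<lambda>x. (d x)\<^sup>2)"
  by (intro continuous_intros d_continuous)

lemma grad_measurable [measurable]: "grad i \<in> borel_measurable borel"
proof -
  note [measurable] = borel_measurable_partial_deriv[OF \<eta>_continuous] borel_measurable_partial_deriv[OF d_sqr_continuous]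
  show ?thesis unfolding grad_def[abs_def] by measurable
qed

lemma approx_Lipschitz:
  obtains M where "M-lipschitz_on UNIV (approx N)"
proof -
  let ?P = "\<lambda>x. profile \<alpha> b (\<epsilon> N) ((d x)\<^sup>2)"
  let ?M = "\<alpha> * ((\<epsilon> N)\<^sup>2) powr (- \<alpha> / 2) / \<epsilon> N"
  let ?Q = "((\<epsilon> N)\<^sup>2) powr (- \<alpha> / 2)"
  have P: "0 \<le> ?P x" "?P x \<le> ?Q" for x
  proof -
    show "0 \<le> ?P x" using \<epsilon>(1) by (rule profile_nonneg)
    have "?P x \<le> ((d x)\<^sup>2 + (\<epsilon> N)\<^sup>2) powr (- \<alpha> / 2)" using \<epsilon>(1) by (intro profile_le) auto
    also have "\<dots> \<le> ?Q" using \<alpha> \<epsilon>(1)[of N] by (intro powr_mono2') auto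
    finally show "?P x \<le> ?Q" .
  qed
  have "\<bar>approx N x - approx N y\<bar> \<le> (?M + ?Q * L) * norm (x - y)" for x y
  proof -
    have "approx N x - approx N y = (?P x - ?P y) * \<eta> x + ?P y * (\<eta> x - \<eta> y)"
      unfolding approx_def by (simp add: algebra_simps)
    then have "\<bar>approx N x - approx N y\<bar> \<le> \<bar>?P x - ?P y\<bar> * \<bar>\<eta> x\<bar> + \<bar>?P y\<bar> * \<bar>\<eta> x - \<eta> y\<bar>"
      by (metis abs_mult abs_triangle_ineq)
    also have "\<dots> \<le> (?M * norm (x - y)) * 1 + ?Q * (L * norm (x - y))"
    proof (intro add_mono mult_mono)
      have "\<bar>?P x - ?P y\<bar> \<le> ?M * \<bar>d x - d y\<bar>" using \<epsilon>(1) \<alpha>(1) by (rule profile_Lipschitz)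
      also have "\<dots> \<le> ?M * norm (x - y)" using \<epsilon>(1)[of N] \<alpha> d_Lipschitz by (intro mult_left_mono) auto
      finally show "\<bar>?P x - ?P y\<bar> \<le> ?M * norm (x - y)" .
      show "0 \<le> ?M * norm (x - y)" using \<epsilon>(1)[of N] \<alpha> by simp
    qed (use \<eta>[of x] P[of y] \<eta>_Lipschitz in auto)
    finally show ?thesis by (simp add: algebra_simps)
  qed
  moreover have "0 \<le> ?M + ?Q * L" using \<epsilon>(1)[of N] \<alpha> L_nonneg by simp
  ultimately show ?thesis using that[of "?M + ?Q * L"] by (simp add: lipschitz_on_def dist_norm)
qed

lemma approx_zero_outside: "norm x > 1 \<Longrightarrow> approx N x = 0"
proof -
  assume x: "norm x > 1"
  show "approx N x = 0"
  proof (cases "\<eta> x = 0")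
    case False
    then have "1 / \<beta> \<le> d x" using support[of x] x by force
    then show ?thesis unfolding approx_def using profile_support[OF \<epsilon>(1) \<alpha>(1) \<beta>] by simp
  qed (simp add: approx_def)
qed

lemma d_powr_le: "d x < 1 / \<beta> \<Longrightarrow> 0 < d x \<Longrightarrow> d x powr (- \<alpha>) \<le> (1 / \<beta>) * d x powr (- (\<alpha> + 1))"
proof -
  assume x: "d x < 1 / \<beta>" "0 < d x"
  have "d x powr (- \<alpha>) = d x powr (1 + - (\<alpha> + 1))" by simp
  also have "\<dots> = d x * d x powr (- (\<alpha> + 1))" using x by (subst powr_add) simp
  also have "\<dots> \<le> (1 / \<beta>) * d x powr (- (\<alpha> + 1))" using x by (intro mult_right_mono) auto
  finally show ?thesis .
qed

lemma profile_le_d: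
  assumes "0 < d x"
  shows "profile \<alpha> b (\<epsilon> N) ((d x)\<^sup>2) \<le> d x powr (- \<alpha>)"
proof -
  have "profile \<alpha> b (\<epsilon> N) ((d x)\<^sup>2) \<le> ((d x)\<^sup>2 + (\<epsilon> N)\<^sup>2) powr (- \<alpha> / 2)"
    using \<epsilon>(1) by (intro profile_le) auto
  also have "\<dots> \<le> ((d x)\<^sup>2) powr (- \<alpha> / 2)" using assms \<alpha> by (intro powr_mono2') auto
  also have "\<dots> = d x powr (- \<alpha>)" using powr_neg_half[of "d x" \<alpha>] assms by simp
  finally show ?thesis .
qed

lemma approx_bound:
  assumes "0 < d x"
  shows "\<bar>approx N x\<bar> \<le> majorant x"
proof (cases "d x < 1 / \<beta>")
  case True
  let ?P = "profile \<alpha> b (\<epsilon> N) ((d x)\<^sup>2)"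
  have "?P \<le> d x powr (- \<alpha>)" using assms by (rule profile_le_d)
  moreover have "0 \<le> ?P" using \<epsilon>(1) by (rule profile_nonneg)
  ultimately have "approx N x \<le> d x powr (- \<alpha>) * 1" "0 \<le> approx N x"
    unfolding approx_def using \<eta>[of x] by (auto intro: mult_mono mult_nonneg_nonneg simp del: mult_1_right)
  then have "\<bar>approx N x\<bar> \<le> d x powr (- \<alpha>) * 1" by linarith
  also have "\<dots> \<le> (1 / \<beta>) * d x powr (- (\<alpha> + 1))" using d_powr_le[OF True assms] by simp
  also have "\<dots> \<le> majorant x" unfolding majorant_def
    using \<alpha> \<beta> L_nonneg by (intro mult_right_mono) (auto simp: add_divide_distrib)
  finally show ?thesis .
next
  case False
  then show ?thesis unfolding approx_def majorant_def using profile_support[OF \<epsilon>(1) \<alpha>(1) \<beta>, of "d x" N] majorant_const_pos by simp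
qed

text \<open>The surplus \<open>h\<^sup>2\<close> accommodates the square of a Lipschitz function.\<close>
lemma partial_deriv_bound_aux:
  assumes "\<And>h. 0 < h \<Longrightarrow> \<bar>f (x + h *\<^sub>R axis i 1) - f x\<bar> \<le> h * (K + h)"
    and "has_partial_deriv f i x l"
  shows "\<bar>l\<bar> \<le> K"
proof (rule LIMSEQ_le)
  show "(\<lambda>m. \<bar>(f (x + (1 / real (Suc m)) *\<^sub>R axis i 1) - f x) * real (Suc m)\<bar>) \<longlonglongrightarrow> \<bar>l\<bar>"
    by (intro tendsto_rabs partial_deriv_LIMSEQ assms)
  show "(\<lambda>m. K + 1 / real (Suc m)) \<longlonglongrightarrow> K"
    using tendsto_add[OF tendsto_const[of K] LIMSEQ_inverse_real_of_nat] by (simp add: inverse_eq_divide)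
  show "\<exists>N. \<forall>m\<ge>N. \<bar>(f (x + (1 / real (Suc m)) *\<^sub>R axis i 1) - f x) * real (Suc m)\<bar> \<le> K + 1 / real (Suc m)"
  proof (intro exI allI impI)
    fix m
    have "\<bar>f (x + (1 / real (Suc m)) *\<^sub>R axis i 1) - f x\<bar> * real (Suc m)
        \<le> (1 / real (Suc m) * (K + 1 / real (Suc m))) * real (Suc m)"
      by (intro mult_right_mono assms(1)) auto
    then show "\<bar>(f (x + (1 / real (Suc m)) *\<^sub>R axis i 1) - f x) * real (Suc m)\<bar> \<le> K + 1 / real (Suc m)"
      by (simp add: abs_mult del: of_nat_Suc)
  qed
qed

lemma d_sqr_deriv_bound:
  assumes "has_partial_deriv (\<lambda>x. (d x)\<^sup>2) i x l"
  shows "\<bar>l\<bar> \<le> 2 * d x"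
proof (rule partial_deriv_bound_aux[OF _ assms])
  fix h :: real assume h: "0 < h"
  let ?y = "x + h *\<^sub>R axis i 1"
  have 1: "\<bar>d ?y - d x\<bar> \<le> h" using d_Lipschitz[of ?y x] h by simp
  have "(d ?y)\<^sup>2 - (d x)\<^sup>2 = (d ?y - d x) * (d ?y + d x)" by (simp add: power2_eq_square algebra_simps)
  then have "\<bar>(d ?y)\<^sup>2 - (d x)\<^sup>2\<bar> = \<bar>d ?y - d x\<bar> * \<bar>d ?y + d x\<bar>" by (simp add: abs_mult)
  also have "\<dots> \<le> h * (2 * d x + h)" using 1 h d_nonneg[of x] d_nonneg[of ?y] by (intro mult_mono) auto
  finally show "\<bar>(d ?y)\<^sup>2 - (d x)\<^sup>2\<bar> \<le> h * (2 * d x + h)" .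
qed

lemma \<eta>_deriv_bound:
  assumes "has_partial_deriv \<eta> i x l"
  shows "\<bar>l\<bar> \<le> L"
proof (rule partial_deriv_bound_aux[OF _ assms])
  fix h :: real assume h: "0 < h"
  have "\<bar>\<eta> (x + h *\<^sub>R axis i 1) - \<eta> x\<bar> \<le> L * h" using \<eta>_Lipschitz[of "x + h *\<^sub>R axis i 1" x] h by simp
  also have "\<dots> \<le> h * (L + h)" using h by (simp add: algebra_simps)
  finally show "\<bar>\<eta> (x + h *\<^sub>R axis i 1) - \<eta> x\<bar> \<le> h * (L + h)" .
qed

text \<open>The chain rule, the bound \<open>|\<partial>(d\<^sup>2)| \<le> 2 d\<close>, and the limits of the smooth profile and its derivative.\<close>
lemma approx_deriv:
  assumes x: "0 < d x" and l: "has_partial_deriv (\<lambda>x. (d x)\<^sup>2) i x l" and m: "has_partial_deriv \<eta> i x m"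
  defines "D N \<equiv> profile' \<alpha> b (\<epsilon> N) ((d x)\<^sup>2) * l * \<eta> x + profile \<alpha> b (\<epsilon> N) ((d x)\<^sup>2) * m"
  shows "has_partial_deriv (approx N) i x (D N)" "\<bar>D N\<bar> \<le> majorant x" "D \<longlonglongrightarrow> grad i x"
proof -
  let ?P = "\<lambda>N. profile \<alpha> b (\<epsilon> N) ((d x)\<^sup>2)" and ?P' = "\<lambda>N. profile' \<alpha> b (\<epsilon> N) ((d x)\<^sup>2)"
  have "(profile \<alpha> b (\<epsilon> N) has_real_derivative ?P' N) (at ((d (x + 0 *\<^sub>R axis i 1))\<^sup>2))"
    using DERIV_profile[OF \<epsilon>(1), of "(d x)\<^sup>2"] by simp
  from DERIV_mult[OF DERIV_chain2[OF this l] m]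
  show "has_partial_deriv (approx N) i x (D N)"
    unfolding approx_def D_def by (simp add: mult_ac add.commute)
  show "\<bar>D N\<bar> \<le> majorant x"
  proof (cases "d x < 1 / \<beta>")
    case True
    have "\<bar>?P' N\<bar> \<le> \<alpha> / 2 * ((d x)\<^sup>2 + (\<epsilon> N)\<^sup>2) powr (- \<alpha> / 2 - 1)" using \<epsilon>(1) \<alpha>(1) by (intro profile'_bound) auto
    also have "\<dots> \<le> \<alpha> / 2 * ((d x)\<^sup>2) powr (- \<alpha> / 2 - 1)" using x \<alpha> by (intro mult_left_mono powr_mono2') auto
    also have "((d x)\<^sup>2) powr (- \<alpha> / 2 - 1) = d x powr (- (\<alpha> + 2))"
    proof -
      have "- \<alpha> / 2 - 1 = - ((\<alpha> + 2) / 2)" by (simp add: field_simps)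
      then show ?thesis using powr_neg_half[of "d x" "\<alpha> + 2"] x by simp
    qed
    finally have 1: "\<bar>?P' N\<bar> \<le> \<alpha> / 2 * d x powr (- (\<alpha> + 2))" .
    have "?P N \<le> d x powr (- \<alpha>)" using x by (rule profile_le_d)
    also note d_powr_le[OF True x]
    finally have 2: "?P N \<le> (1 / \<beta>) * d x powr (- (\<alpha> + 1))" .
    have 0: "0 \<le> ?P N" using \<epsilon>(1) by (rule profile_nonneg)
    have "\<bar>D N\<bar> \<le> \<bar>?P' N\<bar> * \<bar>l\<bar> * \<bar>\<eta> x\<bar> + \<bar>?P N\<bar> * \<bar>m\<bar>"
      unfolding D_def by (metis abs_mult abs_triangle_ineq)
    also have "\<dots> \<le> (\<alpha> / 2 * d x powr (- (\<alpha> + 2))) * (2 * d x) * 1 + ((1 / \<beta>) * d x powr (- (\<alpha> + 1))) * L"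
      using 0 1 2 d_sqr_deriv_bound[OF l] \<eta>_deriv_bound[OF m] \<eta>[of x] x \<alpha> \<beta>
      by (intro add_mono mult_mono) auto
    also have "\<dots> = (\<alpha> + L / \<beta>) * d x powr (- (\<alpha> + 1))"
    proof -
      have "d x powr (- (\<alpha> + 1)) = d x powr (1 + - (\<alpha> + 2))"
        by (rule arg_cong[where f = "\<lambda>a. d x powr a"]) simp
      also have "\<dots> = d x * d x powr (- (\<alpha> + 2))" using x by (subst powr_add) simp
      finally show ?thesis by (simp add: algebra_simps)
    qed
    also have "\<dots> \<le> majorant x" unfolding majorant_def
      using \<beta> by (intro mult_right_mono) (auto simp: add_divide_distrib)
    finally show ?thesis .
  next
    case False
    then have "D N = 0" unfolding D_def using profile_support[OF \<epsilon>(1) \<alpha>(1) \<beta>, of "d x" N] by simp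
    then show ?thesis unfolding majorant_def using majorant_const_pos by simp
  qed
  have "D \<longlonglongrightarrow> (if b < d x powr (- \<alpha>) then - \<alpha> / 2 * ((d x)\<^sup>2) powr (- \<alpha> / 2 - 1) else 0) * l * \<eta> x
      + max (d x powr (- \<alpha>) - b) 0 * m"
    unfolding D_def by (intro tendsto_add tendsto_mult tendsto_const profile_limits x \<epsilon> \<alpha>(1))
  also have "(if b < d x powr (- \<alpha>) then - \<alpha> / 2 * ((d x)\<^sup>2) powr (- \<alpha> / 2 - 1) else 0) * l * \<eta> x
      + max (d x powr (- \<alpha>) - b) 0 * m = grad i x"
    unfolding grad_def using partial_deriv_eq[OF l] partial_deriv_eq[OF m] by simp
  finally show "D \<longlonglongrightarrow> grad i x" .
qed

lemma AE_approx_deriv: "AE x in lborel. \<bar>partial_deriv (approx N) i x\<bar> \<le> majorant x"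
  and AE_approx_differentiable: "AE x in lborel. \<exists>l. has_partial_deriv (approx N) i x l"
  and AE_approx_deriv_lim: "AE x in lborel. (\<lambda>N. partial_deriv (approx N) i x) \<longlonglongrightarrow> grad i x"
  and AE_grad_bound: "AE x in lborel. \<bar>grad i x\<bar> \<le> majorant x"
proof -
  have "AE x in lborel. (\<exists>D. (\<forall>N. has_partial_deriv (approx N) i x (D N) \<and> \<bar>D N\<bar> \<le> majorant x) \<and> D \<longlonglongrightarrow> grad i x)"
    using AE_d_pos d_sqr_deriv \<eta>_deriv
  proof eventually_elim
    case (elim x)
    obtain l where l: "has_partial_deriv (\<lambda>x. (d x)\<^sup>2) i x l" using elim(2) by blast
    obtain m where m: "has_partial_deriv \<eta> i x m" using elim(3) by blast
    show ?case
      by (intro exI[of _ "\<lambda>N. profile' \<alpha> b (\<epsilon> N) ((d x)\<^sup>2) * l * \<eta> x + profile \<alpha> b (\<epsilon> N) ((d x)\<^sup>2) * m"]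
        conjI allI approx_deriv[OF elim(1) l m])
  qed
  then have *: "AE x in lborel. (\<forall>N. (\<exists>l. has_partial_deriv (approx N) i x l) \<and> \<bar>partial_deriv (approx N) i x\<bar> \<le> majorant x) \<and>
      (\<lambda>N. partial_deriv (approx N) i x) \<longlonglongrightarrow> grad i x"
  proof eventually_elim
    case (elim x)
    then obtain D where D: "\<And>N. has_partial_deriv (approx N) i x (D N)" "\<And>N. \<bar>D N\<bar> \<le> majorant x" "D \<longlonglongrightarrow> grad i x"
      by blast
    have eq: "partial_deriv (approx N) i x = D N" for N by (rule partial_deriv_eq[OF D(1)])
    have "(\<lambda>N. partial_deriv (approx N) i x) = D" using eq by blast
    then show ?case using D eq by auto
  qed
  show "AE x in lborel. \<bar>partial_deriv (approx N) i x\<bar> \<le> majorant x" using * by eventually_elim blast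
  show "AE x in lborel. \<exists>l. has_partial_deriv (approx N) i x l" using * by eventually_elim blast
  show "AE x in lborel. (\<lambda>N. partial_deriv (approx N) i x) \<longlonglongrightarrow> grad i x" using * by eventually_elim blast
  show "AE x in lborel. \<bar>grad i x\<bar> \<le> majorant x"
    using *
  proof eventually_elim
    case (elim x)
    have "(\<lambda>N. \<bar>partial_deriv (approx N) i x\<bar>) \<longlonglongrightarrow> \<bar>grad i x\<bar>" using elim by (intro tendsto_rabs) blast
    then show ?case by (rule LIMSEQ_le_const2) (use elim in blast)
  qed
qed

lemma approx_lim: "0 < d x \<Longrightarrow> (\<lambda>N. approx N x) \<longlonglongrightarrow> u x"
  unfolding approx_def u_def by (intro tendsto_mult tendsto_const profile_limits \<epsilon> \<alpha>(1))

lemma u_bound: "0 < d x \<Longrightarrow> \<bar>u x\<bar> \<le> majorant x"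
  by (rule LIMSEQ_le_const2[OF tendsto_rabs[OF approx_lim]]) (use approx_bound in auto)

lemma majorant_integrable:
  assumes "compact K"
  shows "set_integrable lborel K majorant"
proof -
  have \<alpha>1: "\<alpha> + 1 < lam"
  proof -
    have "\<alpha> + 1 = (\<alpha> + 1) * 1" by simp
    also have "\<dots> \<le> (\<alpha> + 1) * p" using p \<alpha> by (intro mult_left_mono) auto
    also have "\<dots> < lam" by (rule \<alpha>(2))
    finally show ?thesis .
  qed
  obtain A where A: "0 \<le> A" "\<And>y r. 0 < r \<Longrightarrow>
    (\<integral>\<^sup>+x\<in>ball y r. ennreal (d x powr (- (\<alpha> + 1))) \<partial>lborel) \<le> ennreal (A * r powr (real CARD('n) - (\<alpha> + 1)))"
    using integral_d_powr_ball[of "\<alpha> + 1"] \<alpha> \<alpha>1 by auto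
  obtain r where r: "0 < r" "K \<subseteq> ball 0 r"
    using bounded_subset_ballD[OF compact_imp_bounded[OF assms], of 0] by blast
  have K: "K \<in> sets borel" using assms by (simp add: compact_imp_closed borel_closed)
  let ?k = "\<alpha> + (1 + L) / \<beta>"
  show ?thesis unfolding set_integrable_def integrable_iff_bounded
  proof
    show "(\<lambda>x. indicat_real K x *\<^sub>R majorant x) \<in> borel_measurable lborel" using K by simp
    have "(\<integral>\<^sup>+x. ennreal (norm (indicat_real K x *\<^sub>R majorant x)) \<partial>lborel)
      \<le> (\<integral>\<^sup>+x. ennreal ?k * (ennreal (d x powr (- (\<alpha> + 1))) * indicator (ball 0 r) x) \<partial>lborel)"
    proof (rule nn_integral_mono)
      fix x
      show "ennreal (norm (indicat_real K x *\<^sub>R majorant x))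
        \<le> ennreal ?k * (ennreal (d x powr (- (\<alpha> + 1))) * indicator (ball 0 r) x)"
        using r(2) majorant_const_pos by (cases "x \<in> K") (auto simp: majorant_def abs_mult ennreal_mult)
    qed
    also have "\<dots> = ennreal ?k * (\<integral>\<^sup>+x\<in>ball 0 r. ennreal (d x powr (- (\<alpha> + 1))) \<partial>lborel)"
      by (subst nn_integral_cmult) auto
    also have "\<dots> \<le> ennreal ?k * ennreal (A * r powr (real CARD('n) - (\<alpha> + 1)))"
      using A(2)[OF r(1)] by (intro mult_left_mono) auto
    also have "\<dots> < \<infinity>" by (simp flip: ennreal_mult'' add: ennreal_mult_less_top)
    finally show "(\<integral>\<^sup>+x. ennreal (norm (indicat_real K x *\<^sub>R majorant x)) \<partial>lborel) < \<infinity>" .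
  qed
qed

lemma locally_integrable_of_majorant:
  fixes f :: "real ^ 'n \<Rightarrow> 'b::euclidean_space"
  assumes [measurable]: "f \<in> borel_measurable borel" and "AE x in lborel. norm (f x) \<le> c * majorant x"
  shows "locally_integrable_on UNIV f"
  unfolding locally_integrable_on_def
proof (intro allI impI)
  fix K :: "(real ^ 'n) set" assume "compact K \<and> K \<subseteq> UNIV"
  then have K: "compact K" "K \<in> sets borel" by (simp_all add: compact_imp_closed borel_closed)
  have "integrable lborel (\<lambda>x. indicat_real K x *\<^sub>R f x)"
  proof (rule Bochner_Integration.integrable_bound)
    show "integrable lborel (\<lambda>x. c * (indicat_real K x *\<^sub>R majorant x))"
      using majorant_integrable[OF K(1)] unfolding set_integrable_def by auto
    show "(\<lambda>x. indicat_real K x *\<^sub>R f x) \<in> borel_measurable lborel" using K(2) by simp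
    show "AE x in lborel. norm (indicat_real K x *\<^sub>R f x) \<le> norm (c * (indicat_real K x *\<^sub>R majorant x))"
      using assms(2) by eventually_elim (auto simp: indicator_def)
  qed
  then show "f absolutely_integrable_on K"
    unfolding set_integrable_def using K(2) by (subst integrable_completion) auto
qed

definition gradient :: "real ^ 'n \<Rightarrow> real ^ 'n" where
  "gradient x = (\<chi> i. grad i x)"

lemma gradient_measurable [measurable]: "gradient \<in> borel_measurable borel"
  unfolding gradient_def[abs_def] by (rule vec_borel_measurable) simp

lemma AE_norm_gradient: "AE x in lborel. norm (gradient x) \<le> real CARD('n) * majorant x"
proof -
  have "AE x in lborel. \<forall>i. \<bar>grad i x\<bar> \<le> majorant x"
    using AE_grad_bound by (subst AE_all_countable) auto
  then show ?thesis
  proof eventually_elim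
    case (elim x)
    have "norm (gradient x) \<le> (\<Sum>i\<in>UNIV. \<bar>gradient x $ i\<bar>)" by (rule norm_le_l1_cart)
    also have "\<dots> \<le> (\<Sum>i\<in>(UNIV :: 'n set). majorant x)" using elim unfolding gradient_def by (intro sum_mono) auto
    finally show ?case by simp
  qed
qed

lemma weak_gradient: "has_weak_gradient_on u gradient UNIV"
  unfolding has_weak_gradient_on_def
proof (intro conjI allI impI)
  show "locally_integrable_on UNIV u"
  proof (rule locally_integrable_of_majorant[of _ 1])
    show "AE x in lborel. norm (u x) \<le> 1 * majorant x" using AE_d_pos by eventually_elim (use u_bound in simp)
  qed simp
  show "locally_integrable_on UNIV gradient"
    using AE_norm_gradient by (rule locally_integrable_of_majorant[rotated]) simp
  fix \<phi> :: "real ^ 'n \<Rightarrow> real" and i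
  assume "test_function_on UNIV \<phi>"
  then interpret test_fun \<phi> by unfold_locales
  have [measurable]: "d\<phi> i \<in> borel_measurable borel" "\<phi> \<in> borel_measurable borel"
    using continuous continuous_d\<phi> by (auto intro: borel_measurable_continuous_onI)
  have approx_cont: "continuous_on UNIV (approx N)" for N
    by (rule approx_Lipschitz[of N]) (rule lipschitz_on_continuous_on)
  have "(LINT x|lborel. u x * d\<phi> i x) = - (LINT x|lborel. grad i x * \<phi> x)"
  proof (rule integration_by_parts_limit[where F = approx and G = "\<lambda>N. partial_deriv (approx N) i" and w = majorant])
    show "(LINT x|lborel. approx N x * d\<phi> i x) = - (LINT x|lborel. partial_deriv (approx N) i x * \<phi> x)" for N
    proof -
      obtain M where "M-lipschitz_on UNIV (approx N)" by (rule approx_Lipschitz)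
      then show ?thesis using approx_zero_outside AE_approx_differentiable by (rule integration_by_parts_Lipschitz)
    qed
    show "approx N \<in> borel_measurable borel" for N using approx_cont by (rule borel_measurable_continuous_onI)
    show "partial_deriv (approx N) i \<in> borel_measurable borel" for N using approx_cont by (rule borel_measurable_partial_deriv)
    show "AE x in lborel. \<bar>approx N x\<bar> \<le> majorant x" for N using AE_d_pos by eventually_elim (rule approx_bound)
    show "AE x in lborel. (\<lambda>N. approx N x) \<longlonglongrightarrow> u x" using AE_d_pos by eventually_elim (rule approx_lim)
  qed (use majorant_integrable AE_approx_deriv AE_approx_deriv_lim in auto)
  then show "(LINT x:UNIV|lebesgue. u x * d\<phi> i x) = - (LINT x:UNIV|lebesgue. gradient x $ i * \<phi> x)"
    unfolding set_lebesgue_integral_def gradient_def by (simp add: integral_completion)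
qed

text \<open>The gradient is bounded by a multiple of \<open>d\<close> to the power \<open>- (\<alpha> + 1)\<close>, and \<open>s = (\<alpha> + 1) p\<close> is less than
  \<open>lam\<close>.\<close>
lemma triple_norm_gradient: "triple_norm p lam (ball 0 1) gradient < \<infinity>"
proof -
  let ?n = "real CARD('n)"
  let ?k = "?n * (\<alpha> + (1 + L) / \<beta>)"
  obtain B where B: "0 \<le> B" "\<And>y. (\<integral>\<^sup>+x\<in>ball y 2. ennreal (d x powr (- ((\<alpha> + 1) * p)) * norm (x - y) powr (lam - ?n)) \<partial>lborel) \<le> ennreal B"
    using integral_d_powr_kernel[of "(\<alpha> + 1) * p"] \<alpha> p by auto
  have k: "0 \<le> ?k" using majorant_const_pos by simp
  have "(\<integral>\<^sup>+x\<in>ball 0 1. ennreal (norm (gradient x) powr p * norm (x - y) powr (lam - ?n)) \<partial>lebesgue) \<le> ennreal (?k powr p) * ennreal B"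
    if y: "y \<in> closure (ball 0 1)" for y
  proof -
    have y1: "norm y \<le> 1" using y by simp
    have "(\<integral>\<^sup>+x\<in>ball 0 1. ennreal (norm (gradient x) powr p * norm (x - y) powr (lam - ?n)) \<partial>lebesgue)
      = (\<integral>\<^sup>+x\<in>ball 0 1. ennreal (norm (gradient x) powr p * norm (x - y) powr (lam - ?n)) \<partial>lborel)"
      by (rule nn_integral_completion)
    also have "\<dots> \<le> (\<integral>\<^sup>+x. ennreal (?k powr p) * (ennreal (d x powr (- ((\<alpha> + 1) * p)) * norm (x - y) powr (lam - ?n)) * indicator (ball y 2) x) \<partial>lborel)"
    proof (rule nn_integral_mono_AE)
      show "AE x in lborel. ennreal (norm (gradient x) powr p * norm (x - y) powr (lam - ?n)) * indicator (ball 0 1) x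
        \<le> ennreal (?k powr p) * (ennreal (d x powr (- ((\<alpha> + 1) * p)) * norm (x - y) powr (lam - ?n)) * indicator (ball y 2) x)"
        using AE_norm_gradient
      proof eventually_elim
        case (elim x)
        show ?case
        proof (cases "x \<in> ball 0 1")
          case True
          have "norm (y - x) \<le> norm y + norm x" by (rule norm_triangle_ineq4)
          then have xy: "x \<in> ball y 2" using y1 True by (simp add: dist_norm)
          have "norm (gradient x) \<le> ?k * d x powr (- (\<alpha> + 1))" using elim unfolding majorant_def by (simp add: mult.assoc)
          then have "norm (gradient x) powr p \<le> (?k * d x powr (- (\<alpha> + 1))) powr p"
            using p by (intro powr_mono2) auto
          also have "\<dots> = ?k powr p * d x powr (- ((\<alpha> + 1) * p))"
          proof -
            have "(?k * d x powr (- (\<alpha> + 1))) powr p = ?k powr p * (d x powr (- (\<alpha> + 1))) powr p"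
              using k by (simp only: powr_mult powr_ge_zero)
            then show ?thesis by (simp only: powr_powr mult_minus_left)
          qed
          finally have "norm (gradient x) powr p * norm (x - y) powr (lam - ?n)
            \<le> ?k powr p * (d x powr (- ((\<alpha> + 1) * p)) * norm (x - y) powr (lam - ?n))"
            unfolding mult.assoc[symmetric] by (rule mult_right_mono) simp
          then show ?thesis using True xy by (simp add: ennreal_leI flip: ennreal_mult)
        qed simp
      qed
    qed
    also have "\<dots> = ennreal (?k powr p) * (\<integral>\<^sup>+x\<in>ball y 2. ennreal (d x powr (- ((\<alpha> + 1) * p)) * norm (x - y) powr (lam - ?n)) \<partial>lborel)"
      by (rule nn_integral_cmult) measurable
    also have "\<dots> \<le> ennreal (?k powr p) * ennreal B" by (intro mult_left_mono B(2)) simp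
    finally show ?thesis .
  qed
  then have "(SUP y \<in> closure (ball 0 1). \<integral>\<^sup>+x\<in>ball 0 1. ennreal (norm (gradient x) powr p * norm (x - y) powr (lam - ?n)) \<partial>lebesgue)
    \<le> ennreal (?k powr p) * ennreal B" by (rule SUP_least)
  also have "\<dots> < \<infinity>" by (simp add: ennreal_mult_less_top)
  finally show ?thesis unfolding triple_norm_def ennreal_powr_finite .
qed

lemma embedding_counterexample_u: "embedding_counterexample p lam q u"
proof -
  have "morrey_norm p lam (ball 0 1) gradient < \<infinity>"
    using triple_norm_gradient codim by (intro morrey_norm_finite) auto
  then show ?thesis
    unfolding embedding_counterexample_def
    using u_zero_outside Lq_norm_u weak_gradient triple_norm_gradient by auto
qed

end

section \<open>Cutoff functions\<close>

text \<open>The differentiability requirement is the one that makes \<open>\<xi>(|x|)\<close> differentiable along lines, including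
  at \<open>x = 0\<close>, in every dimension.\<close>
definition admissible_cutoff :: "(real \<Rightarrow> real) \<Rightarrow> bool" where
  "admissible_cutoff \<xi> \<longleftrightarrow>
     (\<exists>L. \<forall>s\<ge>0. \<forall>t\<ge>0. \<bar>\<xi> s - \<xi> t\<bar> \<le> L * \<bar>s - t\<bar>) \<and>
     (\<forall>t\<ge>0. 0 \<le> \<xi> t \<and> \<xi> t \<le> 1) \<and>
     (\<exists>c>0. \<forall>t. 0 \<le> t \<and> t < 1 / 2 \<longrightarrow> c \<le> \<xi> t) \<and>
     (\<forall>t\<ge>sqrt 3 / 3. \<xi> t = 0) \<and>
     (\<forall>g l. (g has_real_derivative l) (at 0) \<and> (\<forall>t. 0 \<le> g t) \<longrightarrow>
        (\<exists>l'. ((\<lambda>t. \<xi> (sqrt (g t))) has_real_derivative l') (at 0)))"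

text \<open>The derivative vanishes outside \<open>[1 / 4, 1]\<close> and is continuous on this compact interval, hence bounded.\<close>
lemma admissible_cutoff_cutoff_function:
  assumes "cutoff_function \<xi>"
  shows "admissible_cutoff \<xi>"
proof -
  have smooth: "smooth_on {0<..} \<xi>" and range: "\<And>t. 0 \<le> t \<Longrightarrow> 0 \<le> \<xi> t \<and> \<xi> t \<le> 1"
    and one: "\<And>t. 0 \<le> t \<Longrightarrow> t < 1 / 2 \<Longrightarrow> \<xi> t = 1" and zero: "\<And>t. sqrt 3 / 3 \<le> t \<Longrightarrow> \<xi> t = 0"
    using assms unfolding cutoff_function_def by auto
  define \<xi>' where "\<xi>' = (\<lambda>t. frechet_derivative \<xi> (at t) 1)"
  have "Ck_on (Suc 0) {0<..} \<xi>" using smooth unfolding smooth_on_def by blast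
  then have diff: "\<And>t. 0 < t \<Longrightarrow> \<xi> differentiable (at t)" and cont: "continuous_on {0<..} \<xi>'"
    unfolding \<xi>'_def by auto
  have deriv: "(\<xi> has_real_derivative \<xi>' t) (at t)" if t: "0 < t" for t
  proof -
    have "(\<xi> has_derivative frechet_derivative \<xi> (at t)) (at t)" using diff[OF t] frechet_derivative_works by blast
    moreover have "frechet_derivative \<xi> (at t) = (*) (\<xi>' t)"
    proof
      fix h :: real
      have "linear (frechet_derivative \<xi> (at t))" using diff[OF t] linear_frechet_derivative by blast
      from linear_scale[OF this, of h 1] show "frechet_derivative \<xi> (at t) h = \<xi>' t * h"
        unfolding \<xi>'_def by (simp add: mult.commute)
    qed
    ultimately show ?thesis unfolding has_field_derivative_def by simp
  qed
  have "bounded (\<xi>' ` {1 / 4..1})"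
    by (intro compact_imp_bounded compact_continuous_image continuous_on_subset[OF cont]) auto
  then obtain B where B: "\<And>t. 1 / 4 \<le> t \<Longrightarrow> t \<le> 1 \<Longrightarrow> \<bar>\<xi>' t\<bar> \<le> B" unfolding bounded_iff by force
  have B0: "0 \<le> B" using B[of 1] by (simp add: order_trans[OF abs_ge_zero])
  have sqrt3: "sqrt 3 / 3 < 1" using real_sqrt_less_mono[of 3 4] by simp
  have bound: "\<bar>\<xi>' t\<bar> \<le> B" if t: "0 < t" for t
  proof -
    have const: "\<xi>' t = 0" if "open S" "t \<in> S" "\<And>s. s \<in> S \<Longrightarrow> c = \<xi> s" for S c
    proof -
      have "(\<xi> has_real_derivative 0) (at t)"
        by (rule has_field_derivative_transform_within_open[OF DERIV_const[of c]]) (use that in auto)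
      then show ?thesis using deriv[OF t] DERIV_unique by blast
    qed
    consider "t < 1 / 4" | "1 / 4 \<le> t" "t \<le> 1" | "1 < t" by linarith
    then show ?thesis
    proof cases
      case 1
      then show ?thesis using const[of "{0<..<1 / 2}" 1] one t B0 by auto
    next
      case 3
      then show ?thesis using const[of "{1<..}" 0] zero sqrt3 B0 by auto
    qed (rule B)
  qed
  have Lip: "\<bar>\<xi> s - \<xi> t\<bar> \<le> B * \<bar>s - t\<bar>" if "0 < s" "0 < t" for s t
  proof -
    have "norm (\<xi> s - \<xi> t) \<le> B * norm (s - t)"
    proof (rule field_differentiable_bound[of "{0<..}"])
      fix z :: real assume "z \<in> {0<..}"
      then show "(\<xi> has_field_derivative \<xi>' z) (at z within {0<..})" "norm (\<xi>' z) \<le> B"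
        using deriv bound by (auto intro: has_field_derivative_at_within)
    qed (use that in auto)
    then show ?thesis by simp
  qed
  have Lip0: "\<bar>\<xi> 0 - \<xi> t\<bar> \<le> B * \<bar>0 - t\<bar>" if "0 \<le> t" for t
  proof (cases "t = 0")
    case False
    let ?m = "min t (1 / 4)"
    have "\<xi> 0 = \<xi> ?m" using that by (simp add: one)
    moreover have "\<bar>\<xi> ?m - \<xi> t\<bar> \<le> B * \<bar>?m - t\<bar>" using that False by (intro Lip) auto
    moreover have "B * \<bar>?m - t\<bar> \<le> B * \<bar>0 - t\<bar>" using that B0 by (intro mult_left_mono) auto
    ultimately show ?thesis by simp
  qed simp
  have "\<bar>\<xi> s - \<xi> t\<bar> \<le> B * \<bar>s - t\<bar>" if "0 \<le> s" "0 \<le> t" for s t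
    using Lip[of s t] Lip0[of t] Lip0[of s] that
    by (cases "s = 0"; cases "t = 0") (auto simp: abs_minus_commute)
  moreover have "\<exists>l'. ((\<lambda>t. \<xi> (sqrt (g t))) has_real_derivative l') (at 0)"
    if g: "(g has_real_derivative l) (at 0)" "\<And>t. 0 \<le> g t" for g l
  proof (cases "g 0 < 1 / 4")
    case True
    have "isCont g 0" using g(1) by (rule DERIV_isCont)
    then have "\<forall>\<^sub>F t in nhds 0. g t < 1 / 4"
      unfolding eventually_nhds_conv_at isCont_def using True order_tendstoD(2)[of g "g 0" "at 0" "1 / 4"] by blast
    then have ev: "\<forall>\<^sub>F t in nhds 0. \<xi> (sqrt (g t)) = 1"
    proof eventually_elim
      case (elim t)
      then have "sqrt (g t) < 1 / 2" using real_sqrt_less_mono[of "g t" "1 / 4"] by (simp add: real_sqrt_divide)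
      then show ?case using g(2)[of t] by (intro one) auto
    qed
    have "((\<lambda>t. 1) has_real_derivative 0) (at (0::real))" by simp
    then have "((\<lambda>t. \<xi> (sqrt (g t))) has_real_derivative 0) (at 0)"
      using DERIV_cong_ev[OF refl ev refl] by blast
    then show ?thesis by blast
  next
    case False
    then have g0: "0 < g 0" by linarith
    then have "0 < sqrt (g 0)" by simp
    from DERIV_chain2[OF deriv[OF this] DERIV_chain2[OF DERIV_real_sqrt[OF g0] g(1)]]
    show ?thesis by blast
  qed
  moreover have "\<exists>c>0. \<forall>t. 0 \<le> t \<and> t < 1 / 2 \<longrightarrow> c \<le> \<xi> t"
    by (rule exI[of _ 1]) (simp add: one)
  ultimately show ?thesis unfolding admissible_cutoff_def using range zero by blast
qed

text \<open>A cutoff function that is only continuously differentiable suffices where any cutoff function will do.\<close>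
lemma admissible_cutoff_exists: "\<exists>\<xi>. admissible_cutoff \<xi> \<and> \<xi> 0 = 1"
proof -
  define \<xi> :: "real \<Rightarrow> real" where "\<xi> = (\<lambda>t. (max (1 - 3 * t\<^sup>2) 0)\<^sup>2)"
  have deriv: "(\<xi> has_real_derivative 2 * max (1 - 3 * t\<^sup>2) 0 * (- (6 * t))) (at t)" for t
  proof -
    have "((\<lambda>t. 1 - 3 * t\<^sup>2) has_real_derivative - (6 * t)) (at t)" by (auto intro!: derivative_eq_intros)
    from DERIV_chain2[OF DERIV_max_0_square this] show ?thesis unfolding \<xi>_def by simp
  qed
  have "\<bar>\<xi> s - \<xi> t\<bar> \<le> 12 * \<bar>s - t\<bar>" for s t
  proof -
    have "norm (\<xi> s - \<xi> t) \<le> 12 * norm (s - t)"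
    proof (rule field_differentiable_bound[of UNIV])
      fix z :: real
      show "(\<xi> has_field_derivative 2 * max (1 - 3 * z\<^sup>2) 0 * (- (6 * z))) (at z within UNIV)" using deriv by simp
      show "norm (2 * max (1 - 3 * z\<^sup>2) 0 * (- (6 * z))) \<le> 12"
      proof (cases "\<bar>z\<bar> \<le> 1")
        case True
        have "norm (2 * max (1 - 3 * z\<^sup>2) 0 * (- (6 * z))) = 12 * (max (1 - 3 * z\<^sup>2) 0 * \<bar>z\<bar>)"
          by (simp add: abs_mult)
        also have "\<dots> \<le> 12 * (1 * 1)" using True by (intro mult_left_mono mult_mono) auto
        finally show ?thesis by simp
      next
        case False
        then have "1 \<le> z\<^sup>2" using abs_le_square_iff[of 1 z] by simp
        then show ?thesis by (simp add: max_def)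
      qed
    qed auto
    then show ?thesis by simp
  qed
  moreover have "0 \<le> \<xi> t \<and> \<xi> t \<le> 1" for t
    unfolding \<xi>_def by (auto intro!: power_le_one)
  moreover have low: "1 / 16 \<le> \<xi> t" if "0 \<le> t" "t < 1 / 2" for t
  proof -
    have "t\<^sup>2 \<le> (1 / 2)\<^sup>2" using that by (intro power_mono) auto
    then have "t\<^sup>2 \<le> 1 / 4" by (simp add: power_divide)
    then have q: "1 / 4 \<le> max (1 - 3 * t\<^sup>2) 0" by linarith
    have "1 / 16 = (1 / 4 :: real)\<^sup>2" by (simp add: power_divide)
    also have "\<dots> \<le> (max (1 - 3 * t\<^sup>2) 0)\<^sup>2" by (rule power_mono[OF q]) simp
    finally show ?thesis unfolding \<xi>_def .
  qed
  moreover have "\<xi> t = 0" if "sqrt 3 / 3 \<le> t" for t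
  proof -
    have "(sqrt 3 / 3)\<^sup>2 \<le> t\<^sup>2" using that by (intro power_mono) auto
    then have "1 - 3 * t\<^sup>2 \<le> 0" by (simp add: power_divide)
    then show ?thesis unfolding \<xi>_def by (simp add: max_def)
  qed
  moreover have "\<exists>l'. ((\<lambda>t. \<xi> (sqrt (g t))) has_real_derivative l') (at 0)"
    if g: "(g has_real_derivative l) (at 0)" "\<And>t. 0 \<le> g t" for g l
  proof -
    have "((\<lambda>t. 1 - 3 * g t) has_real_derivative 0 - 3 * l) (at 0)"
      by (intro DERIV_diff DERIV_const DERIV_cmult g(1))
    from DERIV_chain2[OF DERIV_max_0_square this]
    show ?thesis unfolding \<xi>_def using g(2) by auto
  qed
  moreover have "\<exists>c>0. \<forall>t. 0 \<le> t \<and> t < 1 / 2 \<longrightarrow> c \<le> \<xi> t"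
    using low by (intro exI[of _ "1 / 16"]) simp
  ultimately have "admissible_cutoff \<xi>" unfolding admissible_cutoff_def by blast
  moreover have "\<xi> 0 = 1" unfolding \<xi>_def by simp
  ultimately show ?thesis by blast
qed

section \<open>The explicit counterexamples\<close>

context thin_set
begin

lemma norm_square_split: "(norm x)\<^sup>2 = (norm (first_coords k x))\<^sup>2 + (norm (last_coords k x))\<^sup>2" for x :: "real ^ 'n::{finite,linorder}"
proof -
  show ?thesis unfolding norm_square_cart sum.distrib[symmetric]
    by (intro sum.cong) (auto simp: first_coords_def last_coords_def)
qed

text \<open>The triangle inequality, since \<open>C\<close> is within distance \<open>a\<close> of the origin.\<close>
lemma norm_first_coords_le_d:
  assumes "C \<subseteq> {- a..a}"
  shows "norm (first_coords k x) \<le> d x + a"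
proof (rule power2_le_imp_le)
  obtain c where c: "c \<in> C" "infdist (x $ i0) C = \<bar>x $ i0 - c\<bar>" by (rule nearest_point)
  have "c \<in> {- a..a}" using c(1) assms by (rule subsetD[rotated])
  then have ca: "\<bar>c\<bar> \<le> a" by (simp add: abs_le_iff)
  then have a: "0 \<le> a" by linarith
  let ?\<delta> = "infdist (x $ i0) C"
  have "\<bar>x $ i0\<bar> \<le> ?\<delta> + a" using c(2) ca by linarith
  then have "\<bar>x $ i0\<bar>\<^sup>2 \<le> (?\<delta> + a)\<^sup>2" by (intro power_mono) auto
  moreover have "(norm (first_coords k x))\<^sup>2 = (\<Sum>i\<in>J. (x $ i)\<^sup>2) + (x $ i0)\<^sup>2"
    using norm_first_coords_diff[of x 0] by (simp add: axis_def zero_vec_def[symmetric] cong: if_cong)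
  ultimately have "(norm (first_coords k x))\<^sup>2 \<le> (d x)\<^sup>2 + 2 * ?\<delta> * a + a\<^sup>2"
    unfolding d_sqr by (simp add: power2_sum)
  also have "\<dots> \<le> (d x + a)\<^sup>2" using infdist_le_d[of x] a by (simp add: power2_sum mult_right_mono)
  finally show "(norm (first_coords k x))\<^sup>2 \<le> (d x + a)\<^sup>2" .
  show "0 \<le> d x + a" using a d_nonneg[of x] by simp
qed

text \<open>The condition on \<open>\<beta>\<close> and \<open>a\<close> puts the support into the unit ball: there \<open>|x'| < 1 / \<beta> + a\<close> and
  \<open>|x''|\<^sup>2 < 1 / 3\<close>.\<close>
lemma embedding_counterexample_cutoff:
  assumes p: "1 < p" "p < real k - \<theta>" and q: "(real k - \<theta>) * p / (real k - \<theta> - p) < q"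
    and \<alpha>: "(real k - \<theta>) / q \<le> \<alpha>" "\<alpha> < (real k - \<theta> - p) / p"
    and \<beta>: "0 < \<beta>" and C: "C \<subseteq> {- a..a}" and a: "0 \<le> a" "(1 / \<beta> + a)\<^sup>2 + 1 / 3 \<le> 1"
    and \<xi>: "admissible_cutoff \<xi>"
  shows "embedding_counterexample p (real k - \<theta>) q
    (\<lambda>x. max (d x powr (- \<alpha>) - \<beta> powr \<alpha>) 0 * \<xi> (norm (last_coords k x)))"
proof -
  let ?lam = "real k - \<theta>"
  have lp: "0 < ?lam * p / (?lam - p)" using p by (intro divide_pos_pos mult_pos_pos) auto
  then have q0: "0 < q" using q by linarith
  have "0 < ?lam / q" using q0 p by (intro divide_pos_pos) auto
  then have \<alpha>0: "0 < \<alpha>" using \<alpha> by linarith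
  have \<alpha>p: "(\<alpha> + 1) * p < ?lam" using \<alpha>(2) p by (simp add: field_simps)
  have \<alpha>q: "?lam \<le> \<alpha> * q" using \<alpha>(1) q0 by (simp add: field_simps)
  note adm = \<xi>[unfolded admissible_cutoff_def]
  note adm1 = adm[THEN conjunct1] and adm2 = adm[THEN conjunct2, THEN conjunct1]
    and adm3 = adm[THEN conjunct2, THEN conjunct2, THEN conjunct1]
    and adm4 = adm[THEN conjunct2, THEN conjunct2, THEN conjunct2, THEN conjunct1]
    and adm5 = adm[THEN conjunct2, THEN conjunct2, THEN conjunct2, THEN conjunct2]
  obtain L where L': "\<forall>s\<ge>0. \<forall>t\<ge>0. \<bar>\<xi> s - \<xi> t\<bar> \<le> L * \<bar>s - t\<bar>"
    using adm1 by (rule exE)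
  then have L: "\<bar>\<xi> s - \<xi> t\<bar> \<le> L * \<bar>s - t\<bar>" if "0 \<le> s" "0 \<le> t" for s t using that by simp
  obtain c0 where c0': "c0 > 0 \<and> (\<forall>t. 0 \<le> t \<and> t < 1 / 2 \<longrightarrow> c0 \<le> \<xi> t)"
    using adm3 by (rule exE)
  have c0: "0 < c0" using c0' by (rule conjunct1)
  have c0_le: "c0 \<le> \<xi> t" if "0 \<le> t" "t < 1 / 2" for t using c0' that by simp
  have range: "0 \<le> \<xi> t" "\<xi> t \<le> 1" if "0 \<le> t" for t using adm2 that by simp_all
  have zero: "\<xi> t = 0" if "sqrt 3 / 3 \<le> t" for t using adm4 that by simp
  have sqrt_deriv: "\<exists>l'. ((\<lambda>t. \<xi> (sqrt (g t))) has_real_derivative l') (at 0)"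
    if "(g has_real_derivative l) (at 0)" "\<And>t. 0 \<le> g t" for g l
    by (rule adm5[rule_format, of g l]) (use that in simp)
  have L0: "0 \<le> L" using L[of 0 1] by (simp add: order_trans[OF abs_ge_zero])
  let ?\<eta> = "\<lambda>x :: real ^ 'n::{finite,linorder}. \<xi> (norm (last_coords k x))"
  have \<eta>_lipschitz: "L-lipschitz_on UNIV ?\<eta>"
  proof (rule lipschitz_onI)
    fix x y :: "real ^ 'n::{finite,linorder}"

    have "\<bar>?\<eta> x - ?\<eta> y\<bar> \<le> L * \<bar>norm (last_coords k x) - norm (last_coords k y)\<bar>" by (intro L) auto
    also have "\<dots> \<le> L * norm (last_coords k x - last_coords k y)"
      using L0 by (intro mult_left_mono norm_triangle_ineq3)
    also have "\<dots> \<le> L * norm (x - y)"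
      using L0 by (intro mult_left_mono norm_le_componentwise_cart) (auto simp: last_coords_def)
    finally show "dist (?\<eta> x) (?\<eta> y) \<le> L * dist x y" by (simp add: dist_norm)
  qed (rule L0)
  interpret profile_of_distance d ?lam p \<alpha> q \<beta> L c0 ?\<eta>
  proof unfold_locales
    show "AE x in lborel. \<forall>i. \<exists>l. has_partial_deriv ?\<eta> i x l"
    proof (intro AE_I2 allI)
      fix x :: "real ^ 'n::{finite,linorder}" and i
      let ?y = "last_coords k x" and ?v = "last_coords k (axis i 1) :: real ^ 'n::{finite,linorder}"
      let ?g = "\<lambda>t. (?y + t *\<^sub>R ?v) \<bullet> (?y + t *\<^sub>R ?v)"
      have "last_coords k (x + t *\<^sub>R axis i 1) = ?y + t *\<^sub>R ?v" for t
        by (simp add: vec_eq_iff last_coords_def)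
      then have eq: "?\<eta> (x + t *\<^sub>R axis i 1) = \<xi> (sqrt (?g t))" for t by (simp add: norm_eq_sqrt_inner)
      have "?g = (\<lambda>t. ?y \<bullet> ?y + 2 * t * (?y \<bullet> ?v) + t\<^sup>2 * (?v \<bullet> ?v))"
        by (simp add: fun_eq_iff inner_add_left inner_add_right inner_commute[of ?v ?y] power2_eq_square algebra_simps)
      moreover have "((\<lambda>t. ?y \<bullet> ?y + 2 * t * (?y \<bullet> ?v) + t\<^sup>2 * (?v \<bullet> ?v)) has_real_derivative 2 * (?y \<bullet> ?v)) (at 0)"
        by (auto intro!: derivative_eq_intros)
      ultimately have "(?g has_real_derivative 2 * (?y \<bullet> ?v)) (at 0)" by simp
      then show "\<exists>l. has_partial_deriv ?\<eta> i x l" unfolding eq by (rule sqrt_deriv) simp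
    qed
    show "norm x < 1" if x: "d x < 1 / \<beta>" "?\<eta> x \<noteq> 0" for x
    proof -
      have "norm (last_coords k x) < sqrt 3 / 3" using zero[of "norm (last_coords k x)"] x(2) by fastforce
      then have "(norm (last_coords k x))\<^sup>2 \<le> (sqrt 3 / 3)\<^sup>2" by (intro power_mono) auto
      then have 1: "(norm (last_coords k x))\<^sup>2 \<le> 1 / 3" by (simp add: power_divide)
      have "norm (first_coords k x) < 1 / \<beta> + a" using norm_first_coords_le_d[OF C, of x] x(1) by linarith
      then have "(norm (first_coords k x))\<^sup>2 < (1 / \<beta> + a)\<^sup>2" by (intro power_strict_mono) auto
      then have "(norm x)\<^sup>2 < 1\<^sup>2" using 1 a(2) unfolding norm_square_split[of x] by simp
      then show ?thesis by (rule power2_less_imp_less) simp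
    qed
    obtain c where c: "c > 0 \<and> (\<forall>\<epsilon>>0. \<exists>t. 0 < t \<and> t < \<epsilon> \<and>
      ennreal (c * t powr ?lam) \<le> emeasure lborel {x. d x < t \<and> norm (last_coords k x) < 1 / 2})"
      using d_lower by (rule exE)
    have [measurable]: "?\<eta> \<in> borel_measurable borel"
      using lipschitz_on_continuous_on[OF \<eta>_lipschitz] by (rule borel_measurable_continuous_onI)
    have mono: "emeasure lborel {x. d x < t \<and> norm (last_coords k x) < 1 / 2} \<le> emeasure lborel {x. d x < t \<and> c0 \<le> ?\<eta> x}" for t
      by (rule emeasure_mono) (use c0_le in auto)
    show "\<exists>c>0. \<forall>\<epsilon>>0. \<exists>t. 0 < t \<and> t < \<epsilon> \<and> ennreal (c * t powr ?lam) \<le> emeasure lborel {x. d x < t \<and> c0 \<le> ?\<eta> x}"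
    proof (rule exI[of _ c], intro conjI allI impI)
      show "0 < c" using c by (rule conjunct1)
      fix \<epsilon> :: real assume "0 < \<epsilon>"
      then obtain t where t: "0 < t" "t < \<epsilon>"
        "ennreal (c * t powr ?lam) \<le> emeasure lborel {x. d x < t \<and> norm (last_coords k x) < 1 / 2}"
        using c[THEN conjunct2, rule_format, of \<epsilon>] by blast
      from t(3) mono have "ennreal (c * t powr ?lam) \<le> emeasure lborel {x. d x < t \<and> c0 \<le> ?\<eta> x}"
        by (rule order_trans)
      then show "\<exists>t. 0 < t \<and> t < \<epsilon> \<and> ennreal (c * t powr ?lam) \<le> emeasure lborel {x. d x < t \<and> c0 \<le> ?\<eta> x}"
        using t(1,2) by blast
    qed
    show "0 \<le> ?\<eta> x" "?\<eta> x \<le> 1" for x using range[of "norm (last_coords k x)"] by simp_all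
  qed (fact \<eta>_lipschitz p(1) \<alpha>0 \<alpha>p q0 \<alpha>q \<beta> d_sqr_partial_deriv c0)+
  have "u = (\<lambda>x. max (d x powr (- \<alpha>) - \<beta> powr \<alpha>) 0 * ?\<eta> x)" by (simp add: fun_eq_iff u_def)
  then show ?thesis using embedding_counterexample_u by simp
qed

end

lemma coord_with_pos:
  assumes "1 \<le> k" "k \<le> CARD('n::{finite,linorder})"
  obtains i0 :: "'n::{finite,linorder}" where "Suc (coord_pos i0) = k"
proof -
  have "k - 1 \<in> range (coord_pos :: 'n \<Rightarrow> nat)" unfolding range_coord_pos using assms by auto
  then obtain i0 :: 'n where "k - 1 = coord_pos i0" by blast
  then show ?thesis using assms that[of i0] by simp
qed

lemma embedding_counterexample_integer:
  fixes p lam q :: real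
  assumes p: "1 < p" "p < lam" and lam: "lam < real CARD('n::{finite,linorder})" "lam = real m"
    and q: "lam * p / (lam - p) < q" and \<alpha>: "lam / q \<le> \<alpha>" "\<alpha> < (lam - p) / p"
    and \<xi>: "admissible_cutoff \<xi>"
  shows "embedding_counterexample p lam q
    (\<lambda>x :: real ^ 'n::{finite,linorder}. max (norm (first_coords m x) powr (- \<alpha>) - 2 powr \<alpha>) 0 * \<xi> (norm (last_coords m x)))"
proof -
  have m: "1 \<le> m" "m \<le> CARD('n)" using p lam by auto
  obtain i0 :: 'n where i0: "Suc (coord_pos i0) = m" using coord_with_pos[OF m] by blast
  interpret thin_set m i0 "{0}" 0
    by unfold_locales (use m i0 lam upper_regular_singleton lower_regular_singleton in auto)
  have "E = {0}" by (auto simp: vec_eq_iff)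
  then have d: "d x = norm (first_coords m x)" for x :: "real ^ 'n::{finite,linorder}"
    using d_eq_infdist[of x] by (simp add: infdist_singleton)
  have "embedding_counterexample p (real m - 0) q
    (\<lambda>x. max (d x powr (- \<alpha>) - 2 powr \<alpha>) 0 * \<xi> (norm (last_coords m x)))"
    by (rule embedding_counterexample_cutoff[where a = 0]) (use assms in \<open>auto simp: power2_eq_square\<close>)
  then show ?thesis unfolding d using lam by simp
qed

lemma cantor_ratio_codim:
  assumes "real k - 1 < lam" "lam < real k"
  shows "cantor_ratio (2 powr (- 1 / (real k - lam))) (real k - lam) (1 - 2 powr (1 - 1 / (real k - lam)))"
proof
  let ?\<theta> = "real k - lam"
  show "2 powr (- 1 / ?\<theta>) < 1 / (2 :: real)"
  proof -
    have "- 1 / ?\<theta> < - 1" using assms by (simp add: field_simps)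
    then have "2 powr (- 1 / ?\<theta>) < (2 :: real) powr (- 1)" by (intro powr_less_mono) auto
    then show ?thesis by (simp add: powr_minus_divide)
  qed
  show "2 * (2 powr (- 1 / ?\<theta>)) powr ?\<theta> = 1"
  proof -
    have "- 1 / ?\<theta> * ?\<theta> = - 1" using assms by simp
    then have "(2 powr (- 1 / ?\<theta>)) powr ?\<theta> = (2 :: real) powr (- 1)" by (simp only: powr_powr)
    then show ?thesis by (simp add: powr_minus_divide)
  qed
  show "2 powr (- 1 / ?\<theta>) = (1 - (1 - 2 powr (1 - 1 / ?\<theta>))) / 2"
    by (simp add: powr_diff powr_minus_divide)
qed (use assms in auto)

lemma thin_set_cantor:
  assumes "real k - 1 < lam" "lam < real k" "lam < real CARD('n::{finite,linorder})" "k \<le> CARD('n)" "1 < lam"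
    and "Suc (coord_pos (i0 :: 'n)) = k"
  shows "thin_set k i0 (cantor_set (1 - 2 powr (1 - 1 / (real k - lam)))) (real k - lam)"
proof -
  interpret cantor_ratio "2 powr (- 1 / (real k - lam))" "real k - lam" "1 - 2 powr (1 - 1 / (real k - lam))"
    using assms by (intro cantor_ratio_codim) auto
  show ?thesis
  proof
    show "cantor_set (1 - 2 powr (1 - 1 / (real k - lam))) \<noteq> {}"
      using cantor_left_in_cantor_set[OF \<rho>_le_1 \<rho>_eq, of 0 0] by auto
  qed (use assms closed_cantor_set upper_regular_cantor lower_regular_cantor in auto)
qed

lemma embedding_counterexample_cantor:
  fixes p lam q :: real
  assumes p: "1 < p" "p < lam" and lam: "lam < real CARD('n::{finite,linorder})"
    and k: "k \<le> CARD('n)" "real k - 1 < lam" "lam < real k"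
    and q: "lam * p / (lam - p) < q" and \<alpha>: "lam / q \<le> \<alpha>" "\<alpha> < (lam - p) / p"
    and \<xi>: "admissible_cutoff \<xi>"
  shows "embedding_counterexample p lam q
    (\<lambda>x :: real ^ 'n::{finite,linorder}. max (infdist (first_coords k x) (cantor_embedded k lam) powr (- \<alpha>) - 4 powr \<alpha>) 0
       * \<xi> (norm (last_coords k x)))"
proof -
  have k1: "1 \<le> k" using p k by linarith
  obtain i0 :: 'n where i0: "Suc (coord_pos i0) = k" using coord_with_pos[OF k1 k(1)] by blast
  let ?C = "cantor_set (1 - 2 powr (1 - 1 / (real k - lam)))"
  interpret thin_set k i0 ?C "real k - lam"
    using assms i0 by (intro thin_set_cantor) auto
  have E: "E = cantor_embedded k lam" unfolding cantor_embedded_def ..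
  have "embedding_counterexample p (real k - (real k - lam)) q
    (\<lambda>x. max (d x powr (- \<alpha>) - 4 powr \<alpha>) 0 * \<xi> (norm (last_coords k x)))"
    by (rule embedding_counterexample_cutoff[where a = "1 / 2"])
      (use assms cantor_set_subset in \<open>auto simp: power2_eq_square\<close>)
  then show ?thesis unfolding d_eq_infdist[symmetric] E by simp
qed

lemma hausdorff_dimension_cantor_embedded:
  assumes "1 < lam" "lam < real CARD('n::{finite,linorder})" "k \<le> CARD('n)" "real k - 1 < lam" "lam < real k"
  shows "hausdorff_dimension (cantor_embedded k lam :: (real ^ 'n::{finite,linorder}) set) = real k - lam"
proof -
  have k1: "1 \<le> k" using assms by linarith
  obtain i0 :: 'n where i0: "Suc (coord_pos i0) = k" using coord_with_pos[OF k1 assms(3)] by blast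
  interpret cantor_ratio "2 powr (- 1 / (real k - lam))" "real k - lam" "1 - 2 powr (1 - 1 / (real k - lam))"
    using assms by (intro cantor_ratio_codim) auto
  interpret thin_set k i0 "cantor_set (1 - 2 powr (1 - 1 / (real k - lam)))" "real k - lam"
    using assms i0 by (intro thin_set_cantor) auto
  have "dist (axis i0 s :: real ^ 'n::{finite,linorder}) (axis i0 s') = \<bar>s - s'\<bar>" for s s' :: real
  proof -
    have "axis i0 s - axis i0 s' = (s - s') *\<^sub>R (axis i0 1 :: real ^ 'n::{finite,linorder})" by (simp add: vec_eq_iff axis_def)
    then show ?thesis by (simp add: dist_norm)
  qed
  then show ?thesis
    unfolding cantor_embedded_def E_eq by (rule hausdorff_dimension_cantor)
qed

text \<open>The hypothesis on \<open>q\<close> says exactly that the interval of admissible \<open>\<alpha>\<close> is not empty.\<close>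
lemma exists_embedding_counterexample:
  fixes p lam q :: real
  assumes p: "1 < p" "p < lam" and lam: "lam < real CARD('n::{finite,linorder})"
    and q: "lam * p / (lam - p) < q"
  shows "\<exists>u :: real ^ 'n::{finite,linorder} \<Rightarrow> real. embedding_counterexample p lam q u"
proof -
  obtain \<xi> where \<xi>: "admissible_cutoff \<xi>" using admissible_cutoff_exists by blast
  have "0 < lam * p / (lam - p)" using p by (intro divide_pos_pos mult_pos_pos) auto
  then have q0: "0 < q" using q by linarith
  have "lam * p < q * (lam - p)" using q p by (simp add: pos_divide_less_eq)
  then have "lam < (lam - p) * q / p" using p by (simp add: pos_less_divide_eq mult.commute)
  then have "lam / q < (lam - p) / p" using q0 by (simp add: pos_divide_less_eq)
  then obtain \<alpha> where \<alpha>: "lam / q \<le> \<alpha>" "\<alpha> < (lam - p) / p" by blast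
  show ?thesis
  proof (cases "\<exists>m. lam = real m")
    case True
    then show ?thesis using embedding_counterexample_integer[OF p lam _ q \<alpha> \<xi>] by blast
  next
    case False
    define k where "k = nat \<lceil>lam\<rceil>"
    have rk: "real k = of_int \<lceil>lam\<rceil>" unfolding k_def using p by simp
    have "lam \<le> real k" "real k - 1 < lam" unfolding rk by linarith+
    moreover have "lam \<noteq> real k" using False by blast
    moreover have "\<lceil>lam\<rceil> \<le> int CARD('n)" unfolding ceiling_le_iff using lam by simp
    then have "k \<le> CARD('n)" unfolding k_def by linarith
    ultimately show ?thesis using embedding_counterexample_cantor[OF p lam _ _ _ q \<alpha> \<xi>, of k] by auto
  qed
qed

theorem theorem1p3:
  fixes p lam q :: real
  assumes "1 < p" and "p < lam" and "lam < real CARD('n::{finite,linorder})"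
    and "q > lam * p / (lam - p)"
  shows "(\<exists>u :: real ^ 'n::{finite,linorder} \<Rightarrow> real. embedding_counterexample p lam q u) \<and>
    (\<forall>m::nat. lam = real m \<longrightarrow>
      (\<forall>\<alpha> \<xi>. lam / q \<le> \<alpha> \<and> \<alpha> < (lam - p) / p \<and> cutoff_function \<xi> \<longrightarrow>
        embedding_counterexample p lam q
          (\<lambda>x :: real ^ 'n::{finite,linorder}. max (norm (first_coords m x) powr (- \<alpha>) - 2 powr \<alpha>) 0
                            * \<xi> (norm (last_coords m x))))) \<and>
    (\<forall>k::nat. 2 \<le> k \<and> k \<le> CARD('n) \<and> real k - 1 < lam \<and> lam < real k \<longrightarrow>
      hausdorff_dimension (cantor_embedded k lam :: (real ^ 'n::{finite,linorder}) set) = real k - lam \<and>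
      (\<forall>\<alpha>. lam / q \<le> \<alpha> \<and> \<alpha> < (lam - p) / p \<longrightarrow>
        (k = CARD('n) \<longrightarrow>
          embedding_counterexample p lam q
            (\<lambda>x :: real ^ 'n::{finite,linorder}. max (infdist x (cantor_embedded k lam) powr (- \<alpha>) - 4 powr \<alpha>) 0)) \<and>
        (k < CARD('n) \<longrightarrow>
          (\<forall>\<xi>. cutoff_function \<xi> \<longrightarrow>
            embedding_counterexample p lam q
              (\<lambda>x :: real ^ 'n::{finite,linorder}.
                 max (infdist (first_coords k x) (cantor_embedded k lam) powr (- \<alpha>) - 4 powr \<alpha>) 0
                 * \<xi> (norm (last_coords k x)))))))"
proof (intro conjI allI impI; (elim conjE)?)
  show "\<exists>u :: real ^ 'n::{finite,linorder} \<Rightarrow> real. embedding_counterexample p lam q u"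
    using assms by (intro exists_embedding_counterexample) auto
next
  fix m :: nat and \<alpha> \<xi>
  assume "lam = real m" "lam / q \<le> \<alpha>" "\<alpha> < (lam - p) / p" "cutoff_function \<xi>"
  then show "embedding_counterexample p lam q
      (\<lambda>x :: real ^ 'n::{finite,linorder}. max (norm (first_coords m x) powr (- \<alpha>) - 2 powr \<alpha>) 0 * \<xi> (norm (last_coords m x)))"
    using assms admissible_cutoff_cutoff_function by (intro embedding_counterexample_integer) auto
next
  fix k :: nat
  assume "2 \<le> k" "k \<le> CARD('n)" "real k - 1 < lam" "lam < real k"
  then show "hausdorff_dimension (cantor_embedded k lam :: (real ^ 'n::{finite,linorder}) set) = real k - lam"
    using assms(1-3) by (intro hausdorff_dimension_cantor_embedded) auto
next
  fix k :: nat and \<alpha>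
  assume k: "k \<le> CARD('n)" "real k - 1 < lam" "lam < real k"
    and \<alpha>: "lam / q \<le> \<alpha>" "\<alpha> < (lam - p) / p" and kn: "k = CARD('n)"
  \<comment> \<open>For \<open>k = n\<close> there are no remaining coordinates, and a cutoff function evaluated at 0 is the constant 1.\<close>
  obtain \<xi> where \<xi>: "admissible_cutoff \<xi>" "\<xi> 0 = 1" using admissible_cutoff_exists by blast
  have pos: "coord_pos i < k" for i :: 'n using range_coord_pos[where ?'n = 'n] kn by auto
  have "first_coords k x = x" "last_coords k x = 0" for x :: "real ^ 'n::{finite,linorder}"
    using pos by (simp_all add: vec_eq_iff first_coords_def last_coords_def)
  then show "embedding_counterexample p lam q
      (\<lambda>x :: real ^ 'n::{finite,linorder}. max (infdist x (cantor_embedded k lam) powr (- \<alpha>) - 4 powr \<alpha>) 0)"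
    using embedding_counterexample_cantor[OF assms(1-3) k assms(4) \<alpha> \<xi>(1)] \<xi>(2) by simp
next
  fix k :: nat and \<alpha> \<xi>
  assume "k \<le> CARD('n)" "real k - 1 < lam" "lam < real k" "lam / q \<le> \<alpha>" "\<alpha> < (lam - p) / p" "cutoff_function \<xi>"
  then show "embedding_counterexample p lam q
      (\<lambda>x :: real ^ 'n::{finite,linorder}. max (infdist (first_coords k x) (cantor_embedded k lam) powr (- \<alpha>) - 4 powr \<alpha>) 0
        * \<xi> (norm (last_coords k x)))"
    using assms admissible_cutoff_cutoff_function by (intro embedding_counterexample_cantor) auto
qed

end
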